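(* Let $\mathrm{N}\langle x_1,\ldots,x_n\rangle$ be the free Novikov algebra over a field $k$ of characteristic $0$ in the variables $x_1,\ldots,x_n$. Suppose that $f\in \mathrm{N}\langle x_1,\ldots,x_n\rangle$ and $f\notin \mathrm{N}\langle x_1,\ldots,x_{n-1}\rangle$. Then the subalgebra of the quotient algebra $\mathrm{N}\langle x_1,\ldots,x_n\rangle/\mathrm{id}(f)$ generated by $x_1+\mathrm{id}(f),\ldots,x_{n-1}+\mathrm{id}(f)$ is a free Novikov algebra with free generators $x_1+\mathrm{id}(f),\ldots,x_{n-1}+\mathrm{id}(f)$.
   Context: Algebras are $k$-vector spaces with a $k$-bilinear multiplication, not assumed associative or unital. A Novikov algebra is an algebra satisfying the identities $(xy)z-x(yz)=(xz)y-x(zy)$ and $x(yz)=y(xz)$. $\mathrm{N}\langle x_1,\ldots,x_n\rangle$ is the free (non-unital) algebra on $x_1,\ldots,x_n$ in the variety of Novikov algebras over $k$, and $\mathrm{N}\langle x_1,\ldots,x_{n-1}\rangle$ is regarded as its subalgebra generated by $x_1,\ldots,x_{n-1}$. $\mathrm{id}(f)$ denotes the (two-sided) ideal of $\mathrm{N}\langle x_1,\ldots,x_n\rangle$ generated by $f$. *)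

theory Defs
  imports "HOL.Hull" "HOL-Algebra.QuotRing" "HOL-Algebra.Module"
begin

text \<open>
  The scalars form a type of class \<open>field\<close>. An algebra is a \<open>module\<close> record of HOL-Algebra
  whose field \<open>one\<close> carries no information: it occurs in no axiom, and in the definitions below
  only as a dummy value. Algebras need not be associative or unital.
\<close>

locale nonassoc_algebra = abelian_group A
  for A :: "('k::field, 'a) module" (structure) +
  assumes smult_closed: "x \<in> carrier A \<Longrightarrow> c \<odot> x \<in> carrier A"
    and smult_l_distr: "x \<in> carrier A \<Longrightarrow> (c + d) \<odot> x = c \<odot> x \<oplus> d \<odot> x"
    and smult_r_distr:
      "\<lbrakk>x \<in> carrier A; y \<in> carrier A\<rbrakk> \<Longrightarrow> c \<odot> (x \<oplus> y) = c \<odot> x \<oplus> c \<odot> y"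
    and smult_smult: "x \<in> carrier A \<Longrightarrow> (c * d) \<odot> x = c \<odot> (d \<odot> x)"
    and smult_one: "x \<in> carrier A \<Longrightarrow> 1 \<odot> x = x"
    and mult_closed: "\<lbrakk>x \<in> carrier A; y \<in> carrier A\<rbrakk> \<Longrightarrow> x \<otimes> y \<in> carrier A"
    and mult_l_distr:
      "\<lbrakk>x \<in> carrier A; y \<in> carrier A; z \<in> carrier A\<rbrakk> \<Longrightarrow> (x \<oplus> y) \<otimes> z = x \<otimes> z \<oplus> y \<otimes> z"
    and mult_r_distr:
      "\<lbrakk>x \<in> carrier A; y \<in> carrier A; z \<in> carrier A\<rbrakk> \<Longrightarrow> x \<otimes> (y \<oplus> z) = x \<otimes> y \<oplus> x \<otimes> z"
    and mult_smult_l: "\<lbrakk>x \<in> carrier A; y \<in> carrier A\<rbrakk> \<Longrightarrow> (c \<odot> x) \<otimes> y = c \<odot> (x \<otimes> y)"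
    and mult_smult_r: "\<lbrakk>x \<in> carrier A; y \<in> carrier A\<rbrakk> \<Longrightarrow> x \<otimes> (c \<odot> y) = c \<odot> (x \<otimes> y)"

locale novikov_algebra = nonassoc_algebra +
  assumes right_symmetric:
      "\<lbrakk>x \<in> carrier A; y \<in> carrier A; z \<in> carrier A\<rbrakk> \<Longrightarrow>
        (x \<otimes> y) \<otimes> z \<ominus> x \<otimes> (y \<otimes> z) = (x \<otimes> z) \<otimes> y \<ominus> x \<otimes> (z \<otimes> y)"
    and left_commutative:
      "\<lbrakk>x \<in> carrier A; y \<in> carrier A; z \<in> carrier A\<rbrakk> \<Longrightarrow> x \<otimes> (y \<otimes> z) = y \<otimes> (x \<otimes> z)"

definition is_subalgebra :: "('k, 'a) module \<Rightarrow> 'a set \<Rightarrow> bool" where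
  "is_subalgebra A S \<longleftrightarrow> additive_subgroup S A \<and>
    (\<forall>c. \<forall>x\<in>S. c \<odot>\<^bsub>A\<^esub> x \<in> S) \<and> (\<forall>x\<in>S. \<forall>y\<in>S. x \<otimes>\<^bsub>A\<^esub> y \<in> S)"

definition is_algebra_ideal :: "('k, 'a) module \<Rightarrow> 'a set \<Rightarrow> bool" where
  "is_algebra_ideal A I \<longleftrightarrow> additive_subgroup I A \<and> (\<forall>c. \<forall>x\<in>I. c \<odot>\<^bsub>A\<^esub> x \<in> I) \<and>
    (\<forall>a\<in>carrier A. \<forall>x\<in>I. a \<otimes>\<^bsub>A\<^esub> x \<in> I \<and> x \<otimes>\<^bsub>A\<^esub> a \<in> I)"

definition generated_subalgebra :: "('k, 'a) module \<Rightarrow> 'a set \<Rightarrow> 'a set" where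
  "generated_subalgebra A S = is_subalgebra A hull S"

definition generated_ideal :: "('k, 'a) module \<Rightarrow> 'a set \<Rightarrow> 'a set" where
  "generated_ideal A S = is_algebra_ideal A hull S"

definition quotient_algebra :: "('k, 'a) module \<Rightarrow> 'a set \<Rightarrow> ('k, 'a set) module" where
  "quotient_algebra A I =
    \<lparr>carrier = a_rcosets\<^bsub>A\<^esub> I, mult = rcoset_mult A I, one = I +>\<^bsub>A\<^esub> \<one>\<^bsub>A\<^esub>, zero = I,
     add = set_add A, smult = (\<lambda>c X. \<Union>x\<in>X. I +>\<^bsub>A\<^esub> (c \<odot>\<^bsub>A\<^esub> x))\<rparr>"

definition algebra_hom :: "('k, 'a) module \<Rightarrow> ('k, 'b) module \<Rightarrow> ('a \<Rightarrow> 'b) set" where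
  "algebra_hom A B = {h \<in> carrier A \<rightarrow>\<^sub>E carrier B.
    (\<forall>x\<in>carrier A. \<forall>y\<in>carrier A. h (x \<oplus>\<^bsub>A\<^esub> y) = h x \<oplus>\<^bsub>B\<^esub> h y \<and> h (x \<otimes>\<^bsub>A\<^esub> y) = h x \<otimes>\<^bsub>B\<^esub> h y) \<and>
    (\<forall>c. \<forall>x\<in>carrier A. h (c \<odot>\<^bsub>A\<^esub> x) = c \<odot>\<^bsub>B\<^esub> h x)}"

text \<open>
  Being a free Novikov algebra with free generators \<open>y i\<close> (\<open>i \<in> I\<close>) is the universal property
  in the variety of Novikov algebras. A HOL definition cannot quantify over types, so the type
  \<open>'b\<close> containing the test algebras is a parameter; a theorem that leaves \<open>'b\<close> a type variable
  asserts the universal property with respect to all Novikov algebras.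
\<close>

definition free_novikov_generators ::
  "'b itself \<Rightarrow> ('k::field, 'a) module \<Rightarrow> 'i set \<Rightarrow> ('i \<Rightarrow> 'a) \<Rightarrow> bool" where
  "free_novikov_generators TYPE('b) A I y \<longleftrightarrow>
    novikov_algebra A \<and> y \<in> I \<rightarrow> carrier A \<and>
    (\<forall>(B :: ('k, 'b) module) b. novikov_algebra B \<longrightarrow> b \<in> I \<rightarrow> carrier B \<longrightarrow>
      (\<exists>!h. h \<in> algebra_hom A B \<and> (\<forall>i\<in>I. h (y i) = b i)))"

datatype (gens: 'v) magma = Gen 'v | Mul "'v magma" "'v magma"

text \<open>
  The free nonassociative algebra on \<open>X\<close>: finitely supported functions on the nonassociative
  words over \<open>X\<close>. Such a word of length at least two is a product of two words in exactly one
  way, so the convolution product has a single term at each word.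
\<close>

definition free_nonassoc_algebra :: "'v set \<Rightarrow> ('k::field, 'v magma \<Rightarrow> 'k) module" where
  "free_nonassoc_algebra X =
    \<lparr>carrier = {p. finite {w. p w \<noteq> 0} \<and> (\<forall>w. p w \<noteq> 0 \<longrightarrow> gens w \<subseteq> X)},
     mult = (\<lambda>p q w. case w of Gen v \<Rightarrow> 0 | Mul u v \<Rightarrow> p u * q v),
     one = (\<lambda>w. 0), zero = (\<lambda>w. 0), add = (\<lambda>p q w. p w + q w),
     smult = (\<lambda>c p w. c * p w)\<rparr>"

definition novikov_defects :: "('k, 'a) module \<Rightarrow> 'a set" where
  "novikov_defects A =
    {((x \<otimes>\<^bsub>A\<^esub> y) \<otimes>\<^bsub>A\<^esub> z \<ominus>\<^bsub>A\<^esub> x \<otimes>\<^bsub>A\<^esub> (y \<otimes>\<^bsub>A\<^esub> z)) \<ominus>\<^bsub>A\<^esub>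
      ((x \<otimes>\<^bsub>A\<^esub> z) \<otimes>\<^bsub>A\<^esub> y \<ominus>\<^bsub>A\<^esub> x \<otimes>\<^bsub>A\<^esub> (z \<otimes>\<^bsub>A\<^esub> y)) | x y z.
        x \<in> carrier A \<and> y \<in> carrier A \<and> z \<in> carrier A} \<union>
    {x \<otimes>\<^bsub>A\<^esub> (y \<otimes>\<^bsub>A\<^esub> z) \<ominus>\<^bsub>A\<^esub> y \<otimes>\<^bsub>A\<^esub> (x \<otimes>\<^bsub>A\<^esub> z) | x y z.
        x \<in> carrier A \<and> y \<in> carrier A \<and> z \<in> carrier A}"

definition novikov_ideal :: "'v set \<Rightarrow> ('v magma \<Rightarrow> 'k::field) set" where
  "novikov_ideal X =
    generated_ideal (free_nonassoc_algebra X) (novikov_defects (free_nonassoc_algebra X))"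

definition free_novikov :: "'v set \<Rightarrow> ('k::field, ('v magma \<Rightarrow> 'k) set) module" where
  "free_novikov X = quotient_algebra (free_nonassoc_algebra X) (novikov_ideal X)"

definition novikov_gen :: "'v set \<Rightarrow> 'v \<Rightarrow> ('v magma \<Rightarrow> 'k::field) set" where
  "novikov_gen X v =
    novikov_ideal X +>\<^bsub>free_nonassoc_algebra X :: ('k, _) module\<^esub> (\<lambda>w. if w = Gen v then 1 else 0)"

end

theory Submission
  imports Defs "HOL-Library.Poly_Mapping" "HOL-Library.Multiset_Order" "HOL-Library.Product_Lexorder"
    "HOL-Algebra.Algebraic_Closure_Type"
begin

text \<open>
  In a commutative algebra with a derivation, \<open>x \<diamondop> y = x' y\<close> is a Novikov product. The proof
  rests on two facts about this construction.

  First, the free Novikov algebra embeds into differential polynomials in its generators. A product of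
  derivatives \<open>x\<^sub>i\<^sup>(\<^sup>j\<^sup>)\<close> has weight the sum of the \<open>j - 1\<close>; Novikov words expand into monomials of
  weight \<open>-1\<close>. Conversely every such monomial is the image of an element built from the
  generators by iterated braces \<open>a\<^sup>(\<^sup>k\<^sup>) y\<^sub>1 \<dots> y\<^sub>k\<close>, which make sense in any Novikov algebra. The
  element depends only on the monomial (\<open>rep_unique\<close>), and the span of these elements is closed under
  multiplication because the Leibniz rule holds for them (\<open>reps_mul\<close>). So they span the free
  algebra, and since distinct monomials are linearly independent, a Novikov polynomial whose
  differential polynomial vanishes is zero.

  Second, a differential polynomial that really involves \<open>x\<^sub>n\<close> has a solution \<open>x\<^sub>n\<close> even when the
  other variables are generic (\<open>differential_freiheitssatz\<close>). The differential ring used is the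
  ring of formal power series over an algebraically closed field containing enough independent
  transcendentals. The other variables are replaced by power series all of whose Taylor
  coefficients are independent. The lower Taylor coefficients of \<open>x\<^sub>n\<close>, below the order \<open>r\<close> of the
  polynomial in \<open>x\<^sub>n\<close>, are chosen independent as well; the next one is a root \<open>\<rho>\<close> of the resulting
  algebraic equation. Replacing the polynomial by a minimal relation of \<open>\<rho>\<close> makes the root simple
  (here characteristic \<open>0\<close> enters), and a simple root extends to a power series solution
  by successive approximation (\<open>ode_power_series_solution\<close>).

  For the Freiheitssatz itself, let \<open>f\<close> lie outside the subalgebra of the first \<open>n - 1\<close> generators. By the
  embedding its differential polynomial involves \<open>x\<^sub>n\<close>, since otherwise setting \<open>x\<^sub>n = 0\<close> would not
  change \<open>f\<close>. Solving \<open>f = 0\<close> gives a homomorphism to power series that kills \<open>id(f)\<close> and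
  sends the first \<open>n - 1\<close> generators to generic series. Hence a Novikov polynomial \<open>p\<close> in these generators
  that lies in \<open>id(f)\<close> vanishes at generic series, so it is an identity
  consequence, and it vanishes in every Novikov algebra. This is exactly what the universal property
  of the generated subalgebra of the quotient needs.
\<close>

section \<open>Monomials in an abstract Novikov algebra\<close>

lemma additive_sum_mset:
  fixes h :: "'a::ab_group_add \<Rightarrow> 'b::ab_group_add"
  assumes "\<And>x y. h (x + y) = h x + h y"
  shows "h (\<Sum>y\<in>#Y. f y) = (\<Sum>y\<in>#Y. h (f y))"
proof -
  have "h 0 = 0" using assms[of 0 0] by simp
  then show ?thesis by (induction Y) (auto simp: assms)
qed

lemma sum_mset_diff:
  fixes f g :: "'a \<Rightarrow> 'b::ab_group_add"
  shows "(\<Sum>y\<in>#Y. f y - g y) = (\<Sum>y\<in>#Y. f y) - (\<Sum>y\<in>#Y. g y)"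
  by (induction Y) (auto simp: algebra_simps)

text \<open>
  A whole type rather than a carrier set, so that linear spans are available; the free Novikov
  algebra is brought into this form by a type definition.
\<close>

locale novikov_space = vector_space scale
  for scale :: "'k::field \<Rightarrow> 'a::ab_group_add \<Rightarrow> 'a" +
  fixes mul :: "'a \<Rightarrow> 'a \<Rightarrow> 'a" (infixl "\<diamondop>" 70)
  assumes add_l: "(x + y) \<diamondop> z = x \<diamondop> z + y \<diamondop> z"
    and add_r: "x \<diamondop> (y + z) = x \<diamondop> y + x \<diamondop> z"
    and scale_l: "scale c x \<diamondop> y = scale c (x \<diamondop> y)"
    and scale_r: "x \<diamondop> scale c y = scale c (x \<diamondop> y)"
    and rsym: "(x \<diamondop> y) \<diamondop> z - x \<diamondop> (y \<diamondop> z) = (x \<diamondop> z) \<diamondop> y - x \<diamondop> (z \<diamondop> y)"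
    and lcomm: "x \<diamondop> (y \<diamondop> z) = y \<diamondop> (x \<diamondop> z)"
begin

lemma diff_l: "(x - y) \<diamondop> z = x \<diamondop> z - y \<diamondop> z"
  by (metis add_l add_diff_cancel_right' diff_add_cancel)

lemma diff_r: "x \<diamondop> (y - z) = x \<diamondop> y - x \<diamondop> z"
  by (metis add_r add_diff_cancel_right' diff_add_cancel)

lemma sum_l: "(\<Sum>y\<in>#Y. f y) \<diamondop> z = (\<Sum>y\<in>#Y. f y \<diamondop> z)"
  by (rule additive_sum_mset[where h = "\<lambda>x. x \<diamondop> z"]) (rule add_l)

lemma sum_r: "z \<diamondop> (\<Sum>y\<in>#Y. f y) = (\<Sum>y\<in>#Y. z \<diamondop> f y)"
  by (rule additive_sum_mset[where h = "\<lambda>x. z \<diamondop> x"]) (rule add_r)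

text \<open>
  When \<open>x \<diamondop> y = x' y\<close>, the brace of \<open>a\<close> with \<open>k\<close> elements \<open>Y\<close> is \<open>a\<^sup>(\<^sup>k\<^sup>) \<Prod>Y\<close>. The recursion is the Leibniz
  rule for \<open>(a\<^sup>(\<^sup>k\<^sup>) \<Prod>Y)' z\<close>, solved for the term with the highest derivative of \<open>a\<close>. Which element
  \<open>z\<close> is split off turns out to be immaterial (\<open>brace_rec\<close>).
\<close>

primrec brace_aux :: "nat \<Rightarrow> 'a \<Rightarrow> 'a multiset \<Rightarrow> 'a" where
  "brace_aux 0 a Y = a"
| "brace_aux (Suc k) a Y = (let z = SOME z. z \<in># Y; Y' = Y - {#z#} in
     brace_aux k a Y' \<diamondop> z - (\<Sum>y\<in>#Y'. y \<diamondop> brace_aux k a (add_mset z (Y' - {#y#}))))"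

definition brace :: "'a \<Rightarrow> 'a multiset \<Rightarrow> 'a" where
  "brace a Y = brace_aux (size Y) a Y"

lemma brace_empty [simp]: "brace a {#} = a"
  by (simp add: brace_def)

lemma brace_choice:
  assumes "z = (SOME z. z \<in># add_mset u U)" "Y = add_mset u U - {#z#}"
  shows "brace a (add_mset u U) = brace a Y \<diamondop> z - (\<Sum>y\<in>#Y. y \<diamondop> brace a (add_mset z (Y - {#y#})))"
proof -
  have z: "z \<in># add_mset u U"
    unfolding assms by (rule someI[where x=u]) simp
  have sz: "size Y = size U" using z assms(2) by (simp add: size_Diff_singleton)
  have "(\<Sum>y\<in>#Y. y \<diamondop> brace a (add_mset z (Y - {#y#})))
     = (\<Sum>y\<in>#Y. y \<diamondop> brace_aux (size U) a (add_mset z (Y - {#y#})))"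
  proof (rule arg_cong[where f=sum_mset], rule image_mset_cong)
    fix y assume "y \<in># Y"
    then have "size (add_mset z (Y - {#y#})) = size U"
      using sz by (metis insert_DiffM size_add_mset)
    then show "y \<diamondop> brace a (add_mset z (Y - {#y#})) = y \<diamondop> brace_aux (size U) a (add_mset z (Y - {#y#}))"
      by (simp only: brace_def)
  qed
  then show ?thesis using sz assms unfolding brace_def by (simp add: Let_def)
qed

text \<open>
  Exchanging the element \<open>z\<close> that is split off with another element \<open>w\<close> amounts to the last of
  the four statements for a smaller multiset: the operator \<open>G z = brace a (add_mset z Y)\<close> satisfies the right
  symmetric law \<open>(G z) w - G (z w) = (G w) z - G (w z)\<close>. This law is inherited by the brace
  recursion from the Novikov identities, provided that \<open>G\<close> is additive and commutes with left
  multiplications, so all four statements are proved in one induction.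
\<close>

lemma
  shows brace_rec: "brace a (add_mset z Y)
          = brace a Y \<diamondop> z - (\<Sum>y\<in>#Y. y \<diamondop> brace a (add_mset z (Y - {#y#})))" (is "?A Y z")
    and brace_add: "brace a (add_mset (u + v) Y) = brace a (add_mset u Y) + brace a (add_mset v Y)" (is "?B Y u v")
    and brace_mul: "u \<diamondop> brace a (add_mset z Y) = brace a (add_mset (u \<diamondop> z) Y)" (is "?C Y u z")
    and brace_rsym: "brace a (add_mset z Y) \<diamondop> w - brace a (add_mset (z \<diamondop> w) Y)
          = brace a (add_mset w Y) \<diamondop> z - brace a (add_mset (w \<diamondop> z) Y)" (is "?D Y z w")
proof -
  have "(\<forall>z. ?A Y z) \<and> (\<forall>u v. ?B Y u v) \<and> (\<forall>u z. ?C Y u z) \<and> (\<forall>z w. ?D Y z w)"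
  proof (induction Y rule: measure_induct_rule[where f = size])
    case (less Y)
    have IH: "?A V z" "?B V u v" "?C V u z" "?D V z w" if "size V < size Y" for V z u v w
      using less.IH[OF that] by blast+
    have lt: "size (Y - {#y#}) < size Y" if "y \<in># Y" for y
      by (rule size_Diff1_less[OF that])
    have A: "?A Y z" for z
    proof -
      define z0 where "z0 = (SOME z0. z0 \<in># add_mset z Y)"
      have z0: "z0 \<in># add_mset z Y" unfolding z0_def by (rule someI[where x=z]) simp
      note ch = brace_choice[OF z0_def refl, of a]
      show ?thesis
      proof (cases "z0 = z")
        case True
        then show ?thesis using ch by simp
      next
        case False
        then obtain V where V: "Y = add_mset z0 V" using z0 by (metis insert_noteq_member mset_add)
        have Y': "add_mset z Y - {#z0#} = add_mset z V" using V by (simp add: add_mset_commute)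
        have szV: "size V < size Y" using V by simp
        define R where "R z w = (\<Sum>y\<in>#V. y \<diamondop> brace a (add_mset w (add_mset z (V - {#y#}))))" for z w
        have Phi: "brace a (add_mset z V) \<diamondop> w - (\<Sum>y\<in>#add_mset z V. y \<diamondop> brace a (add_mset w (add_mset z V - {#y#})))
           = brace a (add_mset z V) \<diamondop> w - z \<diamondop> brace a (add_mset w V) - R z w" for z w
        proof -
          have "(\<Sum>y\<in>#V. y \<diamondop> brace a (add_mset w (add_mset z V - {#y#}))) = R z w"
            unfolding R_def
            by (rule arg_cong[where f=sum_mset], rule image_mset_cong) (simp add: add_mset_diff_bothsides multiset_diff_union_assoc)
          then show ?thesis by (simp add: algebra_simps)
        qed
        have "R z z0 = R z0 z" by (simp add: R_def add_mset_commute)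
        moreover have "z \<diamondop> brace a (add_mset z0 V) = brace a (add_mset (z \<diamondop> z0) V)"
          "z0 \<diamondop> brace a (add_mset z V) = brace a (add_mset (z0 \<diamondop> z) V)"
          using IH(3)[OF szV] by auto
        moreover have "?D V z z0" using IH(4)[OF szV] .
        ultimately show ?thesis
          unfolding ch Y' Phi unfolding V Phi by (simp add: algebra_simps)
      qed
    qed
    have B: "?B Y u v" for u v
    proof -
      have "(\<Sum>y\<in>#Y. y \<diamondop> brace a (add_mset (u + v) (Y - {#y#})))
        = (\<Sum>y\<in>#Y. y \<diamondop> brace a (add_mset u (Y - {#y#})) + y \<diamondop> brace a (add_mset v (Y - {#y#})))"
        by (rule arg_cong[where f=sum_mset], rule image_mset_cong) (simp add: IH(2)[OF lt] add_r)
      then show ?thesis unfolding A by (simp add: add_r sum_mset.distrib)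
    qed
    have C: "?C Y u z" for u z
    proof -
      have "(\<Sum>y\<in>#Y. y \<diamondop> brace a (add_mset (u \<diamondop> z) (Y - {#y#})))
        = (\<Sum>y\<in>#Y. u \<diamondop> (y \<diamondop> brace a (add_mset z (Y - {#y#}))))"
        by (rule arg_cong[where f=sum_mset], rule image_mset_cong) (simp add: IH(3)[OF lt, symmetric] lcomm[of u])
      then show ?thesis unfolding A by (simp add: diff_r sum_r lcomm[of u])
    qed
    have D: "?D Y z w" for z w
    proof -
      \<comment> \<open>right symmetry of \<open>G\<close> holds separately for each summand \<open>E z w y\<close> of the recursion\<close>
      define E where "E z w y = (y \<diamondop> brace a (add_mset z (Y - {#y#}))) \<diamondop> w - y \<diamondop> brace a (add_mset (z \<diamondop> w) (Y - {#y#}))" for z w y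
      have E: "E z w y = E w z y" if y: "y \<in># Y" for y
      proof -
        define G where "G x = brace a (add_mset x (Y - {#y#}))" for x
        have Gadd: "G (u + v) = G u + G v" for u v unfolding G_def by (rule IH(2)[OF lt[OF y]])
        have Gdiff: "G (u - v) = G u - G v" for u v by (metis Gadd add_diff_cancel_right' diff_add_cancel)
        have Gmul: "u \<diamondop> G v = G (u \<diamondop> v)" for u v unfolding G_def by (rule IH(3)[OF lt[OF y]])
        have Gr: "G z \<diamondop> w - G (z \<diamondop> w) = G w \<diamondop> z - G (w \<diamondop> z)" unfolding G_def by (rule IH(4)[OF lt[OF y]])
        have *: "E z w y = y \<diamondop> (G z \<diamondop> w - G (z \<diamondop> w)) + G ((y \<diamondop> w) \<diamondop> z - y \<diamondop> (w \<diamondop> z))" for z w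
        proof -
          have "(y \<diamondop> G z) \<diamondop> w = y \<diamondop> (G z \<diamondop> w) + (y \<diamondop> w) \<diamondop> G z - y \<diamondop> (w \<diamondop> G z)"
            using rsym[of y "G z" w] by (simp add: algebra_simps)
          also have "\<dots> = y \<diamondop> (G z \<diamondop> w) + G ((y \<diamondop> w) \<diamondop> z) - G (y \<diamondop> (w \<diamondop> z))"
            by (simp add: Gmul)
          finally show ?thesis by (simp add: E_def G_def[symmetric] Gdiff diff_r)
        qed
        show ?thesis unfolding * Gr rsym[of y w z] ..
      qed
      have *: "brace a (add_mset z Y) \<diamondop> w - brace a (add_mset (z \<diamondop> w) Y)
        = ((brace a Y \<diamondop> z) \<diamondop> w - brace a Y \<diamondop> (z \<diamondop> w)) - (\<Sum>y\<in>#Y. E z w y)" for z w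
        unfolding A E_def by (simp add: diff_l sum_l sum_mset_diff)
      have "(\<Sum>y\<in>#Y. E z w y) = (\<Sum>y\<in>#Y. E w z y)"
        by (rule arg_cong[where f=sum_mset], rule image_mset_cong) (rule E)
      then show ?thesis unfolding * by (simp add: rsym)
    qed
    show ?case using A B C D by blast
  qed
  then show "?A Y z" "?B Y u v" "?C Y u z" "?D Y z w" by blast+
qed

text \<open>
  These operators play the part of multiplication by an element of weight \<open>0\<close>, for instance \<open>a'\<close> or
  \<open>a\<^sup>(\<^sup>k\<^sup>) y\<^sub>1 \<dots> y\<^sub>k\<^sub>-\<^sub>1\<close>.
\<close>

definition central :: "('a \<Rightarrow> 'a) \<Rightarrow> bool" where
  "central G \<longleftrightarrow> (\<forall>x y. G (x + y) = G x + G y) \<and> (\<forall>x y. G (x \<diamondop> y) = x \<diamondop> G y)"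

lemma central_id: "central (\<lambda>x. x)" by (simp add: central_def)

lemma central_brace: "central (\<lambda>x. brace a (add_mset x Y))"
  by (simp add: central_def brace_add brace_mul)

lemma central_brace_comp: "central G \<Longrightarrow> central (\<lambda>x. brace a (add_mset (G x) Y))"
  by (simp add: central_def brace_add brace_mul)

text \<open>
  Braces are assembled from left multiplications, with which central operators commute.
\<close>

lemma central_commutes_brace:
  assumes "central G"
  shows "G (brace a (add_mset z Y)) = brace a (add_mset (G z) Y)"
proof (induction "size Y" arbitrary: Y rule: less_induct)
  case less
  have add: "G (x + y) = G x + G y" and mul: "G (x \<diamondop> y) = x \<diamondop> G y" for x y
    using assms by (auto simp: central_def)
  have diff: "G (x - y) = G x - G y" for x y by (metis add add_diff_cancel_right' diff_add_cancel)
  have "(\<Sum>y\<in>#Y. G (y \<diamondop> brace a (add_mset z (Y - {#y#})))) = (\<Sum>y\<in>#Y. y \<diamondop> brace a (add_mset (G z) (Y - {#y#})))"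
  proof (rule arg_cong[where f=sum_mset], rule image_mset_cong)
    fix y assume "y \<in># Y"
    from less[OF size_Diff1_less[OF this]]
    show "G (y \<diamondop> brace a (add_mset z (Y - {#y#}))) = y \<diamondop> brace a (add_mset (G z) (Y - {#y#}))"
      by (simp only: mul)
  qed
  then show ?case unfolding brace_rec[of a _ Y] by (simp add: diff mul additive_sum_mset[of G, OF add])
qed

lemma central_swap:
  assumes "central G"
  shows "brace a (add_mset (G y) (add_mset z Y)) = brace a (add_mset (G z) (add_mset y Y))"
  unfolding central_commutes_brace[OF assms, symmetric] by (simp only: add_mset_commute)

text \<open>
  \<open>rep g P Z e\<close> says that \<open>e\<close> realizes the monomial with a factor \<open>(g a)\<^sup>(\<^sup>k\<^sup>+\<^sup>1\<^sup>)\<close> for each pair \<open>(a, k)\<close> in \<open>P\<close>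
  and an underived factor \<open>g z\<close> for each \<open>z\<close> in \<open>Z\<close>. The shift by one excludes derivatives of
  order \<open>0\<close> from \<open>P\<close>: a factor \<open>(a, k)\<close> is introduced by a brace with \<open>k\<close> fresh underived factors
  \<open>Y\<close> and the element \<open>e\<close> built so far, \<open>k + 1\<close> arguments in all.
\<close>

inductive rep :: "('i \<Rightarrow> 'a) \<Rightarrow> ('i \<times> nat) multiset \<Rightarrow> 'i multiset \<Rightarrow> 'a \<Rightarrow> bool" for g where
  rep_gen: "rep g {#} {#z#} (g z)"
| rep_brace: "rep g P Z e \<Longrightarrow> rep g (add_mset (a, size Y) P) (Z + Y) (brace (g a) (add_mset e (image_mset g Y)))"

lemma rep_brace':
  assumes "rep g P Z e" "P' = add_mset (a, size Y) P" "Z' = Z + Y" "e' = brace (g a) (add_mset e (image_mset g Y))"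
  shows "rep g P' Z' e'"
  using assms rep_brace by metis

lemma rep_size: "rep g P Z e \<Longrightarrow> size Z = Suc (\<Sum>(a,k)\<in>#P. k)"
  by (induction rule: rep.induct) auto

text \<open>
  Any underived factor can be taken as the innermost argument, on which the rest of the monomial acts as
  a central operator \<open>G\<close>. If \<open>z\<close> is not yet innermost, it is an argument of some brace and is swapped
  with the innermost one by \<open>central_swap\<close>. The hole may then be filled by another monomial.
\<close>

lemma rep_hole:
  assumes "rep g P Z e" "z \<in># Z"
  shows "\<exists>G. central G \<and> e = G (g z) \<and>
    (\<forall>P' Z' e'. rep g P' Z' e' \<longrightarrow> rep g (P + P') (Z - {#z#} + Z') (G e'))"
  using assms
proof (induction arbitrary: z rule: rep.induct)
  case (rep_gen z0)
  then show ?case by (intro exI[of _ "\<lambda>x. x"]) (auto simp: central_id)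
next
  case (rep_brace P Z e a Y)
  show ?case
  proof (cases "z \<in># Z")
    case True
    have Zz: "Z + Y - {#z#} = Z - {#z#} + Y"
      using diff_union_single_conv[OF True, of Y] by (simp add: union_commute)
    from True obtain G where G: "central G" "e = G (g z)"
      "\<And>P' Z' e'. rep g P' Z' e' \<Longrightarrow> rep g (P + P') (Z - {#z#} + Z') (G e')"
      using rep_brace.IH by blast
    show ?thesis
    proof (intro exI[of _ "\<lambda>x. brace (g a) (add_mset (G x) (image_mset g Y))"] conjI allI impI)
      fix P' Z' e' assume "rep g P' Z' e'"
      from G(3)[OF this] show "rep g (add_mset (a, size Y) P + P') (Z + Y - {#z#} + Z')
            (brace (g a) (add_mset (G e') (image_mset g Y)))"
      proof (rule rep_brace'[where Y = Y])
        show "Z + Y - {#z#} + Z' = Z - {#z#} + Z' + Y"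
          unfolding Zz by (simp add: ac_simps)
      qed simp_all
    next
      show "brace (g a) (add_mset e (image_mset g Y)) = brace (g a) (add_mset (G (g z)) (image_mset g Y))"
        by (simp only: G(2))
    qed (rule central_brace_comp[OF G(1)])
  next
    case False
    then obtain Y0 where Y: "Y = add_mset z Y0" using rep_brace.prems by (metis mset_add union_iff)
    have "size Z \<noteq> 0" using rep_size[OF rep_brace.hyps] by simp
    then obtain z1 Z1 where Z: "Z = add_mset z1 Z1" by (metis multiset_cases size_empty)
    obtain G where G: "central G" "e = G (g z1)"
      "\<And>P' Z' e'. rep g P' Z' e' \<Longrightarrow> rep g (P + P') (Z - {#z1#} + Z') (G e')"
      using rep_brace.IH[of z1] Z by auto
    show ?thesis
    proof (intro exI[of _ "\<lambda>x. brace (g a) (add_mset (G x) (image_mset g (add_mset z1 Y0)))"] conjI allI impI)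
      fix P' Z' e' assume "rep g P' Z' e'"
      from G(3)[OF this] show "rep g (add_mset (a, size Y) P + P') (Z + Y - {#z#} + Z')
            (brace (g a) (add_mset (G e') (image_mset g (add_mset z1 Y0))))"
      proof (rule rep_brace'[where Y = "add_mset z1 Y0"])
        show "add_mset (a, size Y) P + P' = add_mset (a, size (add_mset z1 Y0)) (P + P')"
          unfolding Y by simp
        show "Z + Y - {#z#} + Z' = Z - {#z1#} + Z' + add_mset z1 Y0"
          unfolding Y Z by (simp add: ac_simps)
      qed simp
    next
      show "brace (g a) (add_mset e (image_mset g Y)) = brace (g a) (add_mset (G (g z)) (image_mset g (add_mset z1 Y0)))"
        unfolding Y G(2) image_mset_add_mset by (rule central_swap[OF G(1)])
    qed (rule central_brace_comp[OF G(1)])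
  qed
qed

text \<open>
  The arguments \<open>Y\<close> of the outermost brace may be traded against any other underived factors, one at
  a time: \<open>rep_hole\<close> exposes the factor to be brought in, \<open>central_swap\<close> exchanges it.
\<close>

lemma rep_exchange:
  assumes "rep g P Z e" "Y' \<subseteq># Z + Y" "size Y' = size Y"
  shows "\<exists>e'. rep g P (Z + Y - Y') e' \<and>
    brace a (add_mset e (image_mset g Y)) = brace a (add_mset e' (image_mset g Y'))"
  using assms
proof (induction "size (Y - Y')" arbitrary: Y Z e)
  case 0
  then have "Y \<subseteq># Y'" by (simp add: Diff_eq_empty_iff_mset)
  then have "Y = Y'" using 0 by (metis mset_subset_size nat_less_le subset_mset.le_less)
  then show ?case using 0 by auto
next
  case (Suc n)
  then obtain y where y: "y \<in># Y - Y'" using size_eq_Suc_imp_elem[OF Suc(2)[symmetric]] by blast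
  have "Y + (Y' - Y) = Y' + (Y - Y')"
  proof (rule multiset_eqI)
    show "count (Y + (Y' - Y)) x = count (Y' + (Y - Y')) x" for x by simp
  qed
  from arg_cong[OF this, of size] have "size (Y' - Y) = size (Y - Y')"
    using Suc.prems(3) by simp
  then have "size (Y' - Y) \<noteq> 0" using Suc(2) by linarith
  then obtain z where z: "z \<in># Y' - Y" by (metis multiset_nonemptyE size_empty)
  have zZ: "z \<in># Z"
  proof -
    have "count Y' z > count Y z" using z by (simp add: in_diff_count)
    moreover have "count Y' z \<le> count Z z + count Y z" using Suc.prems(2) by (metis count_union mset_subset_eq_count)
    ultimately have "count Z z > 0" by linarith
    then show ?thesis by simp
  qed
  obtain Y0 where Y: "Y = add_mset y Y0" using y by (metis in_diffD mset_add)
  obtain Z0 where Z: "Z = add_mset z Z0" using zZ by (metis mset_add)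
  obtain G where G: "central G" "e = G (g z)"
      "\<And>P' Z' e'. rep g P' Z' e' \<Longrightarrow> rep g (P + P') (Z - {#z#} + Z') (G e')"
    using rep_hole[OF Suc.prems(1) zZ] by blast
  have r: "rep g P (add_mset y Z0) (G (g y))"
    using G(3)[OF rep_gen[of g y]] Z by simp
  have yz: "y \<noteq> z" using y z by (auto simp: in_diff_count)
  have n: "n = size (add_mset z Y0 - Y')"
  proof -
    have "Y - Y' = add_mset y (add_mset z Y0 - Y')"
    proof (rule multiset_eqI)
      fix x
      show "count (Y - Y') x = count (add_mset y (add_mset z Y0 - Y')) x"
        using y z yz Y by (auto simp: in_diff_count)
    qed
    then show ?thesis using Suc(2) by simp
  qed
  have eq: "Z + Y = add_mset y Z0 + add_mset z Y0" by (simp add: Y Z)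
  obtain e' where e': "rep g P (Z + Y - Y') e'"
    "brace a (add_mset (G (g y)) (image_mset g (add_mset z Y0))) = brace a (add_mset e' (image_mset g Y'))"
    using Suc.hyps(1)[OF n r] Suc.prems Y unfolding eq by auto
  have "brace a (add_mset e (image_mset g Y)) = brace a (add_mset (G (g y)) (image_mset g (add_mset z Y0)))"
    unfolding Y G(2) image_mset_add_mset by (rule central_swap[OF G(1)])
  then show ?case using e' by auto
qed

lemma sub_mset_size:
  assumes "k \<le> size (M :: 'b multiset)" shows "\<exists>Y. Y \<subseteq># M \<and> size Y = k"
  using assms
proof (induction k)
  case 0 then show ?case by (intro exI[of _ "{#}"]) auto
next
  case (Suc k)
  then obtain Y where Y: "Y \<subseteq># M" "size Y = k" by auto
  have "size (M - Y) \<noteq> 0" using Suc.prems Y by (simp add: size_Diff_submset)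
  then obtain z where "z \<in># M - Y" by (metis multiset_nonemptyE size_empty)
  then have "add_mset z Y \<subseteq># M" using Y(1)
    by (intro mset_subset_eqI) (auto simp: in_diff_count Suc_le_eq mset_subset_eq_count)
  then show ?case using Y by (intro exI[of _ "add_mset z Y"]) auto
qed

text \<open>
  Any derived factor can be made the outermost brace, with prescribed arguments: it is moved
  outwards past other braces because brace operators are central, after the arguments of those braces
  have been exchanged for ones disjoint from \<open>Y\<close>.
\<close>

lemma rep_inversion:
  assumes "rep g P Z e" "(a, k) \<in># P" "Y \<subseteq># Z" "size Y = k"
  shows "\<exists>e1. rep g (P - {#(a, k)#}) (Z - Y) e1 \<and> e = brace (g a) (add_mset e1 (image_mset g Y))"
  using assms
proof (induction "size P" arbitrary: P Z e)
  case 0 then show ?case by simp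
next
  case (Suc n)
  from Suc.prems(1) show ?case
  proof (cases rule: rep.cases)
    case rep_gen then show ?thesis using Suc.prems by simp
  next
    case (rep_brace P1 Z1 e2 b Y2)
    show ?thesis
    proof (cases "(a, k) = (b, size Y2)")
      case True
      then have ab: "a = b" "k = size Y2" by auto
      obtain e' where "rep g P1 (Z1 + Y2 - Y) e'"
        "brace (g b) (add_mset e2 (image_mset g Y2)) = brace (g b) (add_mset e' (image_mset g Y))"
        using rep_exchange[OF rep_brace(4), of Y Y2 "g b"] Suc.prems(3,4) rep_brace(2) ab by metis
      moreover have "P - {#(a, k)#} = P1" using ab rep_brace(1) by simp
      ultimately show ?thesis using ab rep_brace(2,3) by metis
    next
      case False
      then have in1: "(a, k) \<in># P1" using Suc.prems(2) rep_brace(1) by auto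
      have szZ: "size Z = Suc (\<Sum>(a,k)\<in>#P. k)" by (rule rep_size[OF Suc.prems(1)])
      obtain P2 where P2: "P1 = add_mset (a, k) P2" using multi_member_split[OF in1] by blast
      have "size Y2 \<le> size (Z - Y)"
        using szZ rep_brace(1) P2 Suc.prems by (simp add: size_Diff_submset)
      then obtain Y3 where Y3: "Y3 \<subseteq># Z - Y" "size Y3 = size Y2" using sub_mset_size by blast
      have Y3Z: "Y3 \<subseteq># Z" using Y3(1) by (rule subset_mset.order_trans) simp
      obtain e' where e': "rep g P1 (Z - Y3) e'"
        "e = brace (g b) (add_mset e' (image_mset g Y3))"
        using rep_exchange[OF rep_brace(4), of Y3 Y2 "g b"] Y3(2) Y3Z rep_brace(2,3) by metis
      have cnt: "count Y3 x + count Y x \<le> count Z x" for x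
        using mset_subset_eq_count[OF Y3(1), of x] mset_subset_eq_count[OF Suc.prems(3), of x] by simp
      have YY: "Y \<subseteq># Z - Y3"
      proof (rule mset_subset_eqI)
        show "count Y x \<le> count (Z - Y3) x" for x using cnt[of x] by simp
      qed
      have "n = size P1" using Suc(2) rep_brace(1) by simp
      from Suc.hyps(1)[OF this e'(1) in1 YY Suc.prems(4)]
      obtain e3 where e3: "rep g (P1 - {#(a, k)#}) (Z - Y3 - Y) e3" "e' = brace (g a) (add_mset e3 (image_mset g Y))"
        by metis
      have Zeq: "Z - Y = (Z - Y3 - Y) + Y3"
      proof (rule multiset_eqI)
        show "count (Z - Y) x = count (Z - Y3 - Y + Y3) x" for x using cnt[of x] by simp
      qed
      have Peq: "P - {#(a, k)#} = add_mset (b, size Y3) (P1 - {#(a, k)#})"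
        using False unfolding P2 rep_brace(1) Y3(2) by simp
      have "rep g (P - {#(a, k)#}) (Z - Y) (brace (g b) (add_mset e3 (image_mset g Y3)))"
        by (rule rep_brace'[OF e3(1) Peq Zeq refl])
      moreover have "e = brace (g a) (add_mset (brace (g b) (add_mset e3 (image_mset g Y3))) (image_mset g Y))"
        unfolding e'(2) e3(2)
        by (rule central_commutes_brace[OF central_brace, symmetric])
      ultimately show ?thesis by blast
    qed
  qed
qed

lemma rep_unique:
  assumes "rep g P Z e" "rep g P Z e'" shows "e = e'"
  using assms
proof (induction arbitrary: e' rule: rep.induct)
  case (rep_gen z)
  then show ?case by (cases rule: rep.cases) auto
next
  case (rep_brace P Z e a Y)
  obtain e1 where e1: "rep g (add_mset (a, size Y) P - {#(a, size Y)#}) (Z + Y - Y) e1"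
    "e' = brace (g a) (add_mset e1 (image_mset g Y))"
    using rep_inversion[OF rep_brace.prems, of a "size Y" Y] by auto
  have "rep g P Z e1" using e1(1) by simp
  from rep_brace.IH[OF this] show ?case using e1(2) by simp
qed

definition reps :: "('i \<Rightarrow> 'a) \<Rightarrow> 'a set" where "reps g = {e. \<exists>P Z. rep g P Z e}"

lemma reps_gen: "g i \<in> reps g"
  unfolding reps_def using rep_gen[of g i] by blast

lemma reps_brace: "e \<in> reps g \<Longrightarrow> brace (g a) (add_mset e (image_mset g Y)) \<in> reps g"
  using rep_brace[of g _ _ e] unfolding reps_def by blast

lemma reps_hole:
  assumes "e \<in> reps g"
  shows "\<exists>G z. central G \<and> e = G (g z) \<and> (\<forall>x\<in>reps g. G x \<in> reps g)"
proof -
  obtain P Z where r: "rep g P Z e" using assms by (auto simp: reps_def)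
  then have "size Z \<noteq> 0" using rep_size by fastforce
  then obtain z where "z \<in># Z" by (metis multiset_nonemptyE size_empty)
  from rep_hole[OF r this] show ?thesis unfolding reps_def by blast
qed

lemma sum_mset_in_span: "(\<And>y. y \<in># Y \<Longrightarrow> f y \<in> span S) \<Longrightarrow> (\<Sum>y\<in>#Y. f y) \<in> span S"
  by (induction Y) (auto intro: span_add span_zero)

lemma brace_one: "x \<diamondop> y = brace x {#y#}"
  by (simp add: brace_rec[of x y "{#}", simplified])

text \<open>
  The recursion of the brace, read from right to left, is the Leibniz rule
  for \<open>(a\<^sup>(\<^sup>k\<^sup>+\<^sup>1\<^sup>) e \<Prod>Y) \<diamondop> e'\<close>. In the term that
  differentiates \<open>e\<close> the left factor is again \<open>e\<close>, which allows induction; every other term is a single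
  realized monomial.
\<close>

lemma reps_mul:
  assumes "e \<in> reps g" "e' \<in> reps g" shows "e \<diamondop> e' \<in> span (reps g)"
proof -
  obtain P Z where "rep g P Z e" using assms(1) by (auto simp: reps_def)
  then show ?thesis using assms(2)
  proof (induction arbitrary: e' rule: rep.induct)
    case (rep_gen z)
    then show ?case using reps_brace[of e' g z "{#}"] by (intro span_base) (simp only: brace_one[of "g z"] image_mset_empty)
  next
    case (rep_brace P Z e a Y)
    have "e \<in> reps g" using rep_brace.hyps by (auto simp: reps_def)
    then obtain G z where G: "central G" "e = G (g z)" "\<And>x. x \<in> reps g \<Longrightarrow> G x \<in> reps g"
      using reps_hole by meson
    \<comment> \<open>two composite arguments \<open>e\<close>, \<open>e'\<close> in one brace: peel \<open>G\<close> off \<open>e = G (g z)\<close> to leave a generator\<close>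
    have move: "brace (g a) (add_mset e' (add_mset e (image_mset g Y'))) \<in> reps g" for Y'
    proof -
      have "brace (g a) (add_mset e' (add_mset e (image_mset g Y')))
          = brace (g a) (add_mset (G (g z)) (add_mset e' (image_mset g Y')))"
        unfolding G(2) by (simp only: add_mset_commute)
      also have "\<dots> = G (brace (g a) (add_mset e' (image_mset g (add_mset z Y'))))"
        unfolding image_mset_add_mset central_commutes_brace[OF G(1)] by (rule central_swap[OF G(1)])
      finally have "brace (g a) (add_mset e' (add_mset e (image_mset g Y')))
          = G (brace (g a) (add_mset e' (image_mset g (add_mset z Y'))))" .
      then show ?thesis using G(3)[OF reps_brace[OF rep_brace.prems]] by (simp only:)
    qed
    have eq: "brace (g a) (add_mset e (image_mset g Y)) \<diamondop> e'
      = brace (g a) (add_mset e' (add_mset e (image_mset g Y)))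
        + (e \<diamondop> brace (g a) (add_mset e' (image_mset g Y))
        + (\<Sum>y\<in>#Y. g y \<diamondop> brace (g a) (add_mset e' (add_mset e (image_mset g (Y - {#y#}))))))"
    proof -
      have "(\<Sum>y\<in>#image_mset g Y. y \<diamondop> brace (g a) (add_mset e' (add_mset e (image_mset g Y) - {#y#})))
        = (\<Sum>y\<in>#Y. g y \<diamondop> brace (g a) (add_mset e' (add_mset e (image_mset g (Y - {#y#})))))"
        unfolding image_mset.compositionality comp_def
      proof (rule arg_cong[where f=sum_mset], rule image_mset_cong)
        fix y assume "y \<in># Y"
        then obtain Y1 where "Y = add_mset y Y1" by (metis mset_add)
        then show "g y \<diamondop> brace (g a) (add_mset e' (add_mset e (image_mset g Y) - {#g y#}))
          = g y \<diamondop> brace (g a) (add_mset e' (add_mset e (image_mset g (Y - {#y#}))))"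
          by simp
      qed
      then show ?thesis
        using brace_rec[of "g a" e' "add_mset e (image_mset g Y)"] by (simp add: algebra_simps)
    qed
    show ?case unfolding eq
    proof (intro span_add sum_mset_in_span)
      show "brace (g a) (add_mset e' (add_mset e (image_mset g Y))) \<in> span (reps g)"
        using move by (rule span_base)
      show "e \<diamondop> brace (g a) (add_mset e' (image_mset g Y)) \<in> span (reps g)"
        by (rule rep_brace.IH) (rule reps_brace[OF rep_brace.prems])
      show "g y \<diamondop> brace (g a) (add_mset e' (add_mset e (image_mset g (Y - {#y#})))) \<in> span (reps g)" for y
        using reps_brace[OF move[of "Y - {#y#}"], of y "{#}"] by (intro span_base) (simp only: brace_one[of "g y"] image_mset_empty)
    qed
  qed
qed

lemma span_reps_mul:
  assumes "x \<in> span (reps g)" "y \<in> span (reps g)" shows "x \<diamondop> y \<in> span (reps g)"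
proof -
  have *: "e \<diamondop> y \<in> span (reps g)" if "e \<in> reps g" for e
    using assms(2)
  proof (induction rule: span_induct_alt)
    case base
    then show ?case using diff_r[of e 0 0] by (simp add: span_zero)
  next
    case (step c x y)
    then show ?case using reps_mul[OF that] by (simp add: add_r scale_r span_add span_scale)
  qed
  from assms(1) show ?thesis
  proof (induction rule: span_induct_alt)
    case base
    then show ?case using diff_l[of 0 0 y] by (simp add: span_zero)
  next
    case (step c x y)
    then show ?case using * by (simp add: add_l scale_l span_add span_scale)
  qed
qed

text \<open>
  A pair \<open>(i, j)\<close> stands for the \<open>j\<close>-th derivative of the generator \<open>i\<close>.
\<close>

definition monomial :: "('i \<times> nat) multiset \<Rightarrow> 'i multiset \<Rightarrow> ('i \<times> nat) multiset" where
  "monomial P Z = image_mset (\<lambda>(a, k). (a, Suc k)) P + image_mset (\<lambda>z. (z, 0)) Z"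

lemma monomial_inj:
  assumes "monomial P Z = monomial P' Z'" shows "P = P' \<and> Z = Z'"
proof -
  have "image_mset (\<lambda>(a, k). (a, k - 1)) (filter_mset (\<lambda>p. snd p \<noteq> 0) (monomial P Z)) = P"
    "image_mset fst (filter_mset (\<lambda>p. snd p = 0) (monomial P Z)) = Z" for P Z
    by (simp_all add: monomial_def filter_mset_image_mset image_mset.compositionality comp_def case_prod_unfold)
  then show ?thesis using assms by metis
qed

definition realizes :: "('i \<Rightarrow> 'a) \<Rightarrow> ('i \<times> nat) multiset \<Rightarrow> 'a \<Rightarrow> bool" where
  "realizes g M e \<longleftrightarrow> (\<exists>P Z. M = monomial P Z \<and> rep g P Z e)"

lemma realizes_unique: "realizes g M e \<Longrightarrow> realizes g M e' \<Longrightarrow> e = e'"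
  unfolding realizes_def using monomial_inj rep_unique by blast

definition val :: "('i \<Rightarrow> 'a) \<Rightarrow> ('i \<times> nat) multiset \<Rightarrow> 'a" where
  "val g M = (THE e. realizes g M e)"

lemma val_eq: "realizes g M e \<Longrightarrow> val g M = e"
  unfolding val_def by (rule the_equality) (auto intro: realizes_unique)

text \<open>
  \<open>val g M\<close> is meaningless unless \<open>M\<close> has weight \<open>-1\<close>, so the coefficients must be confined to
  monomials that are realized.
\<close>

lemma span_reps_normal_form:
  assumes "q \<in> span (reps g)"
  shows "\<exists>d :: ('i \<times> nat) multiset \<Rightarrow>\<^sub>0 'k. q = (\<Sum>M\<in>Poly_Mapping.keys d. scale (Poly_Mapping.lookup d M) (val g M)) \<and>
    (\<forall>M\<in>Poly_Mapping.keys d. realizes g M (val g M))"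
  using assms
proof (induction rule: span_induct_alt)
  case base
  then show ?case by (intro exI[of _ 0]) simp
next
  case (step c e q)
  then obtain d :: "('i \<times> nat) multiset \<Rightarrow>\<^sub>0 'k" where d: "q = (\<Sum>M\<in>Poly_Mapping.keys d. scale (Poly_Mapping.lookup d M) (val g M))"
    "\<forall>M\<in>Poly_Mapping.keys d. realizes g M (val g M)" by blast
  obtain M where M: "realizes g M e" using step.hyps unfolding reps_def realizes_def by blast
  have "(\<Sum>L\<in>Poly_Mapping.keys (Poly_Mapping.single M c + d). scale (Poly_Mapping.lookup (Poly_Mapping.single M c + d) L) (val g L))
    = (\<Sum>L\<in>Poly_Mapping.keys (Poly_Mapping.single M c). scale (Poly_Mapping.lookup (Poly_Mapping.single M c) L) (val g L))
     + (\<Sum>L\<in>Poly_Mapping.keys d. scale (Poly_Mapping.lookup d L) (val g L))"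
    by (rule setsum_keys_plus_distrib) (simp_all add: scale_left_distrib)
  also have "\<dots> = scale c e + q" using val_eq[OF M] d(1) by simp
  finally show ?case using d(2) M val_eq[OF M] keys_add[of "Poly_Mapping.single M c" d]
    by (intro exI[of _ "Poly_Mapping.single M c + d"]) (auto split: if_splits)
qed

end

section \<open>Representations by a derivation\<close>

locale derivation =
  fixes \<delta> :: "'b::comm_ring_1 \<Rightarrow> 'b"
  assumes deriv_add: "\<delta> (x + y) = \<delta> x + \<delta> y"
    and deriv_mult: "\<delta> (x * y) = \<delta> x * y + x * \<delta> y"
begin

lemma deriv_prod_mset: "\<delta> (\<Prod>y\<in>#Y. h y) = (\<Sum>y\<in>#Y. \<delta> (h y) * (\<Prod>x\<in>#Y - {#y#}. h x))"
proof (induction Y)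
  case empty
  have "\<delta> 1 = 0" using deriv_mult[of 1 1] by simp
  then show ?case by simp
next
  case (add z Y)
  have "(\<Sum>y\<in>#Y. \<delta> (h y) * (\<Prod>x\<in>#add_mset z Y - {#y#}. h x)) = (\<Sum>y\<in>#Y. h z * (\<delta> (h y) * (\<Prod>x\<in>#Y - {#y#}. h x)))"
  proof (rule arg_cong[where f=sum_mset], rule image_mset_cong)
    fix y assume "y \<in># Y"
    then obtain V where "Y = add_mset y V" by (metis mset_add)
    then show "\<delta> (h y) * (\<Prod>x\<in>#add_mset z Y - {#y#}. h x) = h z * (\<delta> (h y) * (\<Prod>x\<in>#Y - {#y#}. h x))"
      by (simp add: ac_simps)
  qed
  then show ?case using add by (simp add: deriv_mult sum_mset_distrib_left)
qed

end

text \<open>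
  A homomorphism \<open>h\<close> to the Novikov algebra of a derivation \<open>\<delta>\<close>. It sends each realized element to the
  value of its monomial, so the coefficients of a normal form become those of a differential polynomial.
\<close>

locale novikov_representation = novikov_space scale mul + derivation \<delta>
  for scale :: "'k::field \<Rightarrow> 'a::ab_group_add \<Rightarrow> 'a" and mul :: "'a \<Rightarrow> 'a \<Rightarrow> 'a" (infixl "\<diamondop>" 70)
    and \<delta> :: "'b::comm_ring_1 \<Rightarrow> 'b" +
  fixes \<iota> :: "'k \<Rightarrow> 'b" and h :: "'a \<Rightarrow> 'b"
  assumes h_add: "h (x + y) = h x + h y"
    and h_scale: "h (scale c x) = \<iota> c * h x"
    and h_mul: "h (x \<diamondop> y) = \<delta> (h x) * h y"
begin

lemma h_diff: "h (x - y) = h x - h y"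
  by (metis h_add add_diff_cancel_right' diff_add_cancel)

lemma h_zero: "h 0 = 0"
  using h_add[of 0 0] by simp

lemma h_brace: "h (brace a Y) = (\<delta> ^^ size Y) (h a) * (\<Prod>y\<in>#Y. h y)"
proof (induction "size Y" arbitrary: Y)
  case 0
  then show ?case by simp
next
  case (Suc n)
  then obtain z V where Y: "Y = add_mset z V" by (metis size_eq_Suc_imp_eq_union)
  have n: "n = size V" using Suc(2) Y by simp
  have "(\<Sum>y\<in>#V. h (y \<diamondop> brace a (add_mset z (V - {#y#}))))
    = (\<Sum>y\<in>#V. (\<delta> ^^ n) (h a) * h z * (\<delta> (h y) * (\<Prod>x\<in>#V - {#y#}. h x)))"
  proof (rule arg_cong[where f=sum_mset], rule image_mset_cong)
    fix y assume "y \<in># V"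
    then have "n = size (add_mset z (V - {#y#}))" using n by (metis insert_DiffM size_add_mset)
    from Suc.hyps(1)[OF this] show "h (y \<diamondop> brace a (add_mset z (V - {#y#}))) = (\<delta> ^^ n) (h a) * h z * (\<delta> (h y) * (\<Prod>x\<in>#V - {#y#}. h x))"
      using \<open>n = size (add_mset z (V - {#y#}))\<close> by (simp add: h_mul)
  qed
  then show ?case unfolding Y brace_rec[of a z V]
    using Suc.hyps(1)[OF n] n
    by (simp add: h_diff h_mul deriv_mult deriv_prod_mset additive_sum_mset[of h, OF h_add]
        sum_mset_distrib_left algebra_simps)
qed

lemma h_rep:
  assumes "rep g P Z e"
  shows "h e = (\<Prod>(i, j)\<in>#monomial P Z. (\<delta> ^^ j) (h (g i)))"
  using assms
proof induction
  case (rep_gen z)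
  then show ?case by (simp add: monomial_def)
next
  case (rep_brace P Z e a Y)
  then show ?case by (simp add: monomial_def h_brace image_mset.compositionality comp_def case_prod_unfold algebra_simps)
qed

lemma h_normal_form:
  assumes "q = (\<Sum>M\<in>Poly_Mapping.keys d. scale (Poly_Mapping.lookup d M) (val g M))"
    "\<forall>M\<in>Poly_Mapping.keys d. realizes g M (val g M)"
  shows "h q = (\<Sum>M\<in>Poly_Mapping.keys d. \<iota> (Poly_Mapping.lookup d M) * (\<Prod>(i, j)\<in>#M. (\<delta> ^^ j) (h (g i))))"
proof -
  have "h (\<Sum>M\<in>S. f M) = (\<Sum>M\<in>S. h (f M))" for S f
    by (induction S rule: infinite_finite_induct) (auto simp: h_zero h_add)
  then have "h q = (\<Sum>M\<in>Poly_Mapping.keys d. h (scale (Poly_Mapping.lookup d M) (val g M)))"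
    using assms(1) by simp
  also have "\<dots> = (\<Sum>M\<in>Poly_Mapping.keys d. \<iota> (Poly_Mapping.lookup d M) * (\<Prod>(i, j)\<in>#M. (\<delta> ^^ j) (h (g i))))"
  proof (rule sum.cong[OF refl])
    fix M assume "M \<in> Poly_Mapping.keys d"
    then have "realizes g M (val g M)" using assms(2) by blast
    then show "h (scale (Poly_Mapping.lookup d M) (val g M)) = \<iota> (Poly_Mapping.lookup d M) * (\<Prod>(i, j)\<in>#M. (\<delta> ^^ j) (h (g i)))"
      unfolding realizes_def using h_rep[of g _ _ "val g M"] by (auto simp: h_scale)
  qed
  finally show ?thesis .
qed

end

section \<open>Power series solutions of differential equations\<close>

definition fps_agree :: "nat \<Rightarrow> 'a fps \<Rightarrow> 'a fps \<Rightarrow> bool" where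
  "fps_agree m a b \<longleftrightarrow> (\<forall>i<m. fps_nth a i = fps_nth b i)"

lemma fps_agree_refl [simp]: "fps_agree m a a" by (simp add: fps_agree_def)
lemma fps_agree_sym: "fps_agree m a b \<Longrightarrow> fps_agree m b a" by (simp add: fps_agree_def)
lemma fps_agree_trans: "fps_agree m a b \<Longrightarrow> fps_agree m b c \<Longrightarrow> fps_agree m a c" by (simp add: fps_agree_def)
lemma fps_agree_mono: "fps_agree m a b \<Longrightarrow> k \<le> m \<Longrightarrow> fps_agree k a b" by (simp add: fps_agree_def)

lemma fps_agree_add: "fps_agree m a b \<Longrightarrow> fps_agree m c d \<Longrightarrow> fps_agree m (a + c) (b + d)"
  for a :: "'a::monoid_add fps"
  by (simp add: fps_agree_def)

lemma fps_agree_mult: "fps_agree m a b \<Longrightarrow> fps_agree m c d \<Longrightarrow> fps_agree m (a * c) (b * d)"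
  for a :: "'a::semiring_0 fps"
  unfolding fps_agree_def fps_mult_nth by (intro allI impI sum.cong) auto

lemma fps_agree_sum: "(\<And>i. i \<in> S \<Longrightarrow> fps_agree m (f i) (g i)) \<Longrightarrow> fps_agree m (sum f S) (sum g S)"
  for f :: "'i \<Rightarrow> 'a::comm_monoid_add fps"
  by (induction S rule: infinite_finite_induct) (auto intro: fps_agree_add)

lemma fps_agree_power: "fps_agree m a b \<Longrightarrow> fps_agree m (a ^ k) (b ^ k)"
  for a :: "'a::semiring_1 fps"
  by (induction k) (auto intro: fps_agree_mult)

lemma fps_agree_prod_mset:
  fixes f :: "'i \<Rightarrow> 'a::comm_semiring_1 fps"
  shows "(\<And>i. i \<in># M \<Longrightarrow> fps_agree m (f i) (g i)) \<Longrightarrow> fps_agree m (\<Prod>i\<in>#M. f i) (\<Prod>i\<in>#M. g i)"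
  by (induction M) (auto intro: fps_agree_mult)

lemma fps_agree_deriv: "fps_agree (Suc m) a b \<Longrightarrow> fps_agree m (fps_deriv a) (fps_deriv b)"
  by (simp add: fps_agree_def)

lemma fps_agree_derivs: "fps_agree (m + j) a b \<Longrightarrow> fps_agree m ((fps_deriv ^^ j) a) ((fps_deriv ^^ j) b)"
  by (induction j arbitrary: m) (auto intro: fps_agree_deriv)

lemma poly_eq_sum_le:
  fixes p :: "'a::comm_ring_1 poly"
  shows "degree p \<le> d \<Longrightarrow> poly p x = (\<Sum>i\<le>d. coeff p i * x ^ i)"
  unfolding poly_altdef by (rule sum.mono_neutral_left) (auto simp: coeff_eq_0)

lemma fps_agree_poly:
  fixes p q :: "'a::comm_ring_1 fps poly"
  assumes "\<And>l. fps_agree m (coeff p l) (coeff q l)" "fps_agree m x y"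
  shows "fps_agree m (poly p x) (poly q y)"
proof -
  define d where "d = max (degree p) (degree q)"
  have "poly p x = (\<Sum>i\<le>d. coeff p i * x ^ i)" "poly q y = (\<Sum>i\<le>d. coeff q i * y ^ i)"
    by (rule poly_eq_sum_le; simp add: d_def)+
  then show ?thesis
    by (simp only:) (intro fps_agree_sum fps_agree_mult fps_agree_power assms)
qed

text \<open>
  Stated without division; the instance \<open>k = 0\<close> reads off Taylor coefficients.
\<close>

lemma derivs_nth:
  fixes f :: "'a::field_char_0 fps"
  shows "fact k * fps_nth ((fps_deriv ^^ j) f) k = fact (k + j) * fps_nth f (k + j)"
proof (induction j arbitrary: k)
  case (Suc j)
  have "fact k * fps_nth ((fps_deriv ^^ Suc j) f) k = fact (Suc k) * fps_nth ((fps_deriv ^^ j) f) (Suc k)"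
    by (simp add: algebra_simps)
  also have "\<dots> = fact (Suc k + j) * fps_nth f (Suc k + j)" by (rule Suc)
  finally show ?case by simp
qed simp

lemma derivs_add: "(fps_deriv ^^ j) (a + b) = (fps_deriv ^^ j) a + (fps_deriv ^^ j) (b :: 'a::comm_ring_1 fps)"
  by (induction j) auto

lemma poly_first_order_expansion:
  fixes p :: "'a::idom poly"
  shows "\<exists>q. poly p (x + h) = poly p x + h * poly (pderiv p) x + h\<^sup>2 * q"
proof (induction p)
  case (pCons a p)
  then obtain q where q: "poly p (x + h) = poly p x + h * poly (pderiv p) x + h\<^sup>2 * q" by blast
  show ?case
    by (rule exI[of _ "poly (pderiv p) x + (x + h) * q"])
      (unfold poly_pCons q pderiv_pCons poly_add, simp add: power2_eq_square algebra_simps)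
qed simp

text \<open>
  \<open>poly (A y) (y\<^sup>(\<^sup>r\<^sup>)) = 0\<close> is an algebraic differential equation of order \<open>r\<close>: by \<open>causal\<close> the coefficients
  \<open>A y\<close> see only derivatives of \<open>y\<close> of order less than \<open>r\<close>. If the equation holds at \<open>0\<close> for the initial
  jet \<open>y0\<close>, and the separant does not vanish there, the remaining coefficients of \<open>y\<close> are found
  one after the other as in Hensel's lemma.
\<close>

lemma ode_power_series_solution:
  fixes A :: "'c::field_char_0 fps \<Rightarrow> 'c fps poly" and y0 :: "'c fps"
  assumes causal: "\<And>m y y' l. fps_agree (m + r) y y' \<Longrightarrow> fps_agree (Suc m) (coeff (A y) l) (coeff (A y') l)"
    and init: "fps_nth (poly (A y0) ((fps_deriv ^^ r) y0)) 0 = 0"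
    and sep: "fps_nth (poly (pderiv (A y0)) ((fps_deriv ^^ r) y0)) 0 \<noteq> 0"
  shows "\<exists>y. fps_agree (Suc r) y y0 \<and> poly (A y) ((fps_deriv ^^ r) y) = 0"
proof -
  define F where "F y = poly (A y) ((fps_deriv ^^ r) y)" for y
  have F_causal: "fps_agree (Suc m) (F y) (F y')" if "fps_agree (Suc m + r) y y'" for m y y'
    unfolding F_def using that
    by (intro fps_agree_poly causal fps_agree_derivs) (auto intro: fps_agree_mono)
  define good where "good m y \<longleftrightarrow> fps_agree (Suc r) y y0 \<and> fps_agree (Suc m) (F y) 0" for m y
  have step: "\<exists>y'. good (Suc m) y' \<and> fps_agree (Suc m + r) y y'" if "good m y" for m y
  proof -
    define M where "M = Suc m"
    define s where "s = fps_nth (poly (pderiv (A y)) ((fps_deriv ^^ r) y)) 0"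
    have y: "fps_agree (Suc r) y y0" "fps_agree M (F y) 0" using that by (auto simp: good_def M_def)
    have "fps_agree (Suc 0) (poly (pderiv (A y)) ((fps_deriv ^^ r) y)) (poly (pderiv (A y0)) ((fps_deriv ^^ r) y0))"
    proof (rule fps_agree_poly)
      show "fps_agree (Suc 0) (coeff (pderiv (A y)) l) (coeff (pderiv (A y0)) l)" for l
        unfolding coeff_pderiv
        by (intro fps_agree_mult causal fps_agree_refl) (use y(1) in \<open>auto intro: fps_agree_mono\<close>)
      show "fps_agree (Suc 0) ((fps_deriv ^^ r) y) ((fps_deriv ^^ r) y0)"
        by (rule fps_agree_derivs) (use y(1) in simp)
    qed
    then have s: "s \<noteq> 0" using sep by (simp add: s_def fps_agree_def)
    \<comment> \<open>\<open>u\<close> is the correction with \<open>u\<^sup>(\<^sup>r\<^sup>) = \<kappa> t\<^sup>M\<close>, and \<open>\<kappa>\<close> cancels the coefficient of \<open>t\<^sup>M\<close> to first order\<close>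
    define \<kappa> where "\<kappa> = - fps_nth (F y) M / s"
    define u where "u = fps_const (fact M * \<kappa> / fact (M + r)) * fps_X ^ (M + r)"
    define h where "h = (fps_deriv ^^ r) u"
    have h: "fps_nth h i = (if i = M then \<kappa> else 0)" if "i \<le> M" for i
    proof -
      have "fact i * fps_nth h i = fact (i + r) * fps_nth u (i + r)" unfolding h_def by (rule derivs_nth)
      then show ?thesis using that by (auto simp: u_def field_simps split: if_splits)
    qed
    have h0: "fps_agree M h 0" using h by (simp add: fps_agree_def)
    have uy: "fps_agree (M + r) y (y + u)"
      by (auto simp: fps_agree_def u_def)
    obtain q where q: "poly (A y) ((fps_deriv ^^ r) y + h)
      = F y + h * poly (pderiv (A y)) ((fps_deriv ^^ r) y) + h\<^sup>2 * q"
      using poly_first_order_expansion[of "A y" "(fps_deriv ^^ r) y" h] by (auto simp: F_def)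
    \<comment> \<open>since \<open>M \<ge> 1\<close>, the quadratic term starts at \<open>t\<close> to the power \<open>2 M > M\<close>\<close>
    have hh: "fps_nth (h\<^sup>2 * q) i = 0" if "i \<le> M" for i
    proof -
      have "fps_nth (h\<^sup>2) j = 0" if "j \<le> M" for j
        unfolding power2_eq_square fps_mult_nth
      proof (rule sum.neutral, rule ballI)
        fix l assume l: "l \<in> {0..j}"
        then have "l < M \<or> j - l < M" using that M_def by auto
        then show "fps_nth h l * fps_nth h (j - l) = 0" using h[of l] h[of "j - l"] l that by auto
      qed
      then show ?thesis unfolding fps_mult_nth[of "h\<^sup>2"] using that by (intro sum.neutral) auto
    qed
    have hs: "fps_nth (h * p) i = (if i = M then \<kappa> * fps_nth p 0 else 0)" if "i \<le> M" for i p
    proof -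
      have "fps_nth (h * p) i = (\<Sum>l\<in>{0..i}. if l = M then \<kappa> * fps_nth p 0 else 0)"
        unfolding fps_mult_nth using that by (intro sum.cong) (auto simp: h)
      also have "\<dots> = (if i = M then \<kappa> * fps_nth p 0 else 0)" using that by (auto simp: sum.delta')
      finally show ?thesis .
    qed
    have "fps_agree (Suc M) (F (y + u)) (poly (A y) ((fps_deriv ^^ r) y + h))"
      unfolding F_def h_def derivs_add[symmetric]
      by (intro fps_agree_poly causal fps_agree_refl fps_agree_sym[OF uy])
    moreover have "fps_nth (poly (A y) ((fps_deriv ^^ r) y + h)) i = 0" if "i < Suc M" for i
      using that y(2) s unfolding q by (auto simp: hh hs s_def[symmetric] \<kappa>_def fps_agree_def less_Suc_eq_le)
    ultimately have "fps_agree (Suc M) (F (y + u)) 0" by (simp add: fps_agree_def)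
    moreover have "fps_agree (Suc r) (y + u) y0"
      using fps_agree_mono[OF fps_agree_sym[OF uy], of "Suc r"] y(1) fps_agree_trans by (auto simp: M_def)
    ultimately show ?thesis using uy by (intro exI[of _ "y + u"]) (auto simp: good_def M_def)
  qed
  have "good 0 y0" using init by (auto simp: good_def F_def fps_agree_def)
  with dependent_nat_choice[of good "\<lambda>m y y'. fps_agree (Suc m + r) y y'"] step
  obtain Y where Y: "\<And>m. good m (Y m)" "\<And>m. fps_agree (Suc m + r) (Y m) (Y (Suc m))" by blast
  have stable: "fps_nth (Y m) i = fps_nth (Y k) i" if "i \<le> m + r" "m \<le> k" for i m k
    using that(2)
  proof (induction k rule: dec_induct)
    case (step k)
    have "i < Suc k + r" using step.hyps that by simp
    then show ?case using Y(2)[of k] step.IH by (simp add: fps_agree_def)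
  qed simp
  define y where "y = Abs_fps (\<lambda>i. fps_nth (Y i) i)"
  have yY: "fps_agree (Suc m + r) y (Y m)" for m
    unfolding fps_agree_def y_def
  proof (intro allI impI)
    fix i assume i: "i < Suc m + r"
    show "fps_nth (Abs_fps (\<lambda>i. fps_nth (Y i) i)) i = fps_nth (Y m) i"
      using stable[of i m i] stable[of i i m] i by (cases "m \<le> i") auto
  qed
  have "fps_nth (F y) m = 0" for m
    using F_causal[OF yY[of m]] Y(1)[of m] by (auto simp: good_def fps_agree_def)
  then have "F y = 0" by (simp add: fps_eq_iff)
  moreover have "fps_agree (Suc r) y y0"
    using yY[of 0] Y(1)[of 0] by (auto simp: good_def intro: fps_agree_trans)
  ultimately show ?thesis by (auto simp: F_def)
qed

text \<open>
  Differential polynomials in variables \<open>0, 1, \<dots>\<close>: monomials are multisets of pairs \<open>(i, j)\<close>, the pair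
  standing for the \<open>j\<close>-th derivative of the variable \<open>i\<close>. A lexicographic order on pairs turns the
  monomials into a linearly ordered cancellative monoid, which makes this ring an integral domain.
\<close>

section \<open>Differential polynomials\<close>

type_synonym 'k dpoly = "(nat \<times> nat) multiset \<Rightarrow>\<^sub>0 'k"

definition eval_dpoly :: "('k \<Rightarrow> 'b::comm_ring_1) \<Rightarrow> (nat \<times> nat \<Rightarrow> 'b) \<Rightarrow> 'k::zero dpoly \<Rightarrow> 'b" where
  "eval_dpoly \<iota> v p = (\<Sum>M\<in>Poly_Mapping.keys p. \<iota> (Poly_Mapping.lookup p M) * (\<Prod>x\<in>#M. v x))"

locale ring_homomorphism =
  fixes \<iota> :: "'k::comm_ring_1 \<Rightarrow> 'b::comm_ring_1"
  assumes hom_add: "\<iota> (x + y) = \<iota> x + \<iota> y"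
    and hom_mult: "\<iota> (x * y) = \<iota> x * \<iota> y"
    and hom_one: "\<iota> 1 = 1"
begin

lemma hom_zero: "\<iota> 0 = 0" using hom_add[of 0 0] by simp
lemma hom_of_nat: "\<iota> (of_nat n) = of_nat n" by (induction n) (auto simp: hom_zero hom_one hom_add)
lemma hom_sum: "\<iota> (sum f S) = (\<Sum>x\<in>S. \<iota> (f x))"
  by (induction S rule: infinite_finite_induct) (auto simp: hom_zero hom_add)
lemma hom_prod_mset: "\<iota> (\<Prod>x\<in>#M. f x) = (\<Prod>x\<in>#M. \<iota> (f x))"
  by (induction M) (auto simp: hom_one hom_mult)

definition eval_poly_hom :: "'k poly \<Rightarrow> 'b \<Rightarrow> 'b" where
  "eval_poly_hom p x = poly (map_poly \<iota> p) x"

lemma eval_poly_hom_0: "eval_poly_hom 0 x = 0"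
  by (simp add: eval_poly_hom_def)

lemma eval_poly_hom_pCons: "eval_poly_hom (pCons a p) x = \<iota> a + x * eval_poly_hom p x"
  by (cases "a = 0 \<and> p = 0") (auto simp: eval_poly_hom_def map_poly_pCons hom_zero)

lemma eval_poly_hom_add: "eval_poly_hom (p + q) x = eval_poly_hom p x + eval_poly_hom q x"
  by (induction p q rule: poly_induct2)
    (auto simp: eval_poly_hom_0 eval_poly_hom_pCons hom_zero hom_add algebra_simps)

lemma eval_poly_hom_smult: "eval_poly_hom (smult c p) x = \<iota> c * eval_poly_hom p x"
  by (induction p) (auto simp: eval_poly_hom_0 eval_poly_hom_pCons hom_mult algebra_simps)

lemma eval_poly_hom_mult: "eval_poly_hom (p * q) x = eval_poly_hom p x * eval_poly_hom q x"
  by (induction p)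
    (auto simp: eval_poly_hom_0 eval_poly_hom_pCons eval_poly_hom_add eval_poly_hom_smult hom_zero algebra_simps)

lemma eval_poly_hom_diff: "eval_poly_hom (p - q) x = eval_poly_hom p x - eval_poly_hom q x"
  using eval_poly_hom_add[of "p - q" q x] by simp

lemma eval_poly_hom_monom: "eval_poly_hom (monom c l) x = \<iota> c * x ^ l"
  by (induction l) (auto simp: monom_0 monom_Suc eval_poly_hom_0 eval_poly_hom_pCons hom_zero algebra_simps)

lemma eval_poly_hom_sum: "eval_poly_hom (sum f S) x = (\<Sum>i\<in>S. eval_poly_hom (f i) x)"
  by (induction S rule: infinite_finite_induct) (auto simp: eval_poly_hom_0 eval_poly_hom_add)

lemma eval_dpoly_zero: "eval_dpoly \<iota> v 0 = 0" by (simp add: eval_dpoly_def)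

lemma eval_dpoly_single: "eval_dpoly \<iota> v (Poly_Mapping.single M c) = \<iota> c * (\<Prod>x\<in>#M. v x)"
  by (simp add: eval_dpoly_def hom_zero)

lemma eval_dpoly_add: "eval_dpoly \<iota> v (p + q) = eval_dpoly \<iota> v p + eval_dpoly \<iota> v q"
  unfolding eval_dpoly_def
  by (rule setsum_keys_plus_distrib) (simp_all add: hom_zero hom_add distrib_right)

lemma dpoly_eq_sum_single: "p = (\<Sum>M\<in>Poly_Mapping.keys p. Poly_Mapping.single M (Poly_Mapping.lookup p M))"
  by (rule poly_mapping_eqI) (simp add: lookup_sum lookup_single when_def in_keys_iff)

lemma eval_dpoly_sum: "eval_dpoly \<iota> v (sum f S) = (\<Sum>i\<in>S. eval_dpoly \<iota> v (f i))"
  by (induction S rule: infinite_finite_induct) (auto simp: eval_dpoly_zero eval_dpoly_add)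

lemma eval_dpoly_mult: "eval_dpoly \<iota> v (p * q) = eval_dpoly \<iota> v p * eval_dpoly \<iota> v q"
proof -
  have "p * q = (\<Sum>M\<in>Poly_Mapping.keys p. \<Sum>L\<in>Poly_Mapping.keys q.
      Poly_Mapping.single (M + L) (Poly_Mapping.lookup p M * Poly_Mapping.lookup q L))"
    by (subst dpoly_eq_sum_single[of p], subst dpoly_eq_sum_single[of q])
      (simp add: sum_product mult_single)
  then have "eval_dpoly \<iota> v (p * q) = (\<Sum>M\<in>Poly_Mapping.keys p. \<Sum>L\<in>Poly_Mapping.keys q.
      \<iota> (Poly_Mapping.lookup p M * Poly_Mapping.lookup q L) * (\<Prod>x\<in>#M + L. v x))"
    by (simp only: eval_dpoly_sum eval_dpoly_single)
  also have "\<dots> = eval_dpoly \<iota> v p * eval_dpoly \<iota> v q"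
    by (simp add: eval_dpoly_def sum_product hom_mult algebra_simps)
  finally show ?thesis .
qed

lemma eval_dpoly_one: "eval_dpoly \<iota> v 1 = 1"
  using eval_dpoly_single[of v "{#}" 1] by (simp add: hom_one flip: single_one)

lemma eval_dpoly_hom: "ring_homomorphism (eval_dpoly \<iota> v)"
  by unfold_locales (auto simp: eval_dpoly_add eval_dpoly_mult eval_dpoly_one)

end

definition dpolys_over :: "(nat \<times> nat) set \<Rightarrow> 'k::comm_ring_1 dpoly set" where
  "dpolys_over W = {p. \<forall>M\<in>Poly_Mapping.keys p. set_mset M \<subseteq> W}"

lemma dpolys_over_0: "0 \<in> dpolys_over W" by (simp add: dpolys_over_def)
lemma dpolys_over_1: "1 \<in> dpolys_over W" by (simp add: dpolys_over_def flip: empty_neutral)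
lemma dpolys_over_add: "p \<in> dpolys_over W \<Longrightarrow> q \<in> dpolys_over W \<Longrightarrow> p + q \<in> dpolys_over W"
  using keys_add[of p q] unfolding dpolys_over_def by blast
lemma dpolys_over_uminus: "p \<in> dpolys_over W \<Longrightarrow> - p \<in> dpolys_over W"
  by (simp add: dpolys_over_def in_keys_iff)
lemma dpolys_over_diff: "p \<in> dpolys_over W \<Longrightarrow> q \<in> dpolys_over W \<Longrightarrow> p - q \<in> dpolys_over W"
  using dpolys_over_add[OF _ dpolys_over_uminus, of p W q] by simp
lemma dpolys_over_mult: "p \<in> dpolys_over W \<Longrightarrow> q \<in> dpolys_over W \<Longrightarrow> p * q \<in> dpolys_over W"
  using keys_mult[of p q] unfolding dpolys_over_def by fastforce
lemma dpolys_over_of_nat: "of_nat n \<in> dpolys_over W"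
  by (induction n) (auto simp: dpolys_over_0 dpolys_over_1 intro: dpolys_over_add)
lemma dpolys_over_sum: "(\<And>i. i \<in> S \<Longrightarrow> f i \<in> dpolys_over W) \<Longrightarrow> sum f S \<in> dpolys_over W"
  by (induction S rule: infinite_finite_induct) (auto intro: dpolys_over_0 dpolys_over_add)

lemma eval_dpoly_cong:
  assumes "p \<in> dpolys_over W" "\<And>x. x \<in> W \<Longrightarrow> v x = w x"
  shows "eval_dpoly \<iota> v p = eval_dpoly \<iota> w p"
  unfolding eval_dpoly_def
proof (rule sum.cong[OF refl])
  fix M assume "M \<in> Poly_Mapping.keys p"
  then have "image_mset v M = image_mset w M"
    using assms by (intro image_mset_cong) (auto simp: dpolys_over_def)
  then show "\<iota> (Poly_Mapping.lookup p M) * (\<Prod>x\<in>#M. v x) = \<iota> (Poly_Mapping.lookup p M) * (\<Prod>x\<in>#M. w x)"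
    by simp
qed

instance fract :: ("{idom, ring_char_0}") field_char_0
proof
  have "of_nat n = Fract (of_nat n) (1::'a)" for n
    by (induction n) (auto simp: Zero_fract_def One_fract_def)
  then show "inj (of_nat :: nat \<Rightarrow> 'a fract)"
    by (auto simp: inj_on_def eq_fract)
qed

text \<open>
  The coefficient field of the power series: algebraically closed, and containing the symbols
  \<open>x\<^sub>i\<^sup>(\<^sup>j\<^sup>)\<close> as algebraically independent elements over \<open>'k\<close>.
\<close>

type_synonym 'k dfield = "'k dpoly fract alg_closure"

definition embed :: "'k::field_char_0 dpoly \<Rightarrow> 'k dfield" where
  "embed p = to_ac (Fract p 1)"

definition scal :: "'k::field_char_0 \<Rightarrow> 'k dfield" where
  "scal c = embed (Poly_Mapping.single {#} c)"

definition indet :: "nat \<times> nat \<Rightarrow> 'k::field_char_0 dfield" where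
  "indet x = embed (Poly_Mapping.single {#x#} 1)"

lemma embed_hom: "ring_homomorphism embed"
  by unfold_locales (simp_all add: embed_def flip: to_ac_add to_ac_mult add: One_fract_def[symmetric])

lemma embed_eq_0_iff: "embed p = 0 \<longleftrightarrow> p = 0"
  by (simp add: embed_def Zero_fract_def eq_fract)

lemma scal_hom: "ring_homomorphism scal"
proof -
  interpret ring_homomorphism embed by (rule embed_hom)
  have 1: "Poly_Mapping.single {#} 1 = (1 :: 'a dpoly)" using single_one by (simp add: empty_neutral)
  show ?thesis
    by unfold_locales
      (simp_all add: scal_def single_add hom_add 1 hom_one mult_single flip: hom_mult)
qed

lemma embed_eq_eval: "embed p = eval_dpoly scal indet p"
proof -
  interpret ring_homomorphism embed by (rule embed_hom)
  have *: "embed (Poly_Mapping.single M c) = scal c * (\<Prod>x\<in>#M. indet x)" for M and c :: 'a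
  proof (induction M)
    case (add x M)
    have "Poly_Mapping.single (add_mset x M) c = Poly_Mapping.single {#x#} 1 * Poly_Mapping.single M c"
      by (simp add: mult_single)
    then show ?case using add by (simp only: hom_mult image_mset_add_mset prod_mset.add_mset indet_def ac_simps)
  qed (simp add: scal_def)
  have "embed p = embed (\<Sum>M\<in>Poly_Mapping.keys p. Poly_Mapping.single M (Poly_Mapping.lookup p M))"
    by (subst ring_homomorphism.dpoly_eq_sum_single[OF embed_hom]) (rule refl)
  then show ?thesis by (simp only: hom_sum * eval_dpoly_def)
qed

text \<open>
  The power series whose \<open>j\<close>-th derivative at \<open>0\<close> is the symbol \<open>x\<^sub>i\<^sup>(\<^sup>j\<^sup>)\<close>.
\<close>

definition generic_series :: "nat \<Rightarrow> 'k::field_char_0 dfield fps" where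
  "generic_series i = Abs_fps (\<lambda>j. indet (i, j) / fact j)"

definition jet :: "(nat \<Rightarrow> 'c::comm_ring_1 fps) \<Rightarrow> nat \<times> nat \<Rightarrow> 'c fps" where
  "jet v = (\<lambda>(i, j). (fps_deriv ^^ j) (v i))"

definition eval_at :: "(nat \<Rightarrow> 'k::field_char_0 dfield fps) \<Rightarrow> 'k dpoly \<Rightarrow> 'k dfield fps" where
  "eval_at v = eval_dpoly (\<lambda>c. fps_const (scal c)) (jet v)"

lemma const_scal_hom: "ring_homomorphism (\<lambda>c. fps_const (scal c))"
proof -
  interpret ring_homomorphism scal by (rule scal_hom)
  show ?thesis by unfold_locales (simp_all add: hom_add hom_mult hom_one)
qed

lemma eval_at_hom: "ring_homomorphism (eval_at v)"
  unfolding eval_at_def by (rule ring_homomorphism.eval_dpoly_hom[OF const_scal_hom])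

lemma jet_nth_0: "fps_nth (jet v (i, j)) 0 = fact j * fps_nth (v i) j"
  for v :: "nat \<Rightarrow> 'c::field_char_0 fps"
  using derivs_nth[of 0 j "v i"] by (simp add: jet_def)

lemma jet_generic_nth_0: "v i = generic_series i \<Longrightarrow> fps_nth (jet v (i, j)) 0 = indet (i, j)"
  by (simp add: jet_nth_0 generic_series_def)

lemma nth_0_hom: "ring_homomorphism (\<lambda>f :: 'c::comm_ring_1 fps. fps_nth f 0)"
  by unfold_locales simp_all

text \<open>
  A differential polynomial can be read off from its value at generic series, already from the
  constant term.
\<close>

lemma eval_at_nth_0:
  assumes "p \<in> dpolys_over W" "\<And>x. x \<in> W \<Longrightarrow> fps_nth (jet v x) 0 = indet x"
  shows "fps_nth (eval_at v p) 0 = embed p"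
proof -
  interpret ring_homomorphism "\<lambda>f :: 'a dfield fps. fps_nth f 0" by (rule nth_0_hom)
  have "fps_nth (eval_at v p) 0 = eval_dpoly scal (\<lambda>x. fps_nth (jet v x) 0) p"
    unfolding eval_at_def eval_dpoly_def by (simp add: hom_sum hom_mult hom_prod_mset)
  also have "\<dots> = embed p" unfolding embed_eq_eval by (rule eval_dpoly_cong[OF assms])
  finally show ?thesis .
qed

text \<open>
  Collects the powers of the symbol \<open>s\<close>; the coefficients no longer involve \<open>s\<close>.
\<close>

definition as_poly :: "nat \<times> nat \<Rightarrow> 'k::comm_ring_1 dpoly \<Rightarrow> 'k dpoly poly" where
  "as_poly s p = (\<Sum>M\<in>Poly_Mapping.keys p.
     monom (Poly_Mapping.single (filter_mset (\<lambda>x. x \<noteq> s) M) (Poly_Mapping.lookup p M)) (count M s))"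

lemma filter_mset_decomp: "M = filter_mset (\<lambda>x. x \<noteq> s) M + replicate_mset (count M s) s"
  by (rule multiset_eqI) auto

lemma (in ring_homomorphism) eval_as_poly:
  "eval_dpoly \<iota> v p = ring_homomorphism.eval_poly_hom (eval_dpoly \<iota> v) (as_poly s p) (v s)"
proof -
  interpret E: ring_homomorphism "eval_dpoly \<iota> v" by (rule eval_dpoly_hom)
  have "c * (\<Prod>x\<in>#M. v x) = c * (\<Prod>x\<in>#filter_mset (\<lambda>x. x \<noteq> s) M. v x) * v s ^ count M s" for c M
    by (subst filter_mset_decomp[of M s]) (simp add: mult.assoc)
  then show ?thesis
    unfolding as_poly_def E.eval_poly_hom_sum E.eval_poly_hom_monom eval_dpoly_single eval_dpoly_def[of _ _ p]
    by (rule sum.cong[OF refl])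
qed

lemma coeff_as_poly_over:
  assumes "p \<in> dpolys_over W" shows "coeff (as_poly s p) l \<in> dpolys_over (W - {s})"
  unfolding as_poly_def coeff_sum
proof (rule dpolys_over_sum)
  fix M assume "M \<in> Poly_Mapping.keys p"
  then show "coeff (monom (Poly_Mapping.single (filter_mset (\<lambda>x. x \<noteq> s) M) (Poly_Mapping.lookup p M)) (count M s)) l \<in> dpolys_over (W - {s})"
    using assms by (auto simp: dpolys_over_def coeff_monom)
qed

text \<open>
  Two monomials with the same exponent of \<open>s\<close> and the same remaining factors are equal, so no
  cancellation can occur in the coefficients.
\<close>

lemma degree_as_poly_pos:
  assumes "M \<in> Poly_Mapping.keys p" "s \<in># M"
  shows "degree (as_poly s p) > 0"
proof -
  have "Poly_Mapping.lookup (coeff (as_poly s p) (count M s)) (filter_mset (\<lambda>x. x \<noteq> s) M)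
    = (\<Sum>L\<in>Poly_Mapping.keys p. if L = M then Poly_Mapping.lookup p M else 0)"
    unfolding as_poly_def coeff_sum lookup_sum
  proof (rule sum.cong[OF refl])
    fix L
    show "Poly_Mapping.lookup (coeff (monom (Poly_Mapping.single (filter_mset (\<lambda>x. x \<noteq> s) L) (Poly_Mapping.lookup p L)) (count L s)) (count M s)) (filter_mset (\<lambda>x. x \<noteq> s) M)
      = (if L = M then Poly_Mapping.lookup p M else 0)"
    proof (cases "count L s = count M s \<and> filter_mset (\<lambda>x. x \<noteq> s) L = filter_mset (\<lambda>x. x \<noteq> s) M")
      case True
      then have "L = M" by (metis filter_mset_decomp)
      then show ?thesis by (simp add: coeff_monom)
    next
      case False
      then show ?thesis by (auto simp: coeff_monom lookup_single when_def)
    qed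
  qed
  also have "\<dots> \<noteq> 0" using assms(1) by (simp add: in_keys_iff)
  finally have "coeff (as_poly s p) (count M s) \<noteq> 0" by auto
  then have "count M s \<le> degree (as_poly s p)" by (rule le_degree)
  moreover have "count M s > 0" using assms(2) by simp
  ultimately show ?thesis by linarith
qed

lemma (in ring_homomorphism) hom_poly: "\<iota> (poly p x) = eval_poly_hom p (\<iota> x)"
  by (induction p) (auto simp: eval_poly_hom_0 eval_poly_hom_pCons hom_zero hom_add hom_mult)

lemma map_poly_pderiv:
  fixes \<iota> :: "'a::idom \<Rightarrow> 'b::idom"
  assumes "ring_homomorphism \<iota>"
  shows "map_poly \<iota> (pderiv p) = pderiv (map_poly \<iota> p)"
proof -
  interpret ring_homomorphism \<iota> by fact
  show ?thesis
    by (rule poly_eqI) (simp add: coeff_map_poly coeff_pderiv hom_zero hom_one hom_mult hom_add hom_of_nat)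
qed

text \<open>
  A root \<open>\<rho>\<close> of \<open>f\<close> may be multiple. Among all polynomials with coefficients over \<open>W\<close> that vanish at \<open>\<rho>\<close>
  take \<open>g\<close> of least degree. Its derivative has smaller degree and is not zero in characteristic \<open>0\<close>,
  so it cannot vanish at \<open>\<rho>\<close>; and \<open>g\<close> divides \<open>f\<close> up to a factor \<open>c\<close> by pseudo-division, since a
  remainder would vanish at \<open>\<rho>\<close> too.
\<close>

lemma minimal_relation_at_root:
  fixes f :: "'k::field_char_0 dpoly poly"
  assumes f_over: "\<And>l. coeff f l \<in> dpolys_over W" and deg: "degree f > 0"
  obtains \<rho> g c q where "poly (map_poly embed g) \<rho> = 0" "poly (map_poly embed (pderiv g)) \<rho> \<noteq> 0"
    "\<And>l. coeff g l \<in> dpolys_over W" "c \<in> dpolys_over W" "c \<noteq> 0" "smult c f = q * g"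
proof -
  interpret E: ring_homomorphism "embed :: 'k dpoly \<Rightarrow> 'k dfield" by (rule embed_hom)
  have root_iff: "poly (map_poly embed p) x = E.eval_poly_hom p x" for p x
    by (simp add: E.eval_poly_hom_def)
  have "degree (map_poly embed f) = degree f"
    by (rule degree_map_poly) (use deg in \<open>auto simp: embed_eq_0_iff\<close>)
  then obtain \<rho> where \<rho>: "poly (map_poly embed f) \<rho> = 0"
    using alg_closed_imp_poly_has_root deg by metis
  define rel where "rel p \<longleftrightarrow> p \<noteq> 0 \<and> (\<forall>l. coeff p l \<in> dpolys_over W) \<and> poly (map_poly embed p) \<rho> = 0" for p
  have "rel f" using f_over deg \<rho> by (auto simp: rel_def)
  then obtain g where g: "rel g" and min: "\<And>p. rel p \<Longrightarrow> degree g \<le> degree p"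
    using ex_has_least_nat[of rel f degree] by blast
  have gW: "coeff g l \<in> dpolys_over W" for l using g by (simp add: rel_def)
  have deg_g: "degree g > 0"
  proof (rule ccontr)
    assume "\<not> degree g > 0"
    then obtain a where a: "g = [:a:]" using degree_eq_zeroE by blast
    then show False using g by (auto simp: rel_def map_poly_pCons E.hom_zero embed_eq_0_iff)
  qed
  have "poly (map_poly embed (pderiv g)) \<rho> \<noteq> 0"
  proof
    assume 0: "poly (map_poly embed (pderiv g)) \<rho> = 0"
    have "pderiv g \<noteq> 0" using deg_g by (simp add: pderiv_eq_0_iff)
    moreover have "coeff (pderiv g) l \<in> dpolys_over W" for l
      unfolding coeff_pderiv by (intro dpolys_over_mult gW dpolys_over_of_nat)
    ultimately have "rel (pderiv g)" using 0 by (simp add: rel_def)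
    from min[OF this] show False using deg_g by (simp add: degree_pderiv)
  qed
  moreover have "\<exists>c q. c \<in> dpolys_over W \<and> c \<noteq> 0 \<and> smult c p = q * g"
    if "\<forall>l. coeff p l \<in> dpolys_over W" "poly (map_poly embed p) \<rho> = 0" for p
    using that
  proof (induction "degree p" arbitrary: p rule: less_induct)
    case less
    show ?case
    proof (cases "p = 0")
      case True
      then show ?thesis by (intro exI[of _ 1] exI[of _ 0]) (simp add: dpolys_over_1)
    next
      case False
      then have le: "degree g \<le> degree p" using less.prems by (intro min) (simp add: rel_def)
      define m where "m = monom (lead_coeff p) (degree p - degree g)"
      define p' where "p' = smult (lead_coeff g) p - m * g"
      have m_deg: "degree (m * g) \<le> degree p"
        using degree_mult_le[of m g] degree_monom_le[of "lead_coeff p" "degree p - degree g"] le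
        unfolding m_def by linarith
      have "coeff (m * g) (degree p) = lead_coeff p * lead_coeff g"
        unfolding m_def coeff_monom_mult using le by simp
      then have "coeff p' (degree p) = 0" by (simp add: p'_def)
      moreover have "degree p' \<le> degree p"
        unfolding p'_def by (intro degree_diff_le m_deg) simp
      ultimately have dp': "degree p' < degree p"
        using le deg_g by (metis degree_0 leading_coeff_0_iff le_neq_implies_less not_less_zero less_le_trans)
      have "coeff p' l \<in> dpolys_over W" for l
      proof -
        have "coeff (m * g) l \<in> dpolys_over W"
          unfolding m_def coeff_monom_mult using less.prems(1) gW
          by (auto intro: dpolys_over_mult dpolys_over_0)
        then show ?thesis unfolding p'_def using less.prems(1) gW
          by (auto intro: dpolys_over_mult dpolys_over_diff)
      qed
      moreover have "poly (map_poly embed p') \<rho> = 0"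
        using less.prems(2) g unfolding rel_def root_iff p'_def
        by (simp add: E.eval_poly_hom_diff E.eval_poly_hom_smult E.eval_poly_hom_mult)
      ultimately obtain c q where c: "c \<in> dpolys_over W" "c \<noteq> 0" "smult c p' = q * g"
        using less.hyps[OF dp'] by blast
      have "smult (c * lead_coeff g) p = (q + smult c m) * g"
        using c(3) by (simp add: p'_def smult_diff_right algebra_simps)
      moreover have "c * lead_coeff g \<noteq> 0" using c(2) g by (simp add: rel_def)
      moreover have "c * lead_coeff g \<in> dpolys_over W" using c(1) gW by (intro dpolys_over_mult) auto
      ultimately show ?thesis by blast
    qed
  qed
  ultimately show ?thesis using that f_over \<rho> g gW unfolding rel_def by blast
qed

lemma eval_at_agree:
  assumes "p \<in> dpolys_over W" "\<And>x. x \<in> W \<Longrightarrow> fps_agree m (jet v x) (jet w x)"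
  shows "fps_agree m (eval_at v p) (eval_at w p)"
  unfolding eval_at_def eval_dpoly_def
  using assms by (intro fps_agree_sum fps_agree_mult fps_agree_prod_mset) (auto simp: dpolys_over_def)

text \<open>
  Let \<open>r\<close> be the largest order of a derivative of the variable \<open>n\<close> in \<open>d\<close>. The symbols in \<open>W\<close> get
  independent values at \<open>0\<close>, the symbol \<open>s = (n, r)\<close> gets a root \<open>\<rho>\<close> of \<open>d\<close>. The differential equation given
  by the minimal relation \<open>g\<close> of \<open>\<rho>\<close> has nonvanishing separant at this initial jet, hence a solution \<open>y\<close>.
  It also solves \<open>d\<close>: there \<open>c d\<close> is a multiple of \<open>g\<close>, and \<open>c\<close>, involving only symbols in \<open>W\<close>, does
  not vanish at \<open>y\<close>.
\<close>

theorem differential_freiheitssatz: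
  fixes d :: "'k::field_char_0 dpoly"
  assumes occ: "M \<in> Poly_Mapping.keys d" "(n, j) \<in># M"
  shows "\<exists>v. eval_at v d = 0 \<and> (\<forall>i. i \<noteq> n \<longrightarrow> v i = generic_series i)"
proof -
  define J where "J = snd ` {x \<in> (\<Union>M\<in>Poly_Mapping.keys d. set_mset M). fst x = n}"
  have "finite J" by (simp add: J_def)
  moreover have "j \<in> J" using occ by (force simp: J_def)
  ultimately obtain r where r: "r \<in> J" and max: "\<And>i. i \<in> J \<Longrightarrow> i \<le> r"
    by (metis Max_ge Max_in empty_iff)
  obtain M' where M': "M' \<in> Poly_Mapping.keys d" "(n, r) \<in># M'" using r by (auto simp: J_def)
  define s where "s = (n, r)"
  define W where "W = {x. fst x \<noteq> n \<or> snd x < r}"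
  have "d \<in> dpolys_over (insert s W)"
    unfolding dpolys_over_def
  proof (intro CollectI ballI subsetI)
    fix L x assume L: "L \<in> Poly_Mapping.keys d" "x \<in># L"
    show "x \<in> insert s W"
    proof (cases "fst x = n")
      case True
      then have "snd x \<in> J" using L by (auto simp: J_def)
      then have "snd x \<le> r" by (rule max)
      then show ?thesis using True by (auto simp: s_def W_def prod_eq_iff)
    qed (simp add: W_def)
  qed
  moreover have "s \<notin> W" by (simp add: s_def W_def)
  ultimately have f_over: "coeff (as_poly s d) l \<in> dpolys_over W" for l
    using coeff_as_poly_over[of d "insert s W" s l] by simp
  have "degree (as_poly s d) > 0" using degree_as_poly_pos M' by (simp add: s_def)
  then obtain \<rho> g c q where g: "poly (map_poly embed g) \<rho> = 0" "poly (map_poly embed (pderiv g)) \<rho> \<noteq> 0"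
    "\<And>l. coeff g l \<in> dpolys_over W" and c: "c \<in> dpolys_over W" "c \<noteq> 0" "smult c (as_poly s d) = q * g"
    using minimal_relation_at_root[OF f_over] by metis
  define V where "V y = generic_series(n := y)" for y :: "'k dfield fps"
  define A where "A y = map_poly (eval_at (V y)) g" for y
  define y0 where "y0 = Abs_fps (\<lambda>i. (if i < r then indet (n, i) else \<rho>) / fact i)"
  have coeff_A: "coeff (A y) l = eval_at (V y) (coeff g l)" for y l
    unfolding A_def by (simp add: coeff_map_poly ring_homomorphism.hom_zero[OF eval_at_hom])
  have jet0: "fps_nth (jet (V y) x) 0 = indet x" if "fps_agree r y y0" "x \<in> W" for y x
  proof (cases x)
    case (Pair i k)
    show ?thesis
    proof (cases "i = n")
      case True
      then have "k < r" using that(2) Pair by (simp add: W_def)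
      then have "fps_nth y k = indet (n, k) / fact k" using that(1) by (simp add: fps_agree_def y0_def)
      then show ?thesis using Pair True by (simp add: jet_nth_0 V_def)
    qed (simp add: Pair jet_generic_nth_0 V_def)
  qed
  have y0_r: "fps_nth ((fps_deriv ^^ r) y0) 0 = \<rho>"
    using derivs_nth[of 0 r y0] by (simp add: y0_def)
  interpret Z: ring_homomorphism "\<lambda>f :: 'k dfield fps. fps_nth f 0" by (rule nth_0_hom)
  have at_0: "fps_nth (poly (map_poly (eval_at (V y0)) p) ((fps_deriv ^^ r) y0)) 0 = poly (map_poly embed p) \<rho>"
    if "\<And>l. coeff p l \<in> dpolys_over W" for p
  proof -
    have "map_poly (\<lambda>f. fps_nth f 0) (map_poly (eval_at (V y0)) p) = map_poly embed p"
      by (rule poly_eqI)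
        (simp add: coeff_map_poly ring_homomorphism.hom_zero[OF eval_at_hom]
          ring_homomorphism.hom_zero[OF embed_hom] eval_at_nth_0[OF that] jet0)
    then show ?thesis by (simp add: Z.hom_poly Z.eval_poly_hom_def y0_r)
  qed
  have "\<exists>y. fps_agree (Suc r) y y0 \<and> poly (A y) ((fps_deriv ^^ r) y) = 0"
  proof (rule ode_power_series_solution)
    fix m y y' l assume yy': "fps_agree (m + r) y (y' :: 'k dfield fps)"
    show "fps_agree (Suc m) (coeff (A y) l) (coeff (A y') l)"
      unfolding coeff_A
    proof (rule eval_at_agree[OF g(3)])
      fix x assume "x \<in> W"
      then show "fps_agree (Suc m) (jet (V y) x) (jet (V y') x)"
        using yy' by (cases x) (auto simp: jet_def V_def W_def intro!: fps_agree_derivs elim!: fps_agree_mono)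
    qed
  next
    show "fps_nth (poly (A y0) ((fps_deriv ^^ r) y0)) 0 = 0"
      unfolding A_def using at_0[OF g(3)] g(1) by simp
    show "fps_nth (poly (pderiv (A y0)) ((fps_deriv ^^ r) y0)) 0 \<noteq> 0"
      unfolding A_def map_poly_pderiv[OF eval_at_hom, symmetric]
      using at_0[of "pderiv g"] g(2) unfolding coeff_pderiv
      by (simp add: dpolys_over_mult g(3) dpolys_over_of_nat del: of_nat_Suc)
  qed
  then obtain y where y: "fps_agree (Suc r) y y0" "poly (A y) ((fps_deriv ^^ r) y) = 0" by blast
  interpret E: ring_homomorphism "eval_at (V y)" by (rule eval_at_hom)
  have jety: "fps_nth (jet (V y) x) 0 = indet x" if "x \<in> W" for x
    using jet0[OF fps_agree_mono[OF y(1)] that] by simp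
  have "fps_nth (eval_at (V y) c) 0 = embed c" by (rule eval_at_nth_0[OF c(1) jety])
  then have nonzero: "eval_at (V y) c \<noteq> 0" using c(2) by (auto simp: embed_eq_0_iff)
  have js: "jet (V y) s = (fps_deriv ^^ r) y" by (simp add: jet_def V_def s_def)
  have "eval_at (V y) d = E.eval_poly_hom (as_poly s d) ((fps_deriv ^^ r) y)"
    using ring_homomorphism.eval_as_poly[OF const_scal_hom, of "jet (V y)" d s]
    unfolding eval_at_def[symmetric] js .
  then have "eval_at (V y) c * eval_at (V y) d = E.eval_poly_hom (q * g) ((fps_deriv ^^ r) y)"
    by (simp add: E.eval_poly_hom_smult flip: c(3))
  also have "\<dots> = 0"
    unfolding E.eval_poly_hom_mult using y(2) by (simp add: E.eval_poly_hom_def A_def)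
  finally have "eval_at (V y) d = 0" using nonzero by simp
  then show ?thesis by (intro exI[of _ "V y"]) (simp add: V_def)
qed

lemma eval_at_generic_inj:
  assumes "eval_at generic_series p = 0" shows "p = 0"
proof -
  have "fps_nth (eval_at generic_series p) 0 = embed p"
  proof (rule eval_at_nth_0[of _ UNIV])
    fix x show "fps_nth (jet generic_series x) 0 = indet x"
      by (cases x) (simp add: jet_generic_nth_0)
  qed (simp add: dpolys_over_def)
  then show ?thesis using assms by (simp add: embed_eq_0_iff)
qed

section \<open>Homomorphisms and quotients of algebras\<close>

context nonassoc_algebra
begin

lemma smult_zero_l: "x \<in> carrier A \<Longrightarrow> 0 \<odot> x = \<zero>"
  using smult_l_distr[of x 0 0] smult_closed[of x 0] by (metis add.r_cancel_one' add_0)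

lemma smult_zero_r: "c \<odot> \<zero> = \<zero>"
  using smult_r_distr[of \<zero> \<zero> c] smult_closed[of \<zero> c] by (metis add.r_cancel_one' l_zero zero_closed)

lemma smult_minus_one: "x \<in> carrier A \<Longrightarrow> \<ominus> x = (- 1) \<odot> x"
proof -
  assume x: "x \<in> carrier A"
  have "x \<oplus> (- 1) \<odot> x = (1 + - 1) \<odot> x" unfolding smult_l_distr[OF x] smult_one[OF x] ..
  also have "\<dots> = \<zero>" using smult_zero_l[OF x] by simp
  finally have "(- 1) \<odot> x \<oplus> x = \<zero>" using x by (simp add: add.m_comm smult_closed)
  then show ?thesis by (rule minus_equality[OF _ x smult_closed[OF x]])
qed

lemma mult_zero_l: "x \<in> carrier A \<Longrightarrow> \<zero> \<otimes> x = \<zero>"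
  using mult_l_distr[of \<zero> \<zero> x] mult_closed[of \<zero> x] by (metis add.r_cancel_one' l_zero zero_closed)

lemma mult_zero_r: "x \<in> carrier A \<Longrightarrow> x \<otimes> \<zero> = \<zero>"
  using mult_r_distr[of x \<zero> \<zero>] mult_closed[of x \<zero>] by (metis add.r_cancel_one' l_zero zero_closed)

lemma subspace_additive_subgroup:
  assumes "S \<subseteq> carrier A" "\<zero> \<in> S" "\<And>x y. x \<in> S \<Longrightarrow> y \<in> S \<Longrightarrow> x \<oplus> y \<in> S"
    "\<And>c x. x \<in> S \<Longrightarrow> c \<odot> x \<in> S"
  shows "additive_subgroup S A"
proof (rule additive_subgroup.intro, rule add.subgroupI)
  fix a assume "a \<in> S"
  then show "\<ominus> a \<in> S" using assms smult_minus_one by auto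
qed (use assms in auto)

lemma diff_eq_diff_iff:
  assumes "a \<in> carrier A" "b \<in> carrier A" "c \<in> carrier A" "d \<in> carrier A"
  shows "a \<ominus> b = c \<ominus> d \<longleftrightarrow> a \<oplus> d = c \<oplus> b"
proof
  assume "a \<ominus> b = c \<ominus> d"
  then have "(a \<ominus> b) \<oplus> (b \<oplus> d) = (c \<ominus> d) \<oplus> (b \<oplus> d)" by simp
  moreover have "(a \<ominus> b) \<oplus> (b \<oplus> d) = a \<oplus> d" using assms by (simp add: minus_eq add.m_assoc r_neg1)
  moreover have "(c \<ominus> d) \<oplus> (d \<oplus> b) = c \<oplus> b" using assms by (simp add: minus_eq add.m_assoc r_neg1)
  ultimately show "a \<oplus> d = c \<oplus> b" using assms by (simp add: add.m_comm[of d b])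
next
  assume h: "a \<oplus> d = c \<oplus> b"
  have "a \<ominus> b = (a \<oplus> d) \<oplus> (\<ominus> b \<oplus> \<ominus> d)"
    using assms by (simp add: minus_eq add.m_assoc add.m_comm[of "\<ominus> b"] r_neg1 r_neg2)
  also have "\<dots> = c \<ominus> d" unfolding h
    using assms by (simp add: minus_eq add.m_assoc r_neg1 r_neg2)
  finally show "a \<ominus> b = c \<ominus> d" .
qed

lemma diff_eq_zero_iff: "a \<in> carrier A \<Longrightarrow> b \<in> carrier A \<Longrightarrow> a \<ominus> b = \<zero> \<longleftrightarrow> a = b"
  using diff_eq_diff_iff[of a b b b] by (auto simp: minus_eq r_neg)

lemma novikov_algebra_iff:
  "novikov_algebra A \<longleftrightarrow>
    (\<forall>x\<in>carrier A. \<forall>y\<in>carrier A. \<forall>z\<in>carrier A.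
      (x \<otimes> y) \<otimes> z \<oplus> x \<otimes> (z \<otimes> y) = (x \<otimes> z) \<otimes> y \<oplus> x \<otimes> (y \<otimes> z) \<and> x \<otimes> (y \<otimes> z) = y \<otimes> (x \<otimes> z))"
  unfolding novikov_algebra_def novikov_algebra_axioms_def
  using nonassoc_algebra_axioms by (auto simp: diff_eq_diff_iff mult_closed)

lemma subalgebra_algebra:
  assumes "is_subalgebra A S" shows "nonassoc_algebra (A\<lparr>carrier := S\<rparr>)"
proof -
  have sub: "additive_subgroup S A" and sm: "\<And>c x. x \<in> S \<Longrightarrow> c \<odot> x \<in> S"
    and mu: "\<And>x y. x \<in> S \<Longrightarrow> y \<in> S \<Longrightarrow> x \<otimes> y \<in> S"
    using assms by (auto simp: is_subalgebra_def)
  have S: "S \<subseteq> carrier A" by (rule additive_subgroup.a_subset[OF sub])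
  have ad: "\<And>x y. x \<in> S \<Longrightarrow> y \<in> S \<Longrightarrow> x \<oplus> y \<in> S" by (rule additive_subgroup.a_closed[OF sub])
  have "abelian_group (A\<lparr>carrier := S\<rparr>)"
  proof (rule abelian_groupI)
    fix x assume "x \<in> carrier (A\<lparr>carrier := S\<rparr>)"
    then have "\<ominus> x \<in> S" "\<ominus> x \<oplus> x = \<zero>" using additive_subgroup.a_inv_closed[OF sub] S by (auto simp: l_neg)
    then show "\<exists>y\<in>carrier (A\<lparr>carrier := S\<rparr>). y \<oplus>\<^bsub>A\<lparr>carrier := S\<rparr>\<^esub> x = \<zero>\<^bsub>A\<lparr>carrier := S\<rparr>\<^esub>" by auto
  qed (use S ad additive_subgroup.zero_closed[OF sub] in \<open>auto simp: subset_iff add.m_assoc add.m_comm add.m_lcomm\<close>)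
  moreover have "nonassoc_algebra_axioms (A\<lparr>carrier := S\<rparr>)"
    using S sm mu by unfold_locales
      (auto simp: subset_iff smult_l_distr smult_r_distr smult_smult smult_one mult_l_distr mult_r_distr mult_smult_l mult_smult_r)
  ultimately show ?thesis by (rule nonassoc_algebra.intro)
qed

lemma is_subalgebraD: "is_subalgebra A S \<Longrightarrow> S \<subseteq> carrier A"
  by (auto simp: is_subalgebra_def dest: additive_subgroup.a_subset)

lemma subalgebraI:
  assumes "S \<subseteq> carrier A" "\<zero> \<in> S" "\<And>x y. x \<in> S \<Longrightarrow> y \<in> S \<Longrightarrow> x \<oplus> y \<in> S"
    "\<And>c x. x \<in> S \<Longrightarrow> c \<odot> x \<in> S" "\<And>x y. x \<in> S \<Longrightarrow> y \<in> S \<Longrightarrow> x \<otimes> y \<in> S"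
  shows "is_subalgebra A S"
  unfolding is_subalgebra_def using assms subspace_additive_subgroup[of S] by auto

lemma algebra_idealI:
  assumes "S \<subseteq> carrier A" "\<zero> \<in> S" "\<And>x y. x \<in> S \<Longrightarrow> y \<in> S \<Longrightarrow> x \<oplus> y \<in> S"
    "\<And>c x. x \<in> S \<Longrightarrow> c \<odot> x \<in> S" "\<And>a x. a \<in> carrier A \<Longrightarrow> x \<in> S \<Longrightarrow> a \<otimes> x \<in> S"
    "\<And>a x. a \<in> carrier A \<Longrightarrow> x \<in> S \<Longrightarrow> x \<otimes> a \<in> S"
  shows "is_algebra_ideal A S"
  unfolding is_algebra_ideal_def using assms subspace_additive_subgroup[of S] by auto

lemma subalgebra_closed:
  assumes "is_subalgebra A S"
  shows "\<zero> \<in> S" "\<And>x y. x \<in> S \<Longrightarrow> y \<in> S \<Longrightarrow> x \<oplus> y \<in> S" "\<And>c x. x \<in> S \<Longrightarrow> c \<odot> x \<in> S"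
    "\<And>x y. x \<in> S \<Longrightarrow> y \<in> S \<Longrightarrow> x \<otimes> y \<in> S"
proof -
  interpret S: additive_subgroup S A using assms by (simp add: is_subalgebra_def)
  show "\<zero> \<in> S" "\<And>x y. x \<in> S \<Longrightarrow> y \<in> S \<Longrightarrow> x \<oplus> y \<in> S" "\<And>c x. x \<in> S \<Longrightarrow> c \<odot> x \<in> S"
    "\<And>x y. x \<in> S \<Longrightarrow> y \<in> S \<Longrightarrow> x \<otimes> y \<in> S"
    using assms S.zero_closed S.a_closed by (simp_all add: is_subalgebra_def)
qed

lemma algebra_ideal_closed:
  assumes "is_algebra_ideal A S"
  shows "S \<subseteq> carrier A" "\<zero> \<in> S" "\<And>x y. x \<in> S \<Longrightarrow> y \<in> S \<Longrightarrow> x \<oplus> y \<in> S" "\<And>c x. x \<in> S \<Longrightarrow> c \<odot> x \<in> S"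
    "\<And>a x. a \<in> carrier A \<Longrightarrow> x \<in> S \<Longrightarrow> a \<otimes> x \<in> S" "\<And>a x. a \<in> carrier A \<Longrightarrow> x \<in> S \<Longrightarrow> x \<otimes> a \<in> S"
proof -
  interpret S: additive_subgroup S A using assms by (simp add: is_algebra_ideal_def)
  show "S \<subseteq> carrier A" by (rule S.a_subset)
  show "\<zero> \<in> S" "\<And>x y. x \<in> S \<Longrightarrow> y \<in> S \<Longrightarrow> x \<oplus> y \<in> S" "\<And>c x. x \<in> S \<Longrightarrow> c \<odot> x \<in> S"
    "\<And>a x. a \<in> carrier A \<Longrightarrow> x \<in> S \<Longrightarrow> a \<otimes> x \<in> S" "\<And>a x. a \<in> carrier A \<Longrightarrow> x \<in> S \<Longrightarrow> x \<otimes> a \<in> S"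
    using assms S.zero_closed S.a_closed by (simp_all add: is_algebra_ideal_def)
qed

lemma generated_subalgebra_is_subalgebra:
  assumes "S \<subseteq> carrier A" shows "is_subalgebra A (generated_subalgebra A S)"
proof -
  have car: "is_subalgebra A (carrier A)"
    by (rule subalgebraI) (auto simp: smult_closed mult_closed)
  show ?thesis
    unfolding generated_subalgebra_def hull_def
  proof (rule subalgebraI)
    show "\<Inter>{t. is_subalgebra A t \<and> S \<subseteq> t} \<subseteq> carrier A" using car assms by blast
  qed (simp_all add: subalgebra_closed)
qed

lemma generated_ideal_is_ideal:
  assumes "S \<subseteq> carrier A" shows "is_algebra_ideal A (generated_ideal A S)"
proof -
  have car: "is_algebra_ideal A (carrier A)"
    by (rule algebra_idealI) (auto simp: smult_closed mult_closed)
  show ?thesis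
    unfolding generated_ideal_def hull_def
  proof (rule algebra_idealI)
    show "\<Inter>{t. is_algebra_ideal A t \<and> S \<subseteq> t} \<subseteq> carrier A" using car assms by blast
  qed (simp_all add: algebra_ideal_closed)
qed

end

lemma generated_subalgebra_superset: "S \<subseteq> generated_subalgebra A S"
  by (simp add: generated_subalgebra_def hull_subset)

lemma generated_subalgebra_least: "is_subalgebra A T \<Longrightarrow> S \<subseteq> T \<Longrightarrow> generated_subalgebra A S \<subseteq> T"
  unfolding generated_subalgebra_def by (rule hull_minimal)

lemma generated_ideal_superset: "S \<subseteq> generated_ideal A S"
  by (simp add: generated_ideal_def hull_subset)

lemma generated_ideal_least: "is_algebra_ideal A T \<Longrightarrow> S \<subseteq> T \<Longrightarrow> generated_ideal A S \<subseteq> T"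
  unfolding generated_ideal_def by (rule hull_minimal)

text \<open>
  Homomorphisms that need not be undefined outside the carrier.
\<close>

definition alg_map :: "('k, 'a) module \<Rightarrow> ('k, 'b) module \<Rightarrow> ('a \<Rightarrow> 'b) \<Rightarrow> bool" where
  "alg_map A B h \<longleftrightarrow> h \<in> carrier A \<rightarrow> carrier B \<and>
    (\<forall>x\<in>carrier A. \<forall>y\<in>carrier A. h (x \<oplus>\<^bsub>A\<^esub> y) = h x \<oplus>\<^bsub>B\<^esub> h y \<and> h (x \<otimes>\<^bsub>A\<^esub> y) = h x \<otimes>\<^bsub>B\<^esub> h y) \<and>
    (\<forall>c. \<forall>x\<in>carrier A. h (c \<odot>\<^bsub>A\<^esub> x) = c \<odot>\<^bsub>B\<^esub> h x)"

lemma algebra_hom_iff: "h \<in> algebra_hom A B \<longleftrightarrow> alg_map A B h \<and> h \<in> extensional (carrier A)"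
  by (auto simp: algebra_hom_def alg_map_def PiE_def)

lemma alg_map_comp: "alg_map A B h \<Longrightarrow> alg_map B C g \<Longrightarrow> alg_map A C (\<lambda>x. g (h x))"
  by (simp add: alg_map_def Pi_iff)

locale algebra_map = A: nonassoc_algebra A + B: nonassoc_algebra B
  for A :: "('k::field, 'a) module" and B :: "('k, 'b) module" +
  fixes h assumes map: "alg_map A B h"
begin

lemma closed: "x \<in> carrier A \<Longrightarrow> h x \<in> carrier B"
  and add: "x \<in> carrier A \<Longrightarrow> y \<in> carrier A \<Longrightarrow> h (x \<oplus>\<^bsub>A\<^esub> y) = h x \<oplus>\<^bsub>B\<^esub> h y"
  and mult: "x \<in> carrier A \<Longrightarrow> y \<in> carrier A \<Longrightarrow> h (x \<otimes>\<^bsub>A\<^esub> y) = h x \<otimes>\<^bsub>B\<^esub> h y"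
  and smult: "x \<in> carrier A \<Longrightarrow> h (c \<odot>\<^bsub>A\<^esub> x) = c \<odot>\<^bsub>B\<^esub> h x"
  using map unfolding alg_map_def by auto

lemma zero: "h \<zero>\<^bsub>A\<^esub> = \<zero>\<^bsub>B\<^esub>"
  using smult[of "\<zero>\<^bsub>A\<^esub>" 0] A.smult_zero_r[of 0] B.smult_zero_l closed by auto

lemma minus: "x \<in> carrier A \<Longrightarrow> y \<in> carrier A \<Longrightarrow> h (x \<ominus>\<^bsub>A\<^esub> y) = h x \<ominus>\<^bsub>B\<^esub> h y"
  by (simp add: A.minus_eq B.minus_eq add A.smult_minus_one B.smult_minus_one smult closed A.smult_closed)

lemma kernel_ideal: "is_algebra_ideal A {x \<in> carrier A. h x = \<zero>\<^bsub>B\<^esub>}"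
  by (rule A.algebra_idealI)
    (auto simp: zero add mult smult closed A.smult_closed A.mult_closed B.smult_zero_r B.mult_zero_l B.mult_zero_r)

lemma equalizer_subalgebra:
  assumes "algebra_map A B g" shows "is_subalgebra A {x \<in> carrier A. h x = g x}"
proof -
  interpret g: algebra_map A B g by fact
  show ?thesis
    by (rule A.subalgebraI)
      (auto simp: zero add mult smult g.zero g.add g.mult g.smult A.smult_closed A.mult_closed)
qed

lemma preimage_subalgebra:
  assumes "is_subalgebra B S" shows "is_subalgebra A {x \<in> carrier A. h x \<in> S}"
  using B.subalgebra_closed[OF assms]
  by (intro A.subalgebraI) (auto simp: zero add mult smult A.smult_closed A.mult_closed)

lemma image_subalgebra:
  assumes "is_subalgebra A S" shows "is_subalgebra B (h ` S)"
proof (rule B.subalgebraI)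
  have S: "S \<subseteq> carrier A" by (rule A.is_subalgebraD[OF assms])
  note cl = A.subalgebra_closed[OF assms]
  show "h ` S \<subseteq> carrier B" using S closed by auto
  show "\<zero>\<^bsub>B\<^esub> \<in> h ` S" using cl(1) zero by (metis imageI)
  show "x \<oplus>\<^bsub>B\<^esub> y \<in> h ` S" if "x \<in> h ` S" "y \<in> h ` S" for x y
    using that S cl(2) add by (auto simp: subset_iff simp flip: add intro!: imageI)
  show "c \<odot>\<^bsub>B\<^esub> x \<in> h ` S" if "x \<in> h ` S" for c x
    using that S cl(3) by (auto simp: subset_iff simp flip: smult intro!: imageI)
  show "x \<otimes>\<^bsub>B\<^esub> y \<in> h ` S" if "x \<in> h ` S" "y \<in> h ` S" for x y
    using that S cl(4) by (auto simp: subset_iff simp flip: mult intro!: imageI)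
qed

lemma factor_through:
  assumes C: "nonassoc_algebra C" and g: "alg_map A C g" and surj: "carrier B = h ` carrier A"
    and ker: "\<And>x. x \<in> carrier A \<Longrightarrow> h x = \<zero>\<^bsub>B\<^esub> \<Longrightarrow> g x = \<zero>\<^bsub>C\<^esub>"
  shows "\<exists>g'. alg_map B C g' \<and> (\<forall>x\<in>carrier A. g' (h x) = g x)"
proof -
  interpret g: algebra_map A C g using C g by (simp add: algebra_map_def algebra_map_axioms_def A.nonassoc_algebra_axioms)
  define g' where "g' b = g (SOME x. x \<in> carrier A \<and> h x = b)" for b
  have g': "g' (h x) = g x" if x: "x \<in> carrier A" for x
  proof -
    define z where "z = (SOME z. z \<in> carrier A \<and> h z = h x)"
    have z: "z \<in> carrier A" "h z = h x"
      using someI[of "\<lambda>z. z \<in> carrier A \<and> h z = h x" x] x by (auto simp: z_def)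
    then have "h (z \<ominus>\<^bsub>A\<^esub> x) = \<zero>\<^bsub>B\<^esub>" using x by (simp add: minus closed B.diff_eq_zero_iff)
    then have "g (z \<ominus>\<^bsub>A\<^esub> x) = \<zero>\<^bsub>C\<^esub>" using x z ker by simp
    then have "g z = g x" using x z by (simp add: g.minus g.closed g.B.diff_eq_zero_iff)
    then show ?thesis by (simp add: g'_def z_def)
  qed
  have "alg_map B C g'"
    unfolding alg_map_def surj
    by (auto simp: g' g.closed g.add g.mult g.smult A.smult_closed A.mult_closed simp flip: add mult smult)
  then show ?thesis using g' by blast
qed

end

lemma algebra_mapI: "nonassoc_algebra A \<Longrightarrow> nonassoc_algebra B \<Longrightarrow> alg_map A B h \<Longrightarrow> algebra_map A B h"
  by (simp add: algebra_map_def algebra_map_axioms_def)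

lemma homomorphic_image_algebra:
  fixes A :: "('k::field, 'a) module" and B :: "('k, 'b) module"
  assumes A: "nonassoc_algebra A" and map: "alg_map A B h" and surj: "carrier B = h ` carrier A"
    and zero: "\<zero>\<^bsub>B\<^esub> = h \<zero>\<^bsub>A\<^esub>"
  shows "nonassoc_algebra B"
proof -
  interpret A: nonassoc_algebra A by fact
  have add: "h x \<oplus>\<^bsub>B\<^esub> h y = h (x \<oplus>\<^bsub>A\<^esub> y)" and mult: "h x \<otimes>\<^bsub>B\<^esub> h y = h (x \<otimes>\<^bsub>A\<^esub> y)"
    and smult: "c \<odot>\<^bsub>B\<^esub> h x = h (c \<odot>\<^bsub>A\<^esub> x)" if "x \<in> carrier A" "y \<in> carrier A" for x y c
    using map that by (auto simp: alg_map_def)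
  have "abelian_group B"
  proof (rule abelian_groupI)
    fix x assume "x \<in> carrier B"
    then obtain a where a: "a \<in> carrier A" "x = h a" using surj by auto
    have "h (\<ominus>\<^bsub>A\<^esub> a) \<oplus>\<^bsub>B\<^esub> x = \<zero>\<^bsub>B\<^esub>" using a by (simp add: add zero A.l_neg)
    then show "\<exists>y\<in>carrier B. y \<oplus>\<^bsub>B\<^esub> x = \<zero>\<^bsub>B\<^esub>" using a surj by auto
  qed (auto simp: surj add zero A.add.m_assoc A.add.m_comm A.add.m_lcomm)
  moreover have "nonassoc_algebra_axioms B"
    by unfold_locales (auto simp: surj add mult smult A.smult_closed A.mult_closed
      A.smult_l_distr A.smult_r_distr A.smult_smult A.smult_one A.mult_l_distr A.mult_r_distr A.mult_smult_l A.mult_smult_r)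
  ultimately show ?thesis by (rule nonassoc_algebra.intro)
qed

lemma homomorphic_image_novikov:
  fixes A :: "('k::field, 'a) module" and B :: "('k, 'b) module"
  assumes A: "novikov_algebra A" and B: "nonassoc_algebra B" and map: "alg_map A B h" and surj: "carrier B = h ` carrier A"
  shows "novikov_algebra B"
proof -
  interpret A: novikov_algebra A by fact
  interpret h: algebra_map A B h by (rule algebra_mapI[OF A.nonassoc_algebra_axioms B map])
  show ?thesis
    unfolding h.B.novikov_algebra_iff surj
    using A.novikov_algebra_iff A
    by (auto simp: A.mult_closed simp flip: h.add h.mult)
qed

context nonassoc_algebra
begin

lemma subalgebra_novikov:
  assumes "novikov_algebra A" "is_subalgebra A S" shows "novikov_algebra (A\<lparr>carrier := S\<rparr>)"
  unfolding nonassoc_algebra.novikov_algebra_iff[OF subalgebra_algebra[OF assms(2)]]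
  using assms(1) is_subalgebraD[OF assms(2)] unfolding novikov_algebra_iff by (auto simp: subset_iff)

context
  fixes I assumes I: "is_algebra_ideal A I"
begin

lemma ideal_abelian_subgroup: "abelian_subgroup I A"
  by (rule abelian_subgroupI3) (use I abelian_group_axioms in \<open>auto simp: is_algebra_ideal_def\<close>)

interpretation I: abelian_subgroup I A by (rule ideal_abelian_subgroup)

lemma coset_eq_iff:
  assumes "x \<in> carrier A" "y \<in> carrier A" shows "I +> x = I +> y \<longleftrightarrow> x \<ominus> y \<in> I"
proof
  assume "I +> x = I +> y"
  then have "x \<in> I +> y" using I.a_rcos_self[OF assms(1)] by simp
  then show "x \<ominus> y \<in> I" using I.a_rcos_module_imp[OF assms(2)] by (simp add: minus_eq)
next
  assume "x \<ominus> y \<in> I"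
  then have "x \<in> I +> y" using I.a_rcos_module_rev[OF assms(2,1)] by (simp add: minus_eq)
  then show "I +> x = I +> y" using I.a_repr_independence'[OF _ assms(2)] by simp
qed

lemma coset_shift: "x \<in> carrier A \<Longrightarrow> i \<in> I \<Longrightarrow> I +> (i \<oplus> x) = I +> x"
  using algebra_ideal_closed(1)[OF I] coset_eq_iff[of "i \<oplus> x" x]
  by (auto simp: minus_eq add.m_assoc r_neg subset_iff)

lemma coset_elem: "z \<in> I +> x \<Longrightarrow> \<exists>i\<in>I. z = i \<oplus> x"
  by (auto simp: a_r_coset_def' )

lemma quotient_proj_map: "alg_map A (quotient_algebra A I) (\<lambda>x. I +> x)"
proof -
  note cl = algebra_ideal_closed[OF I]
  have mult: "rcoset_mult A I (I +> x) (I +> y) = I +> (x \<otimes> y)" if x: "x \<in> carrier A" and y: "y \<in> carrier A" for x y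
  proof -
    have "I +> (a \<otimes> b) = I +> (x \<otimes> y)" if ab: "a \<in> I +> x" "b \<in> I +> y" for a b
    proof -
      obtain i j where ij: "i \<in> I" "j \<in> I" "a = i \<oplus> x" "b = j \<oplus> y" using coset_elem[OF ab(1)] coset_elem[OF ab(2)] by blast
      have ijA: "i \<in> carrier A" "j \<in> carrier A" using ij cl(1) by auto
      have "a \<otimes> b = (i \<otimes> b \<oplus> x \<otimes> j) \<oplus> x \<otimes> y"
        using x y ijA by (simp add: ij mult_l_distr mult_r_distr mult_closed add.m_assoc add.m_lcomm)
      moreover have "i \<otimes> b \<oplus> x \<otimes> j \<in> I" using ij ijA x y cl by simp
      ultimately show ?thesis using coset_shift x y by (simp add: mult_closed)
    qed
    moreover have "x \<in> I +> x" "y \<in> I +> y" using I.a_rcos_self x y by auto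
    ultimately show ?thesis unfolding rcoset_mult_def by blast
  qed
  have smult: "(\<Union>z\<in>I +> x. I +> (c \<odot> z)) = I +> (c \<odot> x)" if x: "x \<in> carrier A" for x c
  proof -
    have "I +> (c \<odot> z) = I +> (c \<odot> x)" if zx: "z \<in> I +> x" for z
    proof -
      obtain i where i: "i \<in> I" "z = i \<oplus> x" using coset_elem[OF zx] by blast
      have "i \<in> carrier A" using i cl(1) by auto
      then show ?thesis using coset_shift[of "c \<odot> x" "c \<odot> i"] x i cl(4) by (simp add: smult_r_distr smult_closed)
    qed
    moreover have "x \<in> I +> x" using I.a_rcos_self x by auto
    ultimately show ?thesis by blast
  qed
  show ?thesis
    by (auto simp: alg_map_def quotient_algebra_def mult smult I.a_rcos_sum a_rcosetsI[OF cl(1)])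
qed

lemma quotient_proj_surj: "carrier (quotient_algebra A I) = (\<lambda>x. I +> x) ` carrier A"
  by (auto simp: quotient_algebra_def A_RCOSETS_def')

lemma quotient_zero: "\<zero>\<^bsub>quotient_algebra A I\<^esub> = I +> \<zero>"
  using algebra_ideal_closed(1)[OF I] by (simp add: quotient_algebra_def a_coset_add_zero)

lemma quotient_is_algebra: "nonassoc_algebra (quotient_algebra A I)"
  by (rule homomorphic_image_algebra[OF nonassoc_algebra_axioms quotient_proj_map quotient_proj_surj quotient_zero])

lemma quotient_proj_eq_zero_iff: "x \<in> carrier A \<Longrightarrow> I +> x = \<zero>\<^bsub>quotient_algebra A I\<^esub> \<longleftrightarrow> x \<in> I"
proof -
  assume x: "x \<in> carrier A"
  have "\<ominus> \<zero> = \<zero>" by (rule minus_equality) auto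
  then have "x \<ominus> \<zero> = x" using x by (simp add: minus_eq)
  then show ?thesis unfolding quotient_zero using coset_eq_iff[OF x zero_closed] by simp
qed

end
end

section \<open>Free algebras\<close>

lemma (in novikov_algebra) novikov_defects_zero: "novikov_defects A \<subseteq> {\<zero>}"
  unfolding novikov_defects_def
  using right_symmetric left_commutative by (auto simp: diff_eq_zero_iff mult_closed)

definition word_vec :: "'v magma \<Rightarrow> 'v magma \<Rightarrow> 'k::field" where
  "word_vec w = (\<lambda>u. if u = w then 1 else 0)"

lemma carrier_free: "p \<in> carrier (free_nonassoc_algebra V) \<longleftrightarrow> finite {w. p w \<noteq> 0} \<and> (\<forall>w. p w \<noteq> 0 \<longrightarrow> gens w \<subseteq> V)"
  and zero_free: "\<zero>\<^bsub>free_nonassoc_algebra V\<^esub> = (\<lambda>w. 0)"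
  and add_free: "p \<oplus>\<^bsub>free_nonassoc_algebra V\<^esub> q = (\<lambda>w. p w + q w)"
  and smult_free: "c \<odot>\<^bsub>free_nonassoc_algebra V\<^esub> p = (\<lambda>w. c * p w)"
  and mult_free: "p \<otimes>\<^bsub>free_nonassoc_algebra V\<^esub> q = (\<lambda>w. case w of Gen v \<Rightarrow> 0 | Mul u v \<Rightarrow> p u * q v)"
  by (simp_all add: free_nonassoc_algebra_def)

lemma mult_free_support:
  "{w. (case w of Gen v \<Rightarrow> 0 | Mul u v \<Rightarrow> p u * q v) \<noteq> (0::'k::field)} = (\<lambda>(u, v). Mul u v) ` ({w. p w \<noteq> 0} \<times> {w. q w \<noteq> 0})"
proof (rule Set.set_eqI)
  show "w \<in> {w. (case w of Gen v \<Rightarrow> 0 | Mul u v \<Rightarrow> p u * q v) \<noteq> 0} \<longleftrightarrow> w \<in> (\<lambda>(u, v). Mul u v) ` ({w. p w \<noteq> 0} \<times> {w. q w \<noteq> 0})" for w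
    by (cases w) (auto simp: image_iff)
qed

lemma free_nonassoc_algebra_is_algebra: "nonassoc_algebra (free_nonassoc_algebra V :: ('k::field, 'v magma \<Rightarrow> 'k) module)"
proof -
  let ?F = "free_nonassoc_algebra V :: ('k, 'v magma \<Rightarrow> 'k) module"
  have add_closed: "(\<lambda>w. p w + q w) \<in> carrier ?F" if "p \<in> carrier ?F" "q \<in> carrier ?F" for p q
  proof -
    have "{w. p w + q w \<noteq> 0} \<subseteq> {w. p w \<noteq> 0} \<union> {w. q w \<noteq> 0}" by auto
    then show ?thesis using that unfolding carrier_free
      by (metis (mono_tags, lifting) add.right_neutral add_0 finite_Un finite_subset)
  qed
  have smult_closed: "(\<lambda>w. c * p w) \<in> carrier ?F" if "p \<in> carrier ?F" for p c
    using that unfolding carrier_free by (auto elim: rev_finite_subset)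
  have "abelian_group ?F"
  proof (rule abelian_groupI)
    fix p assume p: "p \<in> carrier ?F"
    have "(\<lambda>w. - 1 * p w) \<in> carrier ?F" by (rule smult_closed[OF p])
    then show "\<exists>q\<in>carrier ?F. q \<oplus>\<^bsub>?F\<^esub> p = \<zero>\<^bsub>?F\<^esub>"
      by (intro bexI[of _ "\<lambda>w. - 1 * p w"]) (auto simp: add_free zero_free)
  qed (auto simp: add_free zero_free add_closed add.assoc add.commute carrier_free[of "\<lambda>w. 0"])
  moreover have "nonassoc_algebra_axioms ?F"
  proof
    fix p q assume pq: "p \<in> carrier ?F" "q \<in> carrier ?F"
    show "p \<otimes>\<^bsub>?F\<^esub> q \<in> carrier ?F"
      unfolding mult_free carrier_free mult_free_support
      using pq by (force simp: carrier_free split: magma.splits)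
  qed (auto simp: add_free smult_free mult_free smult_closed fun_eq_iff algebra_simps split: magma.splits)
  ultimately show ?thesis by (rule nonassoc_algebra.intro)
qed

lemma word_vec_closed: "word_vec w \<in> carrier (free_nonassoc_algebra V) \<longleftrightarrow> gens w \<subseteq> V"
proof -
  have "{u. (if u = w then 1 else 0) \<noteq> (0 :: 'k::field)} = {w}" by auto
  then show ?thesis by (auto simp: carrier_free word_vec_def)
qed

lemma word_vec_mult: "word_vec u \<otimes>\<^bsub>free_nonassoc_algebra V\<^esub> word_vec v = word_vec (Mul u v)"
  by (auto simp: mult_free word_vec_def fun_eq_iff split: magma.splits)

lemma carrier_free_span:
  assumes zero: "\<zero>\<^bsub>free_nonassoc_algebra V\<^esub> \<in> T"
    and add: "\<And>p q. p \<in> T \<Longrightarrow> q \<in> T \<Longrightarrow> p \<oplus>\<^bsub>free_nonassoc_algebra V\<^esub> q \<in> T"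
    and smult: "\<And>c p. p \<in> T \<Longrightarrow> c \<odot>\<^bsub>free_nonassoc_algebra V\<^esub> p \<in> T"
    and words: "\<And>w. gens w \<subseteq> V \<Longrightarrow> word_vec w \<in> T"
  shows "carrier (free_nonassoc_algebra V :: ('k::field, 'v magma \<Rightarrow> 'k) module) \<subseteq> T"
proof
  fix p assume "p \<in> carrier (free_nonassoc_algebra V :: ('k, 'v magma \<Rightarrow> 'k) module)"
  then have "finite {w. p w \<noteq> 0}" "\<forall>w\<in>{w. p w \<noteq> 0}. gens w \<subseteq> V" by (auto simp: carrier_free)
  then show "p \<in> T"
  proof (induction "{w. p w \<noteq> 0}" arbitrary: p rule: finite_induct)
    case empty
    then have "p = (\<lambda>w. 0)" by auto
    then show ?case using zero by (simp add: zero_free)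
  next
    case (insert w S)
    define p' where "p' = p(w := 0)"
    have "S = {u. p' u \<noteq> 0}" using insert(2,4) by (auto simp: p'_def)
    moreover have "gens w \<subseteq> V" using insert.prems insert(4) by blast
    ultimately have "p' \<in> T" "p w \<odot>\<^bsub>free_nonassoc_algebra V\<^esub> word_vec w \<in> T"
      using insert(3)[of p'] insert.prems by (auto simp: p'_def intro!: smult words split: if_splits)
    moreover have "p = p' \<oplus>\<^bsub>free_nonassoc_algebra V\<^esub> (p w \<odot>\<^bsub>free_nonassoc_algebra V\<^esub> word_vec w)"
      by (auto simp: p'_def add_free smult_free word_vec_def)
    ultimately show ?case using add by metis
  qed
qed

text \<open>
  Used as an induction principle: subalgebras that arise as equalizers or preimages and contain the
  generators are everything.
\<close>

lemma carrier_free_generated: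
  fixes T :: "('v magma \<Rightarrow> 'k::field) set"
  assumes T: "is_subalgebra (free_nonassoc_algebra V) T" and gen: "\<And>v. v \<in> V \<Longrightarrow> word_vec (Gen v) \<in> T"
  shows "carrier (free_nonassoc_algebra V) \<subseteq> T"
proof -
  interpret F: nonassoc_algebra "free_nonassoc_algebra V :: ('k, 'v magma \<Rightarrow> 'k) module"
    by (rule free_nonassoc_algebra_is_algebra)
  note cl = F.subalgebra_closed[OF T]
  have "gens w \<subseteq> V \<Longrightarrow> word_vec w \<in> T" for w
  proof (induction w)
    case (Mul u v)
    then show ?case using cl(4)[of "word_vec u" "word_vec v"] by (simp add: word_vec_mult)
  qed (simp add: gen)
  then show ?thesis by (intro carrier_free_span cl)
qed

primrec word_eval :: "('k, 'b) module \<Rightarrow> ('v \<Rightarrow> 'b) \<Rightarrow> 'v magma \<Rightarrow> 'b" where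
  "word_eval B b (Gen v) = b v"
| "word_eval B b (Mul u v) = word_eval B b u \<otimes>\<^bsub>B\<^esub> word_eval B b v"

definition free_eval :: "('k::field, 'b) module \<Rightarrow> ('v \<Rightarrow> 'b) \<Rightarrow> ('v magma \<Rightarrow> 'k) \<Rightarrow> 'b" where
  "free_eval B b p = finsum B (\<lambda>w. p w \<odot>\<^bsub>B\<^esub> word_eval B b w) {w. p w \<noteq> 0}"

lemma word_eval_cong: "(\<And>v. v \<in> gens w \<Longrightarrow> b v = b' v) \<Longrightarrow> word_eval B b w = word_eval B b' w"
  by (induction w) auto

context nonassoc_algebra
begin

lemma word_eval_closed: "b \<in> V \<rightarrow> carrier A \<Longrightarrow> gens w \<subseteq> V \<Longrightarrow> word_eval A b w \<in> carrier A"
  by (induction w) (auto simp: mult_closed)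

lemma free_eval_superset:
  assumes "b \<in> V \<rightarrow> carrier A" "finite S" "{w. p w \<noteq> 0} \<subseteq> S" "\<And>w. w \<in> S \<Longrightarrow> gens w \<subseteq> V"
  shows "free_eval A b p = finsum A (\<lambda>w. p w \<odot> word_eval A b w) S"
  unfolding free_eval_def
  by (rule add.finprod_mono_neutral_cong_left)
    (use assms in \<open>auto simp: smult_zero_l smult_closed word_eval_closed intro!: smult_closed word_eval_closed\<close>)

lemma free_eval_cong:
  assumes "b \<in> V \<rightarrow> carrier A" "p \<in> carrier (free_nonassoc_algebra V)" "\<And>v. v \<in> V \<Longrightarrow> b v = b' v"
  shows "free_eval A b p = free_eval A b' p"
  unfolding free_eval_def
proof (rule finsum_cong')
  fix w assume "w \<in> {w. p w \<noteq> 0}"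
  then have w: "gens w \<subseteq> V" using assms(2) by (auto simp: carrier_free)
  have "word_eval A b w = word_eval A b' w" by (rule word_eval_cong) (use w assms(3) in auto)
  then show "p w \<odot> word_eval A b w = p w \<odot> word_eval A b' w" by simp
next
  show "(\<lambda>w. p w \<odot> word_eval A b' w) \<in> {w. p w \<noteq> 0} \<rightarrow> carrier A"
  proof
    fix w assume "w \<in> {w. p w \<noteq> 0}"
    then have w: "gens w \<subseteq> V" using assms(2) by (auto simp: carrier_free)
    have "b' \<in> V \<rightarrow> carrier A" using assms(1,3) by (auto simp: Pi_iff)
    then show "p w \<odot> word_eval A b' w \<in> carrier A" using w by (intro smult_closed word_eval_closed)
  qed
qed simp

lemma free_eval_word:
  assumes "b \<in> V \<rightarrow> carrier A" "gens w \<subseteq> V" shows "free_eval A b (word_vec w) = word_eval A b w"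
proof -
  have "free_eval A b (word_vec w) = finsum A (\<lambda>u. word_vec w u \<odot> word_eval A b u) {w}"
    by (rule free_eval_superset) (use assms in \<open>auto simp: word_vec_def split: if_splits\<close>)
  then show ?thesis using word_eval_closed[OF assms] by (simp add: word_vec_def smult_one)
qed

lemma free_eval_map:
  assumes b: "b \<in> V \<rightarrow> carrier A"
  shows "alg_map (free_nonassoc_algebra V) A (free_eval A b)"
proof -
  let ?F = "free_nonassoc_algebra V :: ('k, _) module"
  interpret F: nonassoc_algebra ?F by (rule free_nonassoc_algebra_is_algebra)
  have summand: "p w \<odot> word_eval A b w \<in> carrier A" if "p \<in> carrier ?F" "p w \<noteq> 0" for p w
    using that by (intro smult_closed word_eval_closed[OF b]) (auto simp: carrier_free)
  have closed: "free_eval A b p \<in> carrier A" if "p \<in> carrier ?F" for p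
    unfolding free_eval_def using summand[OF that] by (intro finsum_closed) auto
  have add: "free_eval A b (p \<oplus>\<^bsub>?F\<^esub> q) = free_eval A b p \<oplus> free_eval A b q"
    if p: "p \<in> carrier ?F" and q: "q \<in> carrier ?F" for p q
  proof -
    define S where "S = {w. p w \<noteq> 0} \<union> {w. q w \<noteq> 0}"
    have S: "finite S" "\<And>w. w \<in> S \<Longrightarrow> gens w \<subseteq> V" using p q by (auto simp: S_def carrier_free)
    have we: "word_eval A b w \<in> carrier A" if "w \<in> S" for w using S(2)[OF that] by (rule word_eval_closed[OF b])
    have "free_eval A b (p \<oplus>\<^bsub>?F\<^esub> q) = finsum A (\<lambda>w. (p \<oplus>\<^bsub>?F\<^esub> q) w \<odot> word_eval A b w) S"
      by (rule free_eval_superset[OF b S(1) _ S(2)]) (auto simp: S_def add_free)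
    also have "\<dots> = finsum A (\<lambda>w. p w \<odot> word_eval A b w \<oplus> q w \<odot> word_eval A b w) S"
      by (rule finsum_cong') (auto simp: add_free smult_l_distr we smult_closed)
    also have "\<dots> = finsum A (\<lambda>w. p w \<odot> word_eval A b w) S \<oplus> finsum A (\<lambda>w. q w \<odot> word_eval A b w) S"
      by (rule finsum_addf) (auto simp: we smult_closed)
    also have "\<dots> = free_eval A b p \<oplus> free_eval A b q"
    proof -
      have "free_eval A b p = finsum A (\<lambda>w. p w \<odot> word_eval A b w) S"
        "free_eval A b q = finsum A (\<lambda>w. q w \<odot> word_eval A b w) S"
        by (rule free_eval_superset[OF b S(1) _ S(2)]; auto simp: S_def)+
      then show ?thesis by simp
    qed
    finally show ?thesis .
  qed
  have smult: "free_eval A b (c \<odot>\<^bsub>?F\<^esub> p) = c \<odot> free_eval A b p" if p: "p \<in> carrier ?F" for c p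
  proof -
    define S where "S = {w. p w \<noteq> 0}"
    have S: "finite S" "\<And>w. w \<in> S \<Longrightarrow> gens w \<subseteq> V" using p by (auto simp: S_def carrier_free)
    have we: "word_eval A b w \<in> carrier A" if "w \<in> S" for w using S(2)[OF that] by (rule word_eval_closed[OF b])
    have "free_eval A b (c \<odot>\<^bsub>?F\<^esub> p) = finsum A (\<lambda>w. (c \<odot>\<^bsub>?F\<^esub> p) w \<odot> word_eval A b w) S"
      by (rule free_eval_superset[OF b S(1) _ S(2)]) (auto simp: S_def smult_free)
    also have "\<dots> = finsum A (\<lambda>w. c \<odot> (p w \<odot> word_eval A b w)) S"
      by (rule finsum_cong') (auto simp: smult_free smult_smult we smult_closed)
    also have "\<dots> = c \<odot> finsum A (\<lambda>w. p w \<odot> word_eval A b w) S"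
      using S(1) we
    proof (induction S rule: finite_induct)
      case (insert w S)
      then have "(\<lambda>w. p w \<odot> word_eval A b w) \<in> S \<rightarrow> carrier A" by (auto intro!: smult_closed)
      then show ?case using insert by (simp add: smult_r_distr smult_closed finsum_closed)
    qed (simp add: smult_zero_r)
    also have "\<dots> = c \<odot> free_eval A b p" by (simp add: free_eval_def S_def)
    finally show ?thesis .
  qed
  have zero: "free_eval A b \<zero>\<^bsub>?F\<^esub> = \<zero>" by (simp add: free_eval_def zero_free)
  have mult_word: "free_eval A b (word_vec u \<otimes>\<^bsub>?F\<^esub> q) = word_eval A b u \<otimes> free_eval A b q"
    if u: "gens u \<subseteq> V" and q: "q \<in> carrier ?F" for u q
  proof -
    have uF: "word_vec u \<in> carrier ?F" using u by (simp add: word_vec_closed)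
    have uA: "word_eval A b u \<in> carrier A" by (rule word_eval_closed[OF b u])
    have "carrier ?F \<subseteq> {q \<in> carrier ?F. free_eval A b (word_vec u \<otimes>\<^bsub>?F\<^esub> q) = word_eval A b u \<otimes> free_eval A b q}"
    proof (rule carrier_free_span)
      fix w assume w: "gens w \<subseteq> V"
      then show "word_vec w \<in> {q \<in> carrier ?F. free_eval A b (word_vec u \<otimes>\<^bsub>?F\<^esub> q) = word_eval A b u \<otimes> free_eval A b q}"
        using u by (simp add: word_vec_closed word_vec_mult free_eval_word[OF b])
    qed (use uF uA in \<open>auto simp: F.mult_zero_r zero mult_zero_r F.mult_r_distr add mult_r_distr closed F.mult_closed
          F.smult_closed F.mult_smult_r smult mult_smult_r\<close>)
    then show ?thesis using q by blast
  qed
  have mult: "free_eval A b (p \<otimes>\<^bsub>?F\<^esub> q) = free_eval A b p \<otimes> free_eval A b q"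
    if p: "p \<in> carrier ?F" and q: "q \<in> carrier ?F" for p q
  proof -
    have "carrier ?F \<subseteq> {p \<in> carrier ?F. free_eval A b (p \<otimes>\<^bsub>?F\<^esub> q) = free_eval A b p \<otimes> free_eval A b q}"
    proof (rule carrier_free_span)
      fix w assume w: "gens w \<subseteq> V"
      then show "word_vec w \<in> {p \<in> carrier ?F. free_eval A b (p \<otimes>\<^bsub>?F\<^esub> q) = free_eval A b p \<otimes> free_eval A b q}"
        using mult_word[OF w q] by (simp add: word_vec_closed free_eval_word[OF b])
    qed (use q in \<open>auto simp: F.mult_zero_l zero mult_zero_l F.mult_l_distr add mult_l_distr closed F.mult_closed
          F.smult_closed F.mult_smult_l smult mult_smult_l\<close>)
    then show ?thesis using p by blast
  qed
  show ?thesis using closed add mult smult by (auto simp: alg_map_def)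
qed

end

lemma novikov_ideal_is_ideal: "is_algebra_ideal (free_nonassoc_algebra V) (novikov_ideal V)"
proof -
  interpret F: nonassoc_algebra "free_nonassoc_algebra V :: ('b, 'a magma \<Rightarrow> 'b) module"
    by (rule free_nonassoc_algebra_is_algebra)
  show ?thesis unfolding novikov_ideal_def
    by (rule F.generated_ideal_is_ideal) (auto simp: novikov_defects_def F.mult_closed)
qed

lemma free_novikov_is_novikov: "novikov_algebra (free_novikov V :: ('k::field, ('v magma \<Rightarrow> 'k) set) module)"
proof -
  let ?F = "free_nonassoc_algebra V :: ('k, 'v magma \<Rightarrow> 'k) module" and ?I = "novikov_ideal V :: ('v magma \<Rightarrow> 'k) set"
  interpret F: nonassoc_algebra ?F by (rule free_nonassoc_algebra_is_algebra)
  let ?N = "quotient_algebra ?F ?I"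
  interpret N: nonassoc_algebra ?N by (rule F.quotient_is_algebra[OF novikov_ideal_is_ideal])
  interpret p: algebra_map ?F ?N "\<lambda>x. ?I +>\<^bsub>?F\<^esub> x"
    by (rule algebra_mapI[OF F.nonassoc_algebra_axioms N.nonassoc_algebra_axioms F.quotient_proj_map[OF novikov_ideal_is_ideal]])
  have sub: "novikov_defects ?F \<subseteq> ?I" unfolding novikov_ideal_def by (rule generated_ideal_superset)
  have zero: "?I +>\<^bsub>?F\<^esub> d = \<zero>\<^bsub>?N\<^esub>" if "d \<in> novikov_defects ?F" for d
  proof -
    have "d \<in> ?I" using that sub by blast
    moreover from this have "d \<in> carrier ?F" using F.algebra_ideal_closed(1)[OF novikov_ideal_is_ideal] by blast
    ultimately show ?thesis by (simp add: F.quotient_proj_eq_zero_iff[OF novikov_ideal_is_ideal])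
  qed
  show ?thesis
    unfolding free_novikov_def novikov_algebra_def novikov_algebra_axioms_def F.quotient_proj_surj[OF novikov_ideal_is_ideal]
  proof (intro conjI allI impI N.nonassoc_algebra_axioms; elim imageE; hypsubst)
    fix x y z assume xyz: "x \<in> carrier ?F" "y \<in> carrier ?F" "z \<in> carrier ?F"
    have "((x \<otimes>\<^bsub>?F\<^esub> y) \<otimes>\<^bsub>?F\<^esub> z \<ominus>\<^bsub>?F\<^esub> x \<otimes>\<^bsub>?F\<^esub> (y \<otimes>\<^bsub>?F\<^esub> z)) \<ominus>\<^bsub>?F\<^esub> ((x \<otimes>\<^bsub>?F\<^esub> z) \<otimes>\<^bsub>?F\<^esub> y \<ominus>\<^bsub>?F\<^esub> x \<otimes>\<^bsub>?F\<^esub> (z \<otimes>\<^bsub>?F\<^esub> y)) \<in> novikov_defects ?F"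
      using xyz unfolding novikov_defects_def by blast
    from zero[OF this] show "((?I +>\<^bsub>?F\<^esub> x) \<otimes>\<^bsub>?N\<^esub> (?I +>\<^bsub>?F\<^esub> y)) \<otimes>\<^bsub>?N\<^esub> (?I +>\<^bsub>?F\<^esub> z) \<ominus>\<^bsub>?N\<^esub> (?I +>\<^bsub>?F\<^esub> x) \<otimes>\<^bsub>?N\<^esub> ((?I +>\<^bsub>?F\<^esub> y) \<otimes>\<^bsub>?N\<^esub> (?I +>\<^bsub>?F\<^esub> z))
      = ((?I +>\<^bsub>?F\<^esub> x) \<otimes>\<^bsub>?N\<^esub> (?I +>\<^bsub>?F\<^esub> z)) \<otimes>\<^bsub>?N\<^esub> (?I +>\<^bsub>?F\<^esub> y) \<ominus>\<^bsub>?N\<^esub> (?I +>\<^bsub>?F\<^esub> x) \<otimes>\<^bsub>?N\<^esub> ((?I +>\<^bsub>?F\<^esub> z) \<otimes>\<^bsub>?N\<^esub> (?I +>\<^bsub>?F\<^esub> y))"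
      using xyz by (simp add: p.minus p.mult p.closed F.mult_closed N.mult_closed N.diff_eq_zero_iff)
  next
    fix x y z assume xyz: "x \<in> carrier ?F" "y \<in> carrier ?F" "z \<in> carrier ?F"
    have "x \<otimes>\<^bsub>?F\<^esub> (y \<otimes>\<^bsub>?F\<^esub> z) \<ominus>\<^bsub>?F\<^esub> y \<otimes>\<^bsub>?F\<^esub> (x \<otimes>\<^bsub>?F\<^esub> z) \<in> novikov_defects ?F"
      using xyz unfolding novikov_defects_def by blast
    from zero[OF this] show "(?I +>\<^bsub>?F\<^esub> x) \<otimes>\<^bsub>?N\<^esub> ((?I +>\<^bsub>?F\<^esub> y) \<otimes>\<^bsub>?N\<^esub> (?I +>\<^bsub>?F\<^esub> z)) = (?I +>\<^bsub>?F\<^esub> y) \<otimes>\<^bsub>?N\<^esub> ((?I +>\<^bsub>?F\<^esub> x) \<otimes>\<^bsub>?N\<^esub> (?I +>\<^bsub>?F\<^esub> z))"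
      using xyz by (simp add: p.minus p.mult p.closed F.mult_closed N.mult_closed N.diff_eq_zero_iff)
  qed
qed

definition free_class :: "'v set \<Rightarrow> ('v magma \<Rightarrow> 'k::field) \<Rightarrow> ('v magma \<Rightarrow> 'k) set" where
  "free_class V p = novikov_ideal V +>\<^bsub>free_nonassoc_algebra V :: ('k, _) module\<^esub> p"

lemma novikov_gen_eq: "novikov_gen V v = free_class V (word_vec (Gen v))"
  by (simp add: novikov_gen_def free_class_def word_vec_def)

lemma free_class_map: "algebra_map (free_nonassoc_algebra V) (free_novikov V :: ('k::field, ('v magma \<Rightarrow> 'k) set) module) (free_class V)"
  and free_class_surj: "carrier (free_novikov V :: ('k, ('v magma \<Rightarrow> 'k) set) module) = free_class V ` carrier (free_nonassoc_algebra V)"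
  and free_class_eq_zero_iff: "p \<in> carrier (free_nonassoc_algebra V) \<Longrightarrow> free_class V p = \<zero>\<^bsub>free_novikov V :: ('k, ('v magma \<Rightarrow> 'k) set) module\<^esub> \<longleftrightarrow> p \<in> novikov_ideal V"
proof -
  let ?F = "free_nonassoc_algebra V :: ('k, 'v magma \<Rightarrow> 'k) module"
  interpret F: nonassoc_algebra ?F by (rule free_nonassoc_algebra_is_algebra)
  note I = novikov_ideal_is_ideal[of V, where 'b = 'k]
  have cls: "free_class V = (\<lambda>p. novikov_ideal V +>\<^bsub>?F\<^esub> p)" by (rule ext) (simp add: free_class_def)
  show "algebra_map ?F (free_novikov V) (free_class V)"
    unfolding free_novikov_def cls
    by (rule algebra_mapI[OF F.nonassoc_algebra_axioms F.quotient_is_algebra[OF I] F.quotient_proj_map[OF I]])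
  show "carrier (free_novikov V :: ('k, ('v magma \<Rightarrow> 'k) set) module) = free_class V ` carrier ?F"
    unfolding free_novikov_def cls by (rule F.quotient_proj_surj[OF I])
  show "free_class V p = \<zero>\<^bsub>free_novikov V :: ('k, ('v magma \<Rightarrow> 'k) set) module\<^esub> \<longleftrightarrow> p \<in> novikov_ideal V" if "p \<in> carrier ?F"
    unfolding free_novikov_def cls by (rule F.quotient_proj_eq_zero_iff[OF I that])
qed

text \<open>
  The kernel of evaluation is an ideal containing the defects, because evaluation maps defects to
  defects and these vanish in \<open>B\<close>.
\<close>

lemma novikov_ideal_vanishes:
  fixes B :: "('k::field, 'b) module"
  assumes "novikov_algebra B" "b \<in> V \<rightarrow> carrier B" "p \<in> novikov_ideal V"
  shows "free_eval B b p = \<zero>\<^bsub>B\<^esub>"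
proof -
  interpret B: novikov_algebra B by fact
  let ?F = "free_nonassoc_algebra V :: ('k, _) module"
  interpret e: algebra_map ?F B "free_eval B b"
    by (rule algebra_mapI[OF free_nonassoc_algebra_is_algebra B.nonassoc_algebra_axioms B.free_eval_map[OF assms(2)]])
  have "novikov_defects ?F \<subseteq> {x \<in> carrier ?F. free_eval B b x = \<zero>\<^bsub>B\<^esub>}"
  proof
    fix d assume d: "d \<in> novikov_defects ?F"
    then have "d \<in> carrier ?F" by (auto simp: novikov_defects_def e.A.mult_closed)
    moreover have "free_eval B b d \<in> novikov_defects B"
      using d unfolding novikov_defects_def[of ?F]
    proof (elim UnE CollectE exE conjE)
      fix x y z assume "x \<in> carrier ?F" "y \<in> carrier ?F" "z \<in> carrier ?F"
        "d = ((x \<otimes>\<^bsub>?F\<^esub> y) \<otimes>\<^bsub>?F\<^esub> z \<ominus>\<^bsub>?F\<^esub> x \<otimes>\<^bsub>?F\<^esub> (y \<otimes>\<^bsub>?F\<^esub> z)) \<ominus>\<^bsub>?F\<^esub> ((x \<otimes>\<^bsub>?F\<^esub> z) \<otimes>\<^bsub>?F\<^esub> y \<ominus>\<^bsub>?F\<^esub> x \<otimes>\<^bsub>?F\<^esub> (z \<otimes>\<^bsub>?F\<^esub> y))"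
      then show "free_eval B b d \<in> novikov_defects B" unfolding novikov_defects_def
        by (intro UnI1 CollectI exI[of _ "free_eval B b x"] exI[of _ "free_eval B b y"] exI[of _ "free_eval B b z"])
          (simp add: e.minus e.mult e.closed e.A.mult_closed)
    next
      fix x y z assume "x \<in> carrier ?F" "y \<in> carrier ?F" "z \<in> carrier ?F"
        "d = x \<otimes>\<^bsub>?F\<^esub> (y \<otimes>\<^bsub>?F\<^esub> z) \<ominus>\<^bsub>?F\<^esub> y \<otimes>\<^bsub>?F\<^esub> (x \<otimes>\<^bsub>?F\<^esub> z)"
      then show "free_eval B b d \<in> novikov_defects B" unfolding novikov_defects_def
        by (intro UnI2 CollectI exI[of _ "free_eval B b x"] exI[of _ "free_eval B b y"] exI[of _ "free_eval B b z"])
          (simp add: e.minus e.mult e.closed e.A.mult_closed)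
    qed
    ultimately show "d \<in> {x \<in> carrier ?F. free_eval B b x = \<zero>\<^bsub>B\<^esub>}" using B.novikov_defects_zero by auto
  qed
  from generated_ideal_least[OF e.kernel_ideal this] show ?thesis
    using assms(3) by (auto simp: novikov_ideal_def)
qed
lemma free_eval_generator_class:
  fixes V :: "'v set"
  assumes "p \<in> carrier (free_nonassoc_algebra V :: ('k::field, 'v magma \<Rightarrow> 'k) module)"
  shows "free_eval (free_novikov V :: ('k, ('v magma \<Rightarrow> 'k) set) module) (novikov_gen V) p = free_class V p"
proof -
  let ?F = "free_nonassoc_algebra V :: ('k, 'v magma \<Rightarrow> 'k) module" and ?N = "free_novikov V :: ('k, ('v magma \<Rightarrow> 'k) set) module"
  interpret c: algebra_map ?F ?N "free_class V" by (rule free_class_map)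
  have gen: "novikov_gen V \<in> V \<rightarrow> carrier ?N"
    by (auto simp: novikov_gen_eq word_vec_closed intro!: c.closed)
  interpret e: algebra_map ?F ?N "free_eval ?N (novikov_gen V)"
    by (rule algebra_mapI[OF c.A.nonassoc_algebra_axioms c.B.nonassoc_algebra_axioms c.B.free_eval_map[OF gen]])
  have "carrier ?F \<subseteq> {p \<in> carrier ?F. free_eval ?N (novikov_gen V) p = free_class V p}"
    by (rule carrier_free_generated[OF e.equalizer_subalgebra[OF c.algebra_map_axioms]])
      (simp add: word_vec_closed c.B.free_eval_word[OF gen] novikov_gen_eq)
  then show ?thesis using assms by blast
qed

lemma free_novikov_extension:
  fixes B :: "('k::field, 'b) module" and V :: "'v set"
  assumes "novikov_algebra B" "b \<in> V \<rightarrow> carrier B"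
  shows "\<exists>g. alg_map (free_novikov V) B g \<and> (\<forall>p\<in>carrier (free_nonassoc_algebra V). g (free_class V p) = free_eval B b p)"
proof -
  interpret B: novikov_algebra B by fact
  interpret c: algebra_map "free_nonassoc_algebra V :: ('k, 'v magma \<Rightarrow> 'k) module" "free_novikov V" "free_class V" by (rule free_class_map)
  show ?thesis
    by (rule c.factor_through[OF B.nonassoc_algebra_axioms B.free_eval_map[OF assms(2)] free_class_surj])
      (simp add: free_class_eq_zero_iff novikov_ideal_vanishes[OF assms])
qed

lemma free_nonassoc_ops:
  "monoid.mult (free_nonassoc_algebra V) = monoid.mult (free_nonassoc_algebra Y)"
  "ring.add (free_nonassoc_algebra V) = ring.add (free_nonassoc_algebra Y)"
  "module.smult (free_nonassoc_algebra V) = module.smult (free_nonassoc_algebra Y)"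
  by (simp_all add: free_nonassoc_algebra_def)

lemma carrier_free_mono: "I \<subseteq> V \<Longrightarrow> carrier (free_nonassoc_algebra I) \<subseteq> carrier (free_nonassoc_algebra V)"
  unfolding carrier_free subset_iff by blast

lemma alg_map_restrict_free:
  assumes "alg_map (free_nonassoc_algebra V) B h" "I \<subseteq> V"
  shows "alg_map (free_nonassoc_algebra I) B h"
  using assms(1) carrier_free_mono[OF assms(2)] unfolding alg_map_def free_nonassoc_ops[of I V]
  by (auto simp: subset_iff Pi_iff)

text \<open>
  The free Novikov algebra on all natural numbers as a type, to which the theory of realized
  monomials applies.
\<close>

section \<open>Embedding the free Novikov algebra into power series\<close>

typedef (overloaded) 'k nov = "carrier (free_novikov UNIV :: ('k::field, (nat magma \<Rightarrow> 'k) set) module)"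
proof -
  interpret novikov_algebra "free_novikov UNIV :: ('k::field, (nat magma \<Rightarrow> 'k) set) module" by (rule free_novikov_is_novikov)
  show ?thesis using zero_closed by blast
qed

interpretation FN: novikov_algebra "free_novikov UNIV :: ('k::field, (nat magma \<Rightarrow> 'k) set) module"
  by (rule free_novikov_is_novikov)

interpretation FC: algebra_map "free_nonassoc_algebra UNIV :: ('k::field, nat magma \<Rightarrow> 'k) module" "free_novikov UNIV" "free_class UNIV"
  by (rule free_class_map)

instantiation nov :: (field) ab_group_add
begin

definition "x + y = Abs_nov (Rep_nov x \<oplus>\<^bsub>free_novikov UNIV\<^esub> Rep_nov y)"
definition "x - y = Abs_nov (Rep_nov x \<ominus>\<^bsub>free_novikov UNIV\<^esub> Rep_nov y)"
definition "- x = Abs_nov (\<ominus>\<^bsub>free_novikov UNIV\<^esub> Rep_nov x)"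
definition "0 = Abs_nov \<zero>\<^bsub>free_novikov UNIV\<^esub>"

lemma Rep_nov_ops:
  "Rep_nov (x + y) = Rep_nov x \<oplus>\<^bsub>free_novikov UNIV\<^esub> Rep_nov y"
  "Rep_nov (x - y) = Rep_nov x \<ominus>\<^bsub>free_novikov UNIV\<^esub> Rep_nov y"
  "Rep_nov (- x) = \<ominus>\<^bsub>free_novikov UNIV\<^esub> Rep_nov x"
  "Rep_nov (0 :: 'a nov) = \<zero>\<^bsub>free_novikov UNIV\<^esub>"
  using Rep_nov[of x] Rep_nov[of y]
  by (simp_all add: plus_nov_def minus_nov_def uminus_nov_def zero_nov_def Abs_nov_inverse)

instance
proof
  fix x y z :: "'a nov"
  note R = Rep_nov[of x] Rep_nov[of y] Rep_nov[of z]
  show "x + y + z = x + (y + z)" "x + y = y + x" "0 + x = x" "- x + x = 0" "x - y = x + - y"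
    using R by (simp_all add: Rep_nov_inject[symmetric] Rep_nov_ops FN.a_ac FN.l_neg FN.r_neg FN.minus_eq)
qed

end

definition nov_mul :: "'k::field nov \<Rightarrow> 'k nov \<Rightarrow> 'k nov" where
  "nov_mul x y = Abs_nov (Rep_nov x \<otimes>\<^bsub>free_novikov UNIV\<^esub> Rep_nov y)"

definition nov_scale :: "'k::field \<Rightarrow> 'k nov \<Rightarrow> 'k nov" where
  "nov_scale c x = Abs_nov (c \<odot>\<^bsub>free_novikov UNIV\<^esub> Rep_nov x)"

lemma Rep_nov_mul: "Rep_nov (nov_mul x y) = Rep_nov x \<otimes>\<^bsub>free_novikov UNIV\<^esub> Rep_nov y"
  and Rep_nov_scale: "Rep_nov (nov_scale c x) = c \<odot>\<^bsub>free_novikov UNIV\<^esub> Rep_nov x"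
  using Rep_nov[of x] Rep_nov[of y]
  by (simp_all add: nov_mul_def nov_scale_def Abs_nov_inverse FN.mult_closed FN.smult_closed)

interpretation nov: novikov_space nov_scale nov_mul
proof
  fix x y z :: "'k::field nov" and a b :: 'k
  note R = Rep_nov[of x] Rep_nov[of y] Rep_nov[of z]
  note ops = Rep_nov_inject[symmetric] Rep_nov_ops Rep_nov_mul Rep_nov_scale
  show "nov_scale a (x + y) = nov_scale a x + nov_scale a y"
    using R by (simp add: ops FN.smult_r_distr)
  show "nov_scale (a + b) x = nov_scale a x + nov_scale b x"
    using R by (simp add: ops FN.smult_l_distr)
  show "nov_scale a (nov_scale b x) = nov_scale (a * b) x"
    using R by (simp add: ops FN.smult_smult)
  show "nov_scale 1 x = x"
    using R by (simp add: ops FN.smult_one)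
  show "nov_mul (x + y) z = nov_mul x z + nov_mul y z"
    using R by (simp add: ops FN.mult_l_distr)
  show "nov_mul x (y + z) = nov_mul x y + nov_mul x z"
    using R by (simp add: ops FN.mult_r_distr)
  show "nov_mul (nov_scale a x) y = nov_scale a (nov_mul x y)"
    using R by (simp add: ops FN.mult_smult_l)
  show "nov_mul x (nov_scale a y) = nov_scale a (nov_mul x y)"
    using R by (simp add: ops FN.mult_smult_r)
  show "nov_mul (nov_mul x y) z - nov_mul x (nov_mul y z) = nov_mul (nov_mul x z) y - nov_mul x (nov_mul z y)"
    using R by (simp add: ops FN.right_symmetric)
  show "nov_mul x (nov_mul y z) = nov_mul y (nov_mul x z)"
    using FN.left_commutative[OF R] by (simp add: ops)
qed

definition nov_class :: "(nat magma \<Rightarrow> 'k::field) \<Rightarrow> 'k nov" where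
  "nov_class p = Abs_nov (free_class UNIV p)"

abbreviation nov_gen :: "nat \<Rightarrow> 'k::field nov" where
  "nov_gen i \<equiv> nov_class (word_vec (Gen i))"

lemma Rep_nov_class: "p \<in> carrier (free_nonassoc_algebra UNIV) \<Longrightarrow> Rep_nov (nov_class p) = free_class UNIV p"
  by (simp add: nov_class_def Abs_nov_inverse FC.closed)

lemma nov_class_in_span:
  fixes p :: "nat magma \<Rightarrow> 'k::field"
  assumes "p \<in> carrier (free_nonassoc_algebra UNIV)"
  shows "nov_class p \<in> nov.span (nov.reps nov_gen)"
proof -
  let ?F = "free_nonassoc_algebra UNIV :: ('k, nat magma \<Rightarrow> 'k) module"
  let ?T = "{p \<in> carrier ?F. nov_class p \<in> nov.span (nov.reps nov_gen)}"
  note ops = Rep_nov_inject[symmetric] Rep_nov_ops Rep_nov_mul Rep_nov_scale Rep_nov_class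
  have "carrier ?F \<subseteq> ?T"
  proof (rule carrier_free_generated[OF FC.A.subalgebraI])
    show "\<zero>\<^bsub>?F\<^esub> \<in> ?T"
    proof -
      have "nov_class \<zero>\<^bsub>?F\<^esub> = 0" by (simp add: ops FC.zero)
      then show ?thesis by (simp add: nov.span_zero)
    qed
    show "p \<oplus>\<^bsub>?F\<^esub> q \<in> ?T" if "p \<in> ?T" "q \<in> ?T" for p q
    proof -
      have "nov_class (p \<oplus>\<^bsub>?F\<^esub> q) = nov_class p + nov_class q" using that by (simp add: ops FC.add)
      then show ?thesis using that by (simp add: nov.span_add)
    qed
    show "c \<odot>\<^bsub>?F\<^esub> p \<in> ?T" if "p \<in> ?T" for c p
    proof -
      have "nov_class (c \<odot>\<^bsub>?F\<^esub> p) = nov_scale c (nov_class p)" using that by (simp add: ops FC.smult FC.A.smult_closed)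
      then show ?thesis using that by (simp add: nov.span_scale FC.A.smult_closed)
    qed
    show "p \<otimes>\<^bsub>?F\<^esub> q \<in> ?T" if "p \<in> ?T" "q \<in> ?T" for p q
    proof -
      have "nov_class (p \<otimes>\<^bsub>?F\<^esub> q) = nov_mul (nov_class p) (nov_class q)" using that by (simp add: ops FC.mult FC.A.mult_closed)
      then show ?thesis using that by (simp add: nov.span_reps_mul FC.A.mult_closed)
    qed
    show "word_vec (Gen i) \<in> ?T" for i
      using nov.span_base[OF nov.reps_gen, of nov_gen i] by (simp add: word_vec_closed)
  qed auto
  then show ?thesis using assms by blast
qed

text \<open>
  The scalars are those of the free Novikov algebra, not the larger coefficient field of the series,
  so this is a Novikov algebra to which free Novikov algebras over \<open>'k\<close> can be mapped.
\<close>

definition series_novikov :: "('k::field_char_0, 'k dfield fps) module" where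
  "series_novikov = \<lparr>carrier = UNIV, monoid.mult = (\<lambda>a b. fps_deriv a * b), one = 0, zero = 0, add = (+),
     module.smult = (\<lambda>c a. fps_const (scal c) * a)\<rparr>"

lemma series_novikov_simps:
  "carrier (series_novikov :: ('k::field_char_0, 'k dfield fps) module) = UNIV"
  "a \<otimes>\<^bsub>series_novikov\<^esub> b = fps_deriv a * b"
  "a \<oplus>\<^bsub>series_novikov\<^esub> b = a + b"
  "\<zero>\<^bsub>series_novikov\<^esub> = 0"
  "c \<odot>\<^bsub>series_novikov\<^esub> a = fps_const (scal c) * a"
  by (simp_all add: series_novikov_def)

lemma series_novikov_is_novikov: "novikov_algebra (series_novikov :: ('k::field_char_0, 'k dfield fps) module)"
proof -
  interpret s: ring_homomorphism "\<lambda>c :: 'k. fps_const (scal c)" by (rule const_scal_hom)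
  have "abelian_group (series_novikov :: ('k, 'k dfield fps) module)"
  proof (rule abelian_groupI)
    fix x :: "'k dfield fps"
    show "\<exists>y\<in>carrier series_novikov. y \<oplus>\<^bsub>series_novikov :: ('k, _) module\<^esub> x = \<zero>\<^bsub>series_novikov :: ('k, _) module\<^esub>"
      by (intro bexI[of _ "- x"]) (simp_all add: series_novikov_simps)
  qed (simp_all add: series_novikov_simps ac_simps)
  moreover have "nonassoc_algebra_axioms (series_novikov :: ('k, 'k dfield fps) module)"
    by unfold_locales (simp_all add: series_novikov_simps s.hom_add s.hom_mult s.hom_one algebra_simps
        del: fps_const_add fps_const_mult)
  ultimately interpret nonassoc_algebra "series_novikov :: ('k, 'k dfield fps) module" by (rule nonassoc_algebra.intro)
  show ?thesis unfolding novikov_algebra_iff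
    by (simp add: series_novikov_simps algebra_simps)
qed

interpretation SN: novikov_algebra "series_novikov :: ('k::field_char_0, 'k dfield fps) module"
  by (rule series_novikov_is_novikov)

text \<open>
  The differential polynomial \<open>d\<close> of a Novikov polynomial \<open>p\<close> collects the coefficients of \<open>p\<close> in terms of
  realized monomials. If they all vanish, then so does \<open>p\<close> in the free Novikov algebra.
\<close>

lemma free_eval_normal_form:
  fixes p :: "nat magma \<Rightarrow> 'k::field_char_0"
  assumes p: "p \<in> carrier (free_nonassoc_algebra UNIV)"
  obtains d :: "'k dpoly" where "\<And>v. free_eval series_novikov v p = eval_at v d" "d = 0 \<Longrightarrow> p \<in> novikov_ideal UNIV"
proof -
  obtain d :: "'k dpoly" where d: "nov_class p = (\<Sum>M\<in>Poly_Mapping.keys d. nov_scale (Poly_Mapping.lookup d M) (nov.val nov_gen M))"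
    "\<forall>M\<in>Poly_Mapping.keys d. nov.realizes nov_gen M (nov.val nov_gen M :: 'k nov)"
    using nov.span_reps_normal_form[OF nov_class_in_span[OF p]] by blast
  show thesis
  proof
    fix v :: "nat \<Rightarrow> 'k dfield fps"
    obtain g where g: "alg_map (free_novikov UNIV) (series_novikov :: ('k, _) module) g"
      "\<And>q. q \<in> carrier (free_nonassoc_algebra UNIV) \<Longrightarrow> g (free_class UNIV q) = free_eval series_novikov v q"
      using free_novikov_extension[OF series_novikov_is_novikov, of v UNIV] by (auto simp: series_novikov_simps)
    interpret g: algebra_map "free_novikov UNIV" "series_novikov :: ('k, _) module" g
      by (rule algebra_mapI[OF FN.nonassoc_algebra_axioms SN.nonassoc_algebra_axioms g(1)])
    define h where "h x = g (Rep_nov x)" for x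
    interpret h: novikov_representation nov_scale nov_mul fps_deriv "\<lambda>c :: 'k. fps_const (scal c)" h
      by unfold_locales
        (simp_all add: h_def Rep_nov_ops Rep_nov_mul Rep_nov_scale g.add[OF Rep_nov Rep_nov] g.mult[OF Rep_nov Rep_nov] g.smult[OF Rep_nov]
          series_novikov_simps)
    have "h (nov_gen i) = v i" for i
      by (simp add: h_def Rep_nov_class word_vec_closed g(2) SN.free_eval_word[of v UNIV] series_novikov_simps)
    moreover have "h (nov_class p) = free_eval series_novikov v p"
      by (simp add: h_def Rep_nov_class p g(2))
    ultimately show "free_eval series_novikov v p = eval_at v d"
      using h.h_normal_form[OF d] by (simp add: eval_at_def eval_dpoly_def jet_def)
  next
    assume "d = 0"
    then have "nov_class p = 0" using d(1) by simp
    then have "free_class UNIV p = \<zero>\<^bsub>free_novikov UNIV\<^esub>"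
      using Rep_nov_class[OF p] by (simp add: Rep_nov_ops)
    then show "p \<in> novikov_ideal UNIV" using free_class_eq_zero_iff[OF p] by simp
  qed
qed

text \<open>
  The free Novikov algebra embeds into power series: at generic series even the constant term of
  the value determines the differential polynomial.
\<close>

lemma generic_series_free:
  fixes p :: "nat magma \<Rightarrow> 'k::field_char_0"
  assumes "p \<in> carrier (free_nonassoc_algebra UNIV)" "free_eval series_novikov generic_series p = 0"
  shows "p \<in> novikov_ideal UNIV"
  using free_eval_normal_form[OF assms(1)] assms(2) eval_at_generic_inj by metis

section \<open>The Freiheitssatz\<close>

lemma (in nonassoc_algebra) word_eval_zero:
  assumes "b \<in> UNIV \<rightarrow> carrier A" "v \<in> gens w" "b v = \<zero>"
  shows "word_eval A b w = \<zero>"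
  using assms(2)
proof (induction w)
  case (Mul u w)
  then show ?case using word_eval_closed[OF assms(1)] by (auto simp: mult_zero_l mult_zero_r)
qed (use assms in auto)

text \<open>
  If the differential polynomial of \<open>p\<close> does not involve the variable \<open>n\<close>, then neither do its values depend on
  the series substituted for it. Substituting \<open>0\<close> kills the words containing \<open>n\<close>, so dropping these words from
  \<open>p\<close> does not change the value at generic series, nor therefore the class of \<open>p\<close>.
\<close>

lemma eliminate_generator:
  fixes p :: "nat magma \<Rightarrow> 'k::field_char_0"
  assumes p: "p \<in> carrier (free_nonassoc_algebra V)"
    and d: "\<And>v. free_eval series_novikov v p = eval_at v d"
    and no_n: "d \<in> dpolys_over {x. fst x \<noteq> n}"
  shows "\<exists>p'\<in>carrier (free_nonassoc_algebra (V - {n})). p \<ominus>\<^bsub>free_nonassoc_algebra UNIV\<^esub> p' \<in> novikov_ideal UNIV"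
proof -
  define p' where "p' w = (if n \<in> gens w then 0 else p w)" for w
  have p': "p' \<in> carrier (free_nonassoc_algebra (V - {n}))"
    using p by (auto simp: carrier_free p'_def elim: rev_finite_subset split: if_splits)
  have pU: "p \<in> carrier (free_nonassoc_algebra UNIV)" and p'U: "p' \<in> carrier (free_nonassoc_algebra UNIV)"
    using p p' carrier_free_mono[of _ UNIV] by blast+
  let ?g = "generic_series :: nat \<Rightarrow> 'k dfield fps"
  let ?gn = "?g(n := 0)"
  interpret e: algebra_map "free_nonassoc_algebra UNIV" "series_novikov :: ('k, _) module" "free_eval series_novikov ?g"
    by (rule algebra_mapI[OF FC.A.nonassoc_algebra_axioms SN.nonassoc_algebra_axioms SN.free_eval_map]) (simp add: series_novikov_simps)
  have z: "free_eval series_novikov ?g p = free_eval series_novikov ?gn p"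
    unfolding d eval_at_def by (rule eval_dpoly_cong[OF no_n]) (auto simp: jet_def)
  have "free_eval series_novikov ?gn p = finsum series_novikov (\<lambda>w. p w \<odot>\<^bsub>series_novikov\<^esub> word_eval series_novikov ?gn w) {w. p w \<noteq> 0}"
    by (simp add: free_eval_def)
  also have "\<dots> = finsum series_novikov (\<lambda>w. p' w \<odot>\<^bsub>series_novikov\<^esub> word_eval series_novikov ?gn w) {w. p w \<noteq> 0}"
  proof (rule SN.finsum_cong')
    fix w
    have "word_eval series_novikov ?gn w = \<zero>\<^bsub>series_novikov :: ('k, _) module\<^esub>" if "n \<in> gens w"
      by (rule SN.word_eval_zero[OF _ that]) (simp_all add: series_novikov_simps)
    then show "p w \<odot>\<^bsub>series_novikov\<^esub> word_eval series_novikov ?gn w = p' w \<odot>\<^bsub>series_novikov\<^esub> word_eval series_novikov ?gn w"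
      by (auto simp: p'_def series_novikov_simps)
  qed (simp_all add: series_novikov_simps)
  also have "\<dots> = free_eval series_novikov ?gn p'"
    by (rule SN.free_eval_superset[of _ UNIV, symmetric])
      (use pU in \<open>auto simp: series_novikov_simps p'_def carrier_free split: if_splits\<close>)
  also have "\<dots> = free_eval series_novikov ?g p'"
    by (rule SN.free_eval_cong[OF _ p']) (auto simp: series_novikov_simps)
  finally have "free_eval series_novikov ?g p = free_eval series_novikov ?g p'"
    unfolding z .
  then have "free_eval series_novikov ?g (p \<ominus>\<^bsub>free_nonassoc_algebra UNIV\<^esub> p') = \<zero>\<^bsub>series_novikov :: ('k, _) module\<^esub>"
    using pU p'U by (simp add: e.minus e.closed SN.diff_eq_zero_iff)
  then have "p \<ominus>\<^bsub>free_nonassoc_algebra UNIV\<^esub> p' \<in> novikov_ideal UNIV"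
    by (intro generic_series_free) (simp_all add: pU p'U series_novikov_simps)
  then show ?thesis using p' by blast
qed

text \<open>
  Assigning \<open>0\<close> to the missing generators reduces this to evaluations defined everywhere.
\<close>

lemma novikov_ideal_vanishes_extend:
  fixes B :: "('k::field, 'b) module"
  assumes "novikov_algebra B" "b \<in> V \<rightarrow> carrier B" "p \<in> carrier (free_nonassoc_algebra V)" "p \<in> novikov_ideal UNIV"
  shows "free_eval B b p = \<zero>\<^bsub>B\<^esub>"
proof -
  interpret B: novikov_algebra B by fact
  define b' where "b' v = (if v \<in> V then b v else \<zero>\<^bsub>B\<^esub>)" for v
  have "b' \<in> UNIV \<rightarrow> carrier B" using assms(2) by (auto simp: b'_def)
  from novikov_ideal_vanishes[OF assms(1) this assms(4)] have "free_eval B b' p = \<zero>\<^bsub>B\<^esub>" .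
  moreover have "free_eval B b p = free_eval B b' p"
    by (rule B.free_eval_cong[OF assms(2,3)]) (simp add: b'_def)
  ultimately show ?thesis by simp
qed

text \<open>
  The core of the Freiheitssatz: \<open>id(f)\<close> contains no nonzero element of the subalgebra generated by the other
  generators. Since \<open>f\<close> is not congruent to a polynomial without \<open>n\<close>, its differential polynomial involves
  \<open>n\<close> and vanishes at some \<open>v\<close> that is generic elsewhere. Evaluation at \<open>v\<close> annihilates \<open>id(f)\<close>, hence
  \<open>p\<close>; but on \<open>p\<close> it agrees with evaluation at generic series, which is faithful.
\<close>

lemma freiheitssatz_kernel:
  fixes V :: "nat set" and f p :: "nat magma \<Rightarrow> 'k::field_char_0"
  defines "N \<equiv> free_novikov V :: ('k, (nat magma \<Rightarrow> 'k) set) module"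
  assumes f: "f \<in> carrier (free_nonassoc_algebra V)"
    and notin: "free_class V f \<notin> generated_subalgebra N (novikov_gen V ` (V - {n}))"
    and p: "p \<in> carrier (free_nonassoc_algebra (V - {n}))"
    and ideal: "free_class V p \<in> generated_ideal N {free_class V f}"
  shows "p \<in> novikov_ideal UNIV"
proof -
  let ?F = "free_nonassoc_algebra V :: ('k, nat magma \<Rightarrow> 'k) module"
  let ?F' = "free_nonassoc_algebra (V - {n}) :: ('k, nat magma \<Rightarrow> 'k) module"
  have N: "novikov_algebra N" unfolding N_def by (rule free_novikov_is_novikov)
  interpret N: novikov_algebra N by (rule N)
  interpret c: algebra_map ?F N "free_class V" unfolding N_def by (rule free_class_map)
  have fU: "f \<in> carrier (free_nonassoc_algebra UNIV)" and pV: "p \<in> carrier ?F" and pU: "p \<in> carrier (free_nonassoc_algebra UNIV)"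
    using f p carrier_free_mono[of _ UNIV] carrier_free_mono[of "V - {n}" V] by blast+
  obtain d where d: "\<And>v. free_eval series_novikov v f = eval_at v d"
    using free_eval_normal_form[OF fU] by metis
  have gen: "novikov_gen V \<in> V \<rightarrow> carrier N"
    by (auto simp: novikov_gen_eq word_vec_closed intro!: c.closed)
  have "\<exists>M j. M \<in> Poly_Mapping.keys d \<and> (n, j) \<in># M"
  proof (rule ccontr)
    assume "\<not> ?thesis"
    then have "d \<in> dpolys_over {x. fst x \<noteq> n}" by (auto simp: dpolys_over_def)
    from eliminate_generator[OF f d this] obtain f'
      where f': "f' \<in> carrier ?F'" "f \<ominus>\<^bsub>free_nonassoc_algebra UNIV\<^esub> f' \<in> novikov_ideal UNIV" by blast
    have f'V: "f' \<in> carrier ?F" and f'U: "f' \<in> carrier (free_nonassoc_algebra UNIV)"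
      using f'(1) carrier_free_mono[of _ UNIV] carrier_free_mono[of "V - {n}" V] by blast+
    define b where "b v = (if v \<in> V then novikov_gen V v else \<zero>\<^bsub>N\<^esub>)" for v
    have b: "b \<in> UNIV \<rightarrow> carrier N" using gen by (auto simp: b_def)
    interpret e: algebra_map "free_nonassoc_algebra UNIV" N "free_eval N b"
      by (rule algebra_mapI[OF FC.A.nonassoc_algebra_axioms N.nonassoc_algebra_axioms N.free_eval_map[OF b]])
    have eb: "free_eval N b q = free_class V q" if "q \<in> carrier ?F" for q
    proof -
      have "free_eval N (novikov_gen V) q = free_eval N b q"
        by (rule N.free_eval_cong[OF gen that]) (simp add: b_def)
      then show ?thesis using free_eval_generator_class[OF that] by (simp add: N_def)
    qed
    have "free_eval N b (f \<ominus>\<^bsub>free_nonassoc_algebra UNIV\<^esub> f') = \<zero>\<^bsub>N\<^esub>"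
      by (rule novikov_ideal_vanishes[OF N b f'(2)])
    then have "free_class V f = free_class V f'"
      using fU f'U f f'V by (simp add: e.minus e.closed N.diff_eq_zero_iff eb c.closed)
    moreover have "free_class V f' \<in> generated_subalgebra N (novikov_gen V ` (V - {n}))"
    proof -
      interpret c': algebra_map ?F' N "free_class V"
        by (rule algebra_mapI[OF free_nonassoc_algebra_is_algebra N.nonassoc_algebra_axioms alg_map_restrict_free[OF c.map]]) auto
      have "novikov_gen V ` (V - {n}) \<subseteq> carrier N" using gen by auto
      note sub = c'.preimage_subalgebra[OF N.generated_subalgebra_is_subalgebra[OF this]]
      have "carrier ?F' \<subseteq> {q \<in> carrier ?F'. free_class V q \<in> generated_subalgebra N (novikov_gen V ` (V - {n}))}"
        by (rule carrier_free_generated[OF sub])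
          (auto simp: word_vec_closed novikov_gen_eq[symmetric] intro!: generated_subalgebra_superset[THEN subsetD])
      then show ?thesis using f'(1) by blast
    qed
    ultimately show False using notin by simp
  qed
  then obtain v where v: "eval_at v d = 0" "\<And>i. i \<noteq> n \<Longrightarrow> v i = generic_series i"
    using differential_freiheitssatz by metis
  have "v \<in> V \<rightarrow> carrier (series_novikov :: ('k, _) module)" by (simp add: series_novikov_simps)
  from free_novikov_extension[OF series_novikov_is_novikov this]
  obtain g where g: "alg_map N (series_novikov :: ('k, _) module) g"
    "\<And>q. q \<in> carrier ?F \<Longrightarrow> g (free_class V q) = free_eval series_novikov v q" unfolding N_def by blast
  interpret g: algebra_map N "series_novikov :: ('k, _) module" g
    by (rule algebra_mapI[OF N.nonassoc_algebra_axioms SN.nonassoc_algebra_axioms g(1)])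
  have "{free_class V f} \<subseteq> {x \<in> carrier N. g x = \<zero>\<^bsub>series_novikov :: ('k, _) module\<^esub>}"
    using f c.closed by (simp add: g(2) d v(1) series_novikov_simps)
  from generated_ideal_least[OF g.kernel_ideal this] ideal
  have "free_eval series_novikov v p = 0" using pV by (auto simp: g(2) series_novikov_simps)
  moreover have "free_eval series_novikov v p = free_eval series_novikov generic_series p"
    by (rule SN.free_eval_cong[OF _ p]) (auto simp: v(2) series_novikov_simps)
  ultimately show ?thesis using generic_series_free[OF pU] by simp
qed

theorem corollary7:
  fixes n :: nat
    and N :: "('k::field_char_0, (nat magma \<Rightarrow> 'k) set) module"
    and Q :: "('k, (nat magma \<Rightarrow> 'k) set set) module"
  assumes "N = free_novikov {1..n}"
    and "x = novikov_gen {1..n}"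
    and "f \<in> carrier N"
    and "f \<notin> generated_subalgebra N (x ` {1..<n})"
    and "Q = quotient_algebra N (generated_ideal N {f})"
    and "y = (\<lambda>i. generated_ideal N {f} +>\<^bsub>N\<^esub> x i)"
  shows "free_novikov_generators TYPE('b)
           (Q\<lparr>carrier := generated_subalgebra Q (y ` {1..<n})\<rparr>) {1..<n} y"
proof -
  define V I where "V = {1..n}" and "I = {1..<n}"
  have IV: "I = V - {n}" "I \<subseteq> V" by (auto simp: V_def I_def)
  let ?F = "free_nonassoc_algebra V :: ('k, nat magma \<Rightarrow> 'k) module"
  let ?F' = "free_nonassoc_algebra I :: ('k, nat magma \<Rightarrow> 'k) module"
  have N: "novikov_algebra N" unfolding assms(1) by (rule free_novikov_is_novikov)
  interpret N: novikov_algebra N by (rule N)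
  interpret c: algebra_map ?F N "free_class V" unfolding assms(1) V_def by (rule free_class_map)
  define G where "G = generated_ideal N {f}"
  have G: "is_algebra_ideal N G" unfolding G_def by (rule N.generated_ideal_is_ideal) (use assms(3) in simp)
  obtain f0 where f0: "f0 \<in> carrier ?F" "f = free_class V f0"
    using assms(3) free_class_surj unfolding assms(1) V_def by blast
  interpret Q: nonassoc_algebra Q unfolding assms(5) G_def[symmetric] by (rule N.quotient_is_algebra[OF G])
  have proj: "alg_map N Q (\<lambda>a. G +>\<^bsub>N\<^esub> a)" and proj_surj: "carrier Q = (\<lambda>a. G +>\<^bsub>N\<^esub> a) ` carrier N"
    unfolding assms(5) G_def[symmetric] by (rule N.quotient_proj_map[OF G], rule N.quotient_proj_surj[OF G])
  have Q_novikov: "novikov_algebra Q"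
    by (rule homomorphic_image_novikov[OF N Q.nonassoc_algebra_axioms proj proj_surj])
  define \<rho> where "\<rho> p = G +>\<^bsub>N\<^esub> free_class V p" for p
  have "alg_map ?F Q \<rho>" unfolding \<rho>_def[abs_def] by (rule alg_map_comp[OF c.map proj])
  then interpret r: algebra_map ?F' Q \<rho>
    by (intro algebra_mapI[OF free_nonassoc_algebra_is_algebra Q.nonassoc_algebra_axioms] alg_map_restrict_free[OF _ IV(2)])
  have y: "y i = \<rho> (word_vec (Gen i))" for i
    unfolding assms(2,6) \<rho>_def G_def novikov_gen_eq V_def ..
  have y_closed: "y ` I \<subseteq> carrier Q" by (auto simp: y word_vec_closed intro!: r.closed)
  define S where "S = generated_subalgebra Q (y ` I)"
  have S_sub: "is_subalgebra Q S" unfolding S_def by (rule Q.generated_subalgebra_is_subalgebra[OF y_closed])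
  let ?S = "Q\<lparr>carrier := S\<rparr>"
  have S_novikov: "novikov_algebra ?S" by (rule Q.subalgebra_novikov[OF Q_novikov S_sub])
  interpret S: novikov_algebra ?S by (rule S_novikov)
  have y_S: "y i \<in> S" if "i \<in> I" for i
    using generated_subalgebra_superset[of "y ` I" Q] that unfolding S_def by blast
  \<comment> \<open>\<open>S\<close> consists of the classes of polynomials in the first \<open>n - 1\<close> generators, so maps on \<open>S\<close> arise from maps on \<open>?F'\<close>\<close>
  have S_image: "S = \<rho> ` carrier ?F'"
  proof
    have "is_subalgebra ?F' (carrier ?F')" by (rule r.A.subalgebraI) (auto simp: r.A.smult_closed r.A.mult_closed)
    note image = r.image_subalgebra[OF this]
    show "S \<subseteq> \<rho> ` carrier ?F'"
      unfolding S_def by (rule generated_subalgebra_least[OF image]) (auto simp: y word_vec_closed)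
    have "carrier ?F' \<subseteq> {p \<in> carrier ?F'. \<rho> p \<in> S}"
      by (rule carrier_free_generated[OF r.preimage_subalgebra[OF S_sub]]) (use y_S in \<open>auto simp: word_vec_closed y\<close>)
    then show "\<rho> ` carrier ?F' \<subseteq> S" by blast
  qed
  have \<rho>_S: "alg_map ?F' ?S \<rho>"
    using r.map S_image by (auto simp: alg_map_def)
  interpret s: algebra_map ?F' ?S \<rho> by (rule algebra_mapI[OF r.A.nonassoc_algebra_axioms S.nonassoc_algebra_axioms \<rho>_S])
  have ker: "p \<in> novikov_ideal UNIV" if p: "p \<in> carrier ?F'" and z: "\<rho> p = \<zero>\<^bsub>?S\<^esub>" for p
  proof (rule freiheitssatz_kernel[OF f0(1)])
    show "free_class V f0 \<notin> generated_subalgebra (free_novikov V) (novikov_gen V ` (V - {n}))"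
      using assms(4) unfolding f0(2) assms(1,2) V_def[symmetric] I_def[symmetric] IV(1) .
    show "p \<in> carrier (free_nonassoc_algebra (V - {n}))" using p by (simp add: IV(1))
    have "free_class V p \<in> carrier N" using p carrier_free_mono[OF IV(2)] by (intro c.closed) blast
    moreover have "G +>\<^bsub>N\<^esub> free_class V p = \<zero>\<^bsub>quotient_algebra N G\<^esub>"
      using z by (simp add: \<rho>_def assms(5) G_def)
    ultimately have "free_class V p \<in> G" using N.quotient_proj_eq_zero_iff[OF G] by simp
    then show "free_class V p \<in> generated_ideal (free_novikov V) {free_class V f0}"
      unfolding G_def f0(2) assms(1) V_def .
  qed
  show ?thesis
    unfolding free_novikov_generators_def I_def[symmetric] S_def[symmetric]
  proof (intro conjI allI impI)
    show "novikov_algebra ?S" by (rule S_novikov)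
    show "y \<in> I \<rightarrow> carrier ?S" using y_S by simp
    fix B :: "('k, 'b) module" and b
    assume B: "novikov_algebra B" and b: "b \<in> I \<rightarrow> carrier B"
    interpret B: novikov_algebra B by (rule B)
    have eval_map: "alg_map ?F' B (free_eval B b)" by (rule B.free_eval_map[OF b])
    have "\<exists>h. alg_map ?S B h \<and> (\<forall>p\<in>carrier ?F'. h (\<rho> p) = free_eval B b p)"
    proof (rule s.factor_through[OF B.nonassoc_algebra_axioms eval_map])
      show "carrier ?S = \<rho> ` carrier ?F'" using S_image by simp
      show "free_eval B b p = \<zero>\<^bsub>B\<^esub>" if "p \<in> carrier ?F'" "\<rho> p = \<zero>\<^bsub>?S\<^esub>" for p
        by (rule novikov_ideal_vanishes_extend[OF B b that(1) ker[OF that]])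
    qed
    then obtain h where h: "alg_map ?S B h" "\<And>p. p \<in> carrier ?F' \<Longrightarrow> h (\<rho> p) = free_eval B b p" by blast
    show "\<exists>!h. h \<in> algebra_hom ?S B \<and> (\<forall>i\<in>I. h (y i) = b i)"
    proof (rule ex1I[of _ "restrict h S"])
      have "alg_map ?S B (restrict h S)"
        using h(1) S.mult_closed S.a_closed S.smult_closed by (auto simp: alg_map_def)
      moreover have "h (y i) = b i" if "i \<in> I" for i
        using that by (simp add: y h(2) word_vec_closed B.free_eval_word[OF b])
      ultimately show "restrict h S \<in> algebra_hom ?S B \<and> (\<forall>i\<in>I. restrict h S (y i) = b i)"
        using y_S by (simp add: algebra_hom_iff)
    next
      fix h' assume h': "h' \<in> algebra_hom ?S B \<and> (\<forall>i\<in>I. h' (y i) = b i)"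
      have h'_map: "alg_map ?F' B (\<lambda>p. h' (\<rho> p))"
        using h' by (intro alg_map_comp[OF \<rho>_S]) (simp add: algebra_hom_iff)
      interpret e: algebra_map ?F' B "free_eval B b"
        by (rule algebra_mapI[OF r.A.nonassoc_algebra_axioms B.nonassoc_algebra_axioms eval_map])
      have "carrier ?F' \<subseteq> {p \<in> carrier ?F'. free_eval B b p = h' (\<rho> p)}"
        by (rule carrier_free_generated[OF e.equalizer_subalgebra[OF algebra_mapI[OF r.A.nonassoc_algebra_axioms B.nonassoc_algebra_axioms h'_map]]])
          (use h' in \<open>simp add: word_vec_closed B.free_eval_word[OF b] flip: y\<close>)
      then have "h' s = h s" if "s \<in> S" for s using that h(2) unfolding S_image by auto
      moreover have "h' \<in> extensional S" using h' by (simp add: algebra_hom_iff)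
      ultimately show "h' = restrict h S" by (auto simp: extensional_def restrict_def)
    qed
  qed
qed

end
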